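(* Let $(S_n)$ be the elephant random walk with memory parameter $p$ in the diffusive regime $0\le p<3/4$ and first-step parameter $q\in[0,1]$. Then $$\sqrt{\log n}\,\bigl(\widehat{p}_n-p\bigr)\longrightarrow\mathcal{N}\Bigl(0,\frac{3-4p}{4}\Bigr)\quad\text{in distribution as }n\to\infty,$$ which means that $\widehat{p}_n$ is an asymptotically efficient estimator of $p$, in the sense that the asymptotic variance equals the inverse $1/I(p)$ of the asymptotic Fisher information $I(p)=\frac{4}{3-4p}$. In particular, $$2\sqrt{\log n}\,\frac{\widehat{p}_n-p}{\sqrt{3-4\widehat{p}_n}}\longrightarrow\mathcal{N}(0,1)\quad\text{in distribution as }n\to\infty.$$
   Context: Elephant random walk (ERW): fix $q\in[0,1]$ and $p\in[0,1]$. Set $S_0=0$. The first step $X_1$ equals $+1$ with probability $q$ and $-1$ with probability $1-q$. For each $n\ge 1$, an integer $k$ is chosen uniformly at random among $1,\dots,n$ (independently of the past), and $X_{n+1}=X_k$ with probability $p$, $X_{n+1}=-X_k$ with probability $1-p$. The position is $S_{n+1}=S_n+X_{n+1}$, so $S_n=X_1+\cdots+X_n$. Equivalently, with $\mathcal{F}_n=\sigma(X_1,\dots,X_n)$, $\mathbb{P}(X_{n+1}=1\mid\mathcal{F}_n)=\frac12\bigl(1+(2p-1)\frac{S_n}{n}\bigr)$ and $\mathbb{P}(X_{n+1}=-1\mid\mathcal{F}_n)=\frac12\bigl(1-(2p-1)\frac{S_n}{n}\bigr)$ for all $n\ge1$. Estimator: for all $n\ge2$, $$\widehat{p}_n=\frac{\sum_{k=1}^{n-1}\frac{S_k}{k}\bigl(X_{k+1}+\frac{S_k}{k}\bigr)}{2\sum_{k=1}^{n-1}\bigl(\frac{S_k}{k}\bigr)^2}.$$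 $\mathcal{N}(0,\sigma^2)$ denotes the centered Gaussian law with variance $\sigma^2$. *)

theory Defs
  imports "HOL-Probability.Probability"
begin

text \<open>
  The elephant random walk. At time \<open>n + 1\<close> (with \<open>n \<ge> 1\<close>) the elephant recalls the uniformly
  chosen instant \<open>K n \<in> {1..n}\<close> and repeats the step made then if \<open>B n\<close> holds (probability
  \<open>p\<close>), and otherwise makes the opposite step. The pair \<open>(K n, B n)\<close> has the product law, and it
  is independent of the past \<open>(X 1, \<dots>, X n)\<close>. The values \<open>X 0\<close>, \<open>K 0\<close> and \<open>B 0\<close>
  are irrelevant.
\<close>

locale elephant_random_walk = prob_space M
  for M :: "'a measure" and p q :: real and X :: "nat \<Rightarrow> 'a \<Rightarrow> real"
    and K :: "nat \<Rightarrow> 'a \<Rightarrow> nat" and B :: "nat \<Rightarrow> 'a \<Rightarrow> bool" +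
  assumes p_bounds: "0 \<le> p" "p \<le> 1"
    and q_bounds: "0 \<le> q" "q \<le> 1"
    and step_measurable: "\<And>n. n \<ge> 1 \<Longrightarrow> random_variable borel (X n)"
    and first_step: "prob {\<omega> \<in> space M. X 1 \<omega> = 1} = q" "prob {\<omega> \<in> space M. X 1 \<omega> = -1} = 1 - q"
    and choice_measurable: "\<And>n. n \<ge> 1 \<Longrightarrow>
      random_variable (count_space UNIV) (\<lambda>\<omega>. (K n \<omega>, B n \<omega>))"
    and choice_law: "\<And>n. n \<ge> 1 \<Longrightarrow>
      distr M (count_space UNIV) (\<lambda>\<omega>. (K n \<omega>, B n \<omega>))
        = measure_pmf (pair_pmf (pmf_of_set {1..n}) (bernoulli_pmf p))"
    and choice_indep: "\<And>n. n \<ge> 1 \<Longrightarrow>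
      indep_set (sets (vimage_algebra (space M) (\<lambda>\<omega>. (K n \<omega>, B n \<omega>)) (count_space UNIV)))
        (sets (vimage_algebra (space M) (\<lambda>\<omega>. \<lambda>i\<in>{1..n}. X i \<omega>) (Pi\<^sub>M {1..n} (\<lambda>_. borel))))"
    and next_step: "\<And>n. n \<ge> 1 \<Longrightarrow>
      AE \<omega> in M. X (n + 1) \<omega> = (if B n \<omega> then X (K n \<omega>) \<omega> else - X (K n \<omega>) \<omega>)"

definition position :: "(nat \<Rightarrow> real) \<Rightarrow> nat \<Rightarrow> real" where
  "position x n = (\<Sum>k=1..n. x k)"

definition p_hat :: "(nat \<Rightarrow> real) \<Rightarrow> nat \<Rightarrow> real" where
  "p_hat x n =
     (\<Sum>k=1..<n. position x k / k * (x (k + 1) + position x k / k))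
       / (2 * (\<Sum>k=1..<n. (position x k / k)\<^sup>2))"

text \<open>
  The probability that the first \<open>n\<close> steps are \<open>x 1, \<dots>, x n \<in> {-1, 1}\<close> (for \<open>n \<ge> 1\<close>) when the
  memory parameter is \<open>t\<close>: a product of the law of the first step and of the conditional
  probabilities \<open>P(X (k+1) = \<plusminus>1 | X 1, \<dots>, X k) = (1 \<plusminus> (2t - 1) S k / k) / 2\<close>.
\<close>

definition likelihood :: "real \<Rightarrow> (nat \<Rightarrow> real) \<Rightarrow> nat \<Rightarrow> real \<Rightarrow> real" where
  "likelihood q x n t =
     (1 + (2 * q - 1) * x 1) / 2
       * (\<Prod>k=1..<n. (1 + (2 * t - 1) * x (k + 1) * (position x k / k)) / 2)"

text \<open>
  The likelihood of a path is a polynomial in \<open>t\<close>, which also makes sense for \<open>t < 0\<close>; at the boundary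
  point \<open>p = 0\<close> the score below is the derivative of its logarithm, which exists for every path
  of positive probability.
\<close>

definition score :: "real \<Rightarrow> (nat \<Rightarrow> real) \<Rightarrow> nat \<Rightarrow> real \<Rightarrow> real" where
  "score q x n p = deriv (\<lambda>t. ln (likelihood q x n t)) p"

definition fisher_info ::
  "'a measure \<Rightarrow> real \<Rightarrow> real \<Rightarrow> (nat \<Rightarrow> 'a \<Rightarrow> real) \<Rightarrow> nat \<Rightarrow> real" where
  "fisher_info M p q X n = (\<integral>\<omega>. (score q (\<lambda>k. X k \<omega>) n p)\<^sup>2 \<partial>M)"

text \<open>
  The information carried by the first \<open>n\<close> steps grows like \<open>ln n\<close>, the square of the rate
  in the central limit theorem for the estimator.
\<close>

definition asymptotic_fisher_info ::
  "'a measure \<Rightarrow> real \<Rightarrow> real \<Rightarrow> (nat \<Rightarrow> 'a \<Rightarrow> real) \<Rightarrow> real" where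
  "asymptotic_fisher_info M p q X = lim (\<lambda>n. fisher_info M p q X n / ln n)"

text \<open>The centered Gaussian law with variance \<open>v > 0\<close>; the library's density is
  parametrised by the standard deviation.\<close>

definition centered_gaussian :: "real \<Rightarrow> real measure" where
  "centered_gaussian v = density lborel (\<lambda>x. ennreal (normal_density 0 (sqrt v) x))"

definition converges_in_law ::
  "'a measure \<Rightarrow> (nat \<Rightarrow> 'a \<Rightarrow> real) \<Rightarrow> real measure \<Rightarrow> bool" where
  "converges_in_law M Y \<mu> \<longleftrightarrow> weak_conv_m (\<lambda>n. distr M borel (Y n)) \<mu>"

end

theory Submission
  imports Defs "HOL-Real_Asymp.Real_Asymp"
begin

text \<open>
  Put \<open>a = 2 p - 1 < 1/2\<close> and \<open>Y k = S k / k\<close>. The innovations \<open>X (k+1) - a Y k\<close> are martingale differences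
  with conditional variance \<open>1 - a\<^sup>2 (Y k)\<^sup>2\<close>, and \<open>p_hat n - p = N n / (2 A n)\<close> with
  \<open>N n = \<Sum>k<n. Y k (X (k+1) - a Y k)\<close> and \<open>A n = \<Sum>k<n. (Y k)\<^sup>2\<close>. Expanding \<open>(S (n+1))\<^sup>2 / (n+1)\<close> expresses
  \<open>(1 - 2 a) A n\<close> as a harmonic sum plus terms that are small in \<open>L\<^sup>1\<close>, hence \<open>A n / ln n \<longlonglongrightarrow> 1 / (3 - 4 p)\<close>.
  As \<open>E (Y k)\<^sup>4 = O(k\<^sup>-\<^sup>2)\<close>, the conditional variance of \<open>N n\<close> is asymptotically \<open>A n\<close>, and comparing
  \<open>exp (i t N n / sqrt (ln n))\<close> with its conditional Gaussian counterpart step by step gives the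
  limit law of \<open>N n\<close>; Slutsky's argument transfers it to the estimator. The score is a martingale
  with increments of conditional variance \<open>4 (Y k)\<^sup>2 / (1 - a\<^sup>2 (Y k)\<^sup>2)\<close>, so the Fisher information
  is \<open>4 E (A n)\<close> up to a bounded error.
\<close>

subsection \<open>Characteristic functions\<close>

text \<open>No conditional expectation with respect to a sigma-algebra is formed. \<open>X\<close>
  is replaced by \<open>path\<close>, which equals it almost surely and is +1 or -1 everywhere; the
  first \<open>n\<close> steps then take finitely many values, every function of them is simple, and
  conditioning becomes the two-term average \<open>next_mean\<close>. The transition law itself is
  derived from the recall mechanism in \<open>expectation_next\<close>. All limits are taken in L^1,
  which suffices for Slutsky's argument. The condition \<open>p < 3 / 4\<close>, that is a < 1/2,
  enters in the moment recursions, where E (S n)^j gains a factor 1 + j a / n per step against the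
  target order n^(j/2), and as positivity of 1 - 2 a. Two obstacles shape the rest. The sum of
  conditional variances is random, with no bound uniform in \<open>n\<close>, whereas the
  exponential comparison needs one; hence the cut-off weights. At p = 0 the denominators 1 - a^2 (Y
  k)^2 can degenerate; there the walk keeps distance at least 2 from -k and k once k is at least 2,
  and the sixth moment pays for the resulting factor k.\<close>

lemma iexp_lipschitz: "cmod (iexp x - iexp y) \<le> \<bar>x - y\<bar>"
proof -
  have "iexp x - iexp y = iexp y * (iexp (x - y) - 1)"
    by (simp add: exp_diff algebra_simps)
  then have "cmod (iexp x - iexp y) = cmod (iexp (x - y) - 1)"
    by (simp add: norm_mult)
  also have "\<dots> \<le> \<bar>x - y\<bar>"
    using iexp_approx1[of "x - y" 0] by simp
  finally show ?thesis .
qed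

lemma cmod_iexp_diff_le_2: "cmod (iexp x - iexp y) \<le> 2"
  using norm_triangle_ineq4[of "iexp x" "iexp y"] by simp

text \<open>Scaling the standard normal law; its known characteristic function then yields that of
  every centered Gaussian.\<close>

lemma centered_gaussian_eq_distr:
  assumes "v > 0"
  shows "centered_gaussian v = distr std_normal_distribution borel (\<lambda>x. sqrt v * x)"
proof -
  interpret std: prob_space std_normal_distribution
    using prob_space_normal_density by simp
  have "distributed std_normal_distribution lborel (\<lambda>x. x) std_normal_density"
    unfolding distributed_def by (auto simp: distr_id2)
  from std.normal_density_affine[OF this, of "sqrt v" 0] assms
  have "distributed std_normal_distribution lborel (\<lambda>x. sqrt v * x) (normal_density 0 (sqrt v))"
    by simp
  then have "distr std_normal_distribution lborel (\<lambda>x. sqrt v * x) = centered_gaussian v"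
    unfolding distributed_def centered_gaussian_def by simp
  then show ?thesis
    by (metis distr_cong sets_lborel)
qed

lemma real_distribution_centered_gaussian:
  assumes "v > 0"
  shows "real_distribution (centered_gaussian v)"
proof -
  interpret std: prob_space std_normal_distribution
    using prob_space_normal_density by simp
  show ?thesis
    unfolding centered_gaussian_eq_distr[OF assms] by (rule std.real_distribution_distr) simp
qed

lemma char_centered_gaussian:
  assumes "v > 0"
  shows "char (centered_gaussian v) t = exp (- (v * t\<^sup>2) / 2)"
proof -
  have "char (centered_gaussian v) t = char std_normal_distribution (t * sqrt v)"
    unfolding centered_gaussian_eq_distr[OF assms] char_def
    by (subst integral_distr) (simp_all add: algebra_simps)
  also have "\<dots> = exp (- ((t * sqrt v)\<^sup>2) / 2)"
    by (simp add: char_std_normal_distribution)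
  finally show ?thesis
    using assms by (simp add: power_mult_distrib mult.commute)
qed

text \<open>
  On the event where \<open>(U n, V n)\<close> is \<open>\<eta>\<close>-close to \<open>(u, v)\<close> the characteristic functions differ by
  at most \<open>\<bar>t\<bar> * \<delta> * E \<bar>Z n\<bar>\<close>; Markov's inequality bounds the probability of the complement.
\<close>

lemma (in prob_space) char_slutsky:
  fixes Z U V :: "nat \<Rightarrow> 'a \<Rightarrow> real" and g :: "real \<times> real \<Rightarrow> real"
  assumes g: "isCont g (u, v)"
    and Z: "\<And>n. integrable M (Z n)" "\<forall>\<^sub>F n in sequentially. expectation (\<lambda>\<omega>. \<bar>Z n \<omega>\<bar>) \<le> C"
    and U: "\<And>n. integrable M (U n)" "(\<lambda>n. expectation (\<lambda>\<omega>. \<bar>U n \<omega> - u\<bar>)) \<longlonglongrightarrow> 0"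
    and V: "\<And>n. integrable M (V n)" "(\<lambda>n. expectation (\<lambda>\<omega>. \<bar>V n \<omega> - v\<bar>)) \<longlonglongrightarrow> 0"
    and meas: "\<And>n. (\<lambda>\<omega>. g (U n \<omega>, V n \<omega>)) \<in> borel_measurable M"
  shows "(\<lambda>n. char (distr M borel (\<lambda>\<omega>. Z n \<omega> * g (U n \<omega>, V n \<omega>))) t
              - char (distr M borel (Z n)) (t * g (u, v))) \<longlonglongrightarrow> 0"
proof (rule tendstoI)
  fix e :: real assume e: "e > 0"
  define W where "W n \<omega> = Z n \<omega> * g (U n \<omega>, V n \<omega>)" for n \<omega>
  \<comment> \<open>The \<open>+ 1\<close> keeps the denominator positive; \<open>\<delta>\<close>
    makes the first error term smaller than \<open>e / 2\<close>.\<close>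
  define \<delta> where "\<delta> = e / (2 * (\<bar>t\<bar> * \<bar>C\<bar> + 1))"
  have D: "\<bar>t\<bar> * \<bar>C\<bar> + 1 > 0" by (rule add_nonneg_pos) auto
  have \<delta>: "\<delta> > 0" using e D by (simp add: \<delta>_def)
  have tC: "\<bar>t\<bar> * \<delta> * \<bar>C\<bar> < e / 2"
  proof -
    have "\<bar>t\<bar> * \<bar>C\<bar> * \<delta> < (\<bar>t\<bar> * \<bar>C\<bar> + 1) * \<delta>" using \<delta> by (simp add: algebra_simps)
    also have "\<dots> = e / 2" unfolding \<delta>_def using D by (simp add: field_simps)
    finally show ?thesis by (simp add: mult_ac)
  qed
  from g[unfolded continuous_at_eps_delta, rule_format, OF \<delta>] obtain \<eta>
    where \<eta>: "\<eta> > 0" "\<And>x. dist x (u, v) < \<eta> \<Longrightarrow> dist (g x) (g (u, v)) < \<delta>" by blast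
  note [measurable] = borel_measurable_integrable[OF Z(1)] borel_measurable_integrable[OF U(1)]
    borel_measurable_integrable[OF V(1)] meas
  have W_meas[measurable]: "W n \<in> borel_measurable M" for n unfolding W_def by measurable
  \<comment> \<open>Far from \<open>(u, v)\<close> the trivial bound 2 is at most
    \<open>2 / \<eta>\<close> times the distance, so Markov's inequality takes the form of one
    pointwise estimate to be integrated.\<close>
  have pointwise: "cmod (iexp (t * W n \<omega>) - iexp (t * g (u, v) * Z n \<omega>))
      \<le> \<bar>t\<bar> * \<delta> * \<bar>Z n \<omega>\<bar> + 2 / \<eta> * (\<bar>U n \<omega> - u\<bar> + \<bar>V n \<omega> - v\<bar>)" for n \<omega>
  proof (cases "dist (U n \<omega>, V n \<omega>) (u, v) < \<eta>")
    case True
    have "cmod (iexp (t * W n \<omega>) - iexp (t * g (u, v) * Z n \<omega>))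
        \<le> \<bar>t * W n \<omega> - t * g (u, v) * Z n \<omega>\<bar>" by (rule iexp_lipschitz)
    also have "\<dots> = \<bar>t\<bar> * \<bar>Z n \<omega>\<bar> * dist (g (U n \<omega>, V n \<omega>)) (g (u, v))"
      by (simp add: W_def dist_real_def abs_mult[symmetric] algebra_simps)
    also have "\<dots> \<le> \<bar>t\<bar> * \<bar>Z n \<omega>\<bar> * \<delta>"
      using \<eta>(2)[OF True] by (intro mult_left_mono) auto
    also have "\<dots> \<le> \<bar>t\<bar> * \<delta> * \<bar>Z n \<omega>\<bar> + 2 / \<eta> * (\<bar>U n \<omega> - u\<bar> + \<bar>V n \<omega> - v\<bar>)"
      using \<eta>(1) by (simp add: mult_ac)
    finally show ?thesis .
  next
    case False
    have "\<eta> \<le> dist (U n \<omega>, V n \<omega>) (u, v)" using False by simp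
    also have "\<dots> \<le> \<bar>U n \<omega> - u\<bar> + \<bar>V n \<omega> - v\<bar>"
      using sqrt_sum_squares_le_sum_abs[of "U n \<omega> - u" "V n \<omega> - v"]
      by (simp add: dist_Pair_Pair dist_real_def)
    finally have "2 \<le> 2 / \<eta> * (\<bar>U n \<omega> - u\<bar> + \<bar>V n \<omega> - v\<bar>)"
      using \<eta>(1) by (simp add: field_simps)
    moreover have "0 \<le> \<bar>t\<bar> * \<delta> * \<bar>Z n \<omega>\<bar>" using \<delta> by simp
    ultimately show ?thesis
      using cmod_iexp_diff_le_2[of "t * W n \<omega>" "t * g (u, v) * Z n \<omega>"] by linarith
  qed
  have bound: "cmod (char (distr M borel (W n)) t - char (distr M borel (Z n)) (t * g (u, v)))
      \<le> \<bar>t\<bar> * \<delta> * expectation (\<lambda>\<omega>. \<bar>Z n \<omega>\<bar>)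
        + 2 / \<eta> * (expectation (\<lambda>\<omega>. \<bar>U n \<omega> - u\<bar>) + expectation (\<lambda>\<omega>. \<bar>V n \<omega> - v\<bar>))" for n
  proof -
    have "char (distr M borel (W n)) t - char (distr M borel (Z n)) (t * g (u, v))
        = (\<integral>\<omega>. (iexp (t * W n \<omega>) - iexp (t * g (u, v) * Z n \<omega>)) \<partial>M)"
      unfolding char_def
      by (subst Bochner_Integration.integral_diff)
        (auto simp: integral_distr intro!: integrable_iexp simp del: of_real_mult)
    also have "cmod \<dots> \<le> (\<integral>\<omega>. cmod (iexp (t * W n \<omega>) - iexp (t * g (u, v) * Z n \<omega>)) \<partial>M)"
      by (rule integral_norm_bound)
    also have "\<dots> \<le> (\<integral>\<omega>. \<bar>t\<bar> * \<delta> * \<bar>Z n \<omega>\<bar> + 2 / \<eta> * (\<bar>U n \<omega> - u\<bar> + \<bar>V n \<omega> - v\<bar>) \<partial>M)"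
      using Z(1) U(1) V(1)
      by (intro integral_mono pointwise)
        (auto intro!: integrable_iexp integrable_norm Bochner_Integration.integrable_diff
          Bochner_Integration.integrable_add integrable_mult_right integrable_abs simp del: of_real_mult)
    also have "\<dots> = \<bar>t\<bar> * \<delta> * expectation (\<lambda>\<omega>. \<bar>Z n \<omega>\<bar>)
        + 2 / \<eta> * (expectation (\<lambda>\<omega>. \<bar>U n \<omega> - u\<bar>) + expectation (\<lambda>\<omega>. \<bar>V n \<omega> - v\<bar>))"
      using Z(1) U(1) V(1) by simp
    finally show ?thesis .
  qed
  have "(\<lambda>n. 2 / \<eta> * (expectation (\<lambda>\<omega>. \<bar>U n \<omega> - u\<bar>) + expectation (\<lambda>\<omega>. \<bar>V n \<omega> - v\<bar>)))
      \<longlonglongrightarrow> 2 / \<eta> * (0 + 0)"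
    using U(2) V(2) by (intro tendsto_intros)
  then have "\<forall>\<^sub>F n in sequentially.
      2 / \<eta> * (expectation (\<lambda>\<omega>. \<bar>U n \<omega> - u\<bar>) + expectation (\<lambda>\<omega>. \<bar>V n \<omega> - v\<bar>)) < e / 2"
    using e by (intro order_tendstoD(2)[where y = "2 / \<eta> * (0 + 0)"]) auto
  with Z(2) show "\<forall>\<^sub>F n in sequentially. dist (char (distr M borel
      (\<lambda>\<omega>. Z n \<omega> * g (U n \<omega>, V n \<omega>))) t - char (distr M borel (Z n)) (t * g (u, v))) 0 < e"
  proof eventually_elim
    case (elim n)
    have "\<bar>t\<bar> * \<delta> * expectation (\<lambda>\<omega>. \<bar>Z n \<omega>\<bar>) \<le> \<bar>t\<bar> * \<delta> * \<bar>C\<bar>"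
      using elim(1) \<delta> by (intro mult_left_mono) auto
    with bound[of n] elim(2) tC
    have "cmod (char (distr M borel (W n)) t - char (distr M borel (Z n)) (t * g (u, v))) < e"
      by linarith
    then show ?case by (simp add: W_def[abs_def])
  qed
qed

text \<open>\<open>D * n ^ (m + 1)\<close> is a supersolution: by Bernoulli's inequality it grows by
  a factor of at least 1 + (m + 1) / n, and the surplus (m + 1 - \<beta>) / n absorbs the forcing
  term. For E (S n)^j it is applied with \<beta> = j b and m + 1 = j / 2, where
  \<open>\<beta> < m + 1\<close> reads b < 1/2.\<close>

lemma polynomial_growth:
  fixes e :: "nat \<Rightarrow> real"
  assumes rec: "\<And>n. n \<ge> 1 \<Longrightarrow> e (Suc n) \<le> (1 + \<beta> / n) * e n + C * real n ^ m"
    and "0 \<le> \<beta>" "\<beta> < m + 1"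
  obtains D where "D \<ge> 0" "\<And>n. n \<ge> 1 \<Longrightarrow> e n \<le> D * real n ^ Suc m"
proof -
  \<comment> \<open>\<open>C / (m + 1 - \<beta>)\<close> is the least D with
    \<open>\<beta> * D + C \<le> (m + 1) * D\<close>; \<open>e 1\<close> starts the
    induction.\<close>
  define D where "D = max (max (e 1) 0) (C / (m + 1 - \<beta>))"
  have D: "D \<ge> 0" "e 1 \<le> D" "C / (m + 1 - \<beta>) \<le> D"
    by (auto simp: D_def)
  from D(3) have D3: "C \<le> (m + 1 - \<beta>) * D"
    using assms(3) by (simp add: pos_divide_le_eq mult.commute)
  have "e n \<le> D * real n ^ Suc m" if "n \<ge> 1" for n
    using that
  proof (induction n rule: dec_induct)
    case base
    then show ?case using D by simp
  next
    case (step n)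
    have n: "real n > 0" using step by simp
    have "e (Suc n) \<le> (1 + \<beta> / n) * (D * real n ^ Suc m) + C * real n ^ m"
      using rec[of n] step assms(2)
      by (smt (verit) mult_left_mono divide_nonneg_nonneg of_nat_0_le_iff)
    also have "\<dots> = D * real n ^ Suc m + (\<beta> * D + C) * real n ^ m"
      using n by (simp add: field_simps)
    also have "\<dots> \<le> D * real n ^ Suc m + ((m + 1) * D) * real n ^ m"
      using D3 n by (intro add_left_mono mult_right_mono) (auto simp: algebra_simps)
    also have "\<dots> = D * (real n ^ Suc m * (1 + real (Suc m) * (1 / n)))"
      using n by (simp add: field_simps)
    also have "\<dots> \<le> D * (real n ^ Suc m * (1 + 1 / n) ^ Suc m)"
      using D(1) n by (intro mult_left_mono Bernoulli_inequality) (auto intro: order_trans[of _ 0])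
    also have "real n ^ Suc m * (1 + 1 / n) ^ Suc m = (real n * (1 + 1 / n)) ^ Suc m"
      by (rule power_mult_distrib[symmetric])
    also have "real n * (1 + 1 / n) = real (Suc n)"
      using n by (simp add: field_simps)
    finally show ?case .
  qed
  with D(1) show thesis by (rule that)
qed

subsection \<open>One-step conditional expectations\<close>

text \<open>Truncation fills with zeros instead of shortening, so paths of all lengths share one
  type and the truncated sign paths form a finite set.\<close>

definition restrict_path :: "nat \<Rightarrow> (nat \<Rightarrow> real) \<Rightarrow> nat \<Rightarrow> real" where
  "restrict_path n x k = (if k \<in> {1..n} then x k else 0)"

definition sign_paths :: "nat \<Rightarrow> (nat \<Rightarrow> real) set" where
  "sign_paths n = {x. \<forall>k. (k \<in> {1..n} \<longrightarrow> x k \<in> {-1, 1}) \<and> (k \<notin> {1..n} \<longrightarrow> x k = 0)}"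

text \<open>Dependence on the first \<open>n\<close> coordinates alone, encoded as invariance under
  truncation; it plays the role of measurability with respect to the past.\<close>

definition adapted :: "nat \<Rightarrow> ((nat \<Rightarrow> real) \<Rightarrow> 'b) \<Rightarrow> bool" where
  "adapted n F \<longleftrightarrow> (\<forall>x. F (restrict_path n x) = F x)"

abbreviation mean_position :: "(nat \<Rightarrow> real) \<Rightarrow> nat \<Rightarrow> real" where
  "mean_position x k \<equiv> position x k / real k"

lemma restrict_path_nth [simp]: "1 \<le> k \<Longrightarrow> k \<le> n \<Longrightarrow> restrict_path n x k = x k"
  by (simp add: restrict_path_def)

lemma restrict_path_restrict_path [simp]:
  "m \<le> n \<Longrightarrow> restrict_path m (restrict_path n x) = restrict_path m x"
  by (auto simp: restrict_path_def fun_eq_iff)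

lemma restrict_path_Suc_upd:
  "restrict_path (Suc n) (x(Suc n := s)) = (restrict_path n x)(Suc n := s)"
  by (auto simp: restrict_path_def fun_eq_iff)

lemma position_restrict_path [simp]: "k \<le> n \<Longrightarrow> position (restrict_path n x) k = position x k"
  by (auto simp: position_def intro!: sum.cong)

lemma position_Suc: "position x (Suc n) = position x n + x (Suc n)"
  by (simp add: position_def)

lemma position_upd [simp]: "k \<le> n \<Longrightarrow> position (x(Suc n := s)) k = position x k"
  by (auto simp: position_def intro!: sum.cong)

lemma finite_sign_paths: "finite (sign_paths n)"
  unfolding sign_paths_def by (rule finite_set_of_finite_funs) auto

lemma adaptedD: "adapted n F \<Longrightarrow> F (restrict_path n x) = F x"
  by (simp add: adapted_def)

lemma adapted_mono: "adapted m F \<Longrightarrow> m \<le> n \<Longrightarrow> adapted n F"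
  by (metis adapted_def restrict_path_restrict_path)

lemma adapted_upd:
  assumes "adapted n F"
  shows "F (x(Suc n := s)) = F x"
proof -
  have "restrict_path n (x(Suc n := s)) = restrict_path n x"
    by (auto simp: restrict_path_def fun_eq_iff)
  then show ?thesis using assms unfolding adapted_def by metis
qed

section \<open>Conditioning on the first \<open>n\<close> steps as an explicit operator\<close>

context elephant_random_walk
begin

abbreviation memory :: real where "memory \<equiv> 2 * p - 1"

text \<open>A version of \<open>X\<close> with values +1 and -1 on the whole space; \<open>X\<close>
  itself has them only almost surely. Bounds such as |S n| \<le> n then hold pointwise.\<close>

definition path :: "'a \<Rightarrow> nat \<Rightarrow> real" where
  "path \<omega> k = (if X k \<omega> = 1 then 1 else -1)"

text \<open>The conditional expectation of \<open>F\<close> given the first \<open>n\<close> steps,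
  as a function of the path. The value type is general because characteristic functions need complex
  \<open>F\<close>.\<close>

definition next_mean :: "nat \<Rightarrow> ((nat \<Rightarrow> real) \<Rightarrow> 'b::real_vector) \<Rightarrow> (nat \<Rightarrow> real) \<Rightarrow> 'b" where
  "next_mean n F x = ((1 + memory * mean_position x n) / 2) *\<^sub>R F (x(Suc n := 1))
     + ((1 - memory * mean_position x n) / 2) *\<^sub>R F (x(Suc n := -1))"

lemma path_cases: "path \<omega> k = 1 \<or> path \<omega> k = -1"
  by (simp add: path_def)

lemma path_sq [simp]: "(path \<omega> k)\<^sup>2 = 1" and abs_path [simp]: "\<bar>path \<omega> k\<bar> = 1"
  by (simp_all add: path_def)

lemma restrict_path_in_sign_paths: "restrict_path n (path \<omega>) \<in> sign_paths n"
  by (auto simp: sign_paths_def restrict_path_def path_def)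

text \<open>Membership in the generated sigma-algebra, and not just in \<open>events\<close>, is
  what \<open>choice_indep\<close> asks for.\<close>

lemma past_event:
  assumes "x \<in> sign_paths n"
  shows "{\<omega> \<in> space M. restrict_path n (path \<omega>) = x}
    \<in> sets (vimage_algebra (space M) (\<lambda>\<omega>. \<lambda>i\<in>{1..n}. X i \<omega>) (Pi\<^sub>M {1..n} (\<lambda>_. borel)))"
proof -
  \<comment> \<open>\<open>path\<close> is -1 wherever \<open>X i\<close> differs from 1, so the
    coordinate set is the complement of {1} rather than {-1}.\<close>
  define A where "A = (\<Pi>\<^sub>E i\<in>{1..n}. if x i = 1 then {1} else - {1 :: real})"
  have A: "A \<in> sets (Pi\<^sub>M {1..n} (\<lambda>_. borel))"
    unfolding A_def by (intro sets_PiM_I_finite) auto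
  have "restrict_path n (path \<omega>) = x \<longleftrightarrow> (\<lambda>i\<in>{1..n}. X i \<omega>) \<in> A" for \<omega>
  proof -
    have "restrict_path n (path \<omega>) = x \<longleftrightarrow> (\<forall>i\<in>{1..n}. path \<omega> i = x i)"
      using assms by (auto simp: sign_paths_def restrict_path_def fun_eq_iff)
    also have "\<dots> \<longleftrightarrow> (\<forall>i\<in>{1..n}. X i \<omega> \<in> (if x i = 1 then {1} else - {1 :: real}))"
      using assms by (intro ball_cong) (auto simp: path_def sign_paths_def)
    also have "\<dots> \<longleftrightarrow> (\<lambda>i\<in>{1..n}. X i \<omega>) \<in> A"
      by (simp add: A_def PiE_iff)
    finally show ?thesis .
  qed
  then have "{\<omega> \<in> space M. restrict_path n (path \<omega>) = x}
      = (\<lambda>\<omega>. \<lambda>i\<in>{1..n}. X i \<omega>) -` A \<inter> space M" by auto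
  then show ?thesis using in_vimage_algebra[OF A] by metis
qed

lemma past_event_measurable:
  assumes "x \<in> sign_paths n"
  shows "{\<omega> \<in> space M. restrict_path n (path \<omega>) = x} \<in> events"
proof -
  have "(\<lambda>\<omega>. \<lambda>i\<in>{1..n}. X i \<omega>) \<in> measurable M (Pi\<^sub>M {1..n} (\<lambda>_. borel))"
    using step_measurable by (intro measurable_restrict) auto
  then have "sets (vimage_algebra (space M) (\<lambda>\<omega>. \<lambda>i\<in>{1..n}. X i \<omega>) (Pi\<^sub>M {1..n} (\<lambda>_. borel)))
      \<subseteq> events" by (intro sets_image_in_sets) auto
  then show ?thesis using past_event[OF assms] by auto
qed

lemma simple_function_past: "simple_function M (\<lambda>\<omega>. restrict_path n (path \<omega>))"
  unfolding simple_function_def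
proof (intro conjI ballI)
  show "finite ((\<lambda>\<omega>. restrict_path n (path \<omega>)) ` space M)"
    using restrict_path_in_sign_paths by (intro finite_subset[OF _ finite_sign_paths]) auto
  fix x assume "x \<in> (\<lambda>\<omega>. restrict_path n (path \<omega>)) ` space M"
  then have "x \<in> sign_paths n" using restrict_path_in_sign_paths by auto
  from past_event_measurable[OF this]
  show "(\<lambda>\<omega>. restrict_path n (path \<omega>)) -` {x} \<inter> space M \<in> events"
    by (simp add: vimage_def Collect_conj_eq Int_commute)
qed

text \<open>The truncated path takes finitely many values, each on a measurable set, so any function
  of it is simple.\<close>

lemma measurable_adapted:
  fixes F :: "(nat \<Rightarrow> real) \<Rightarrow> 'b::topological_space"
  assumes "adapted n F"
  shows "(\<lambda>\<omega>. F (path \<omega>)) \<in> borel_measurable M"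
proof -
  have "simple_function M (\<lambda>\<omega>. F (restrict_path n (path \<omega>)))"
    using simple_function_compose[OF simple_function_past, of F n] by (simp add: comp_def)
  then show ?thesis using assms by (simp add: adaptedD borel_measurable_simple_function)
qed

lemma integrable_adapted:
  fixes F :: "(nat \<Rightarrow> real) \<Rightarrow> 'b::{banach, second_countable_topology}"
  assumes "adapted n F"
  shows "integrable M (\<lambda>\<omega>. F (path \<omega>))"
proof (rule integrable_const_bound)
  show "AE \<omega> in M. norm (F (path \<omega>)) \<le> Max ((\<lambda>x. norm (F x)) ` sign_paths n)"
  proof (intro AE_I2 Max_ge)
    show "norm (F (path \<omega>)) \<in> (\<lambda>x. norm (F x)) ` sign_paths n" for \<omega>
      using assms restrict_path_in_sign_paths
      by (intro image_eqI[of _ _ "restrict_path n (path \<omega>)"]) (simp_all add: adaptedD)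
  qed (simp add: finite_sign_paths)
qed (rule measurable_adapted[OF assms])

text \<open>Integration over the atoms of the past; \<open>expectation_next\<close> ends by
  recognising this form.\<close>

lemma expectation_adapted:
  fixes F :: "(nat \<Rightarrow> real) \<Rightarrow> 'b::{banach, second_countable_topology}"
  assumes "adapted n F"
  shows "(\<integral>\<omega>. F (path \<omega>) \<partial>M)
    = (\<Sum>x\<in>sign_paths n. prob {\<omega> \<in> space M. restrict_path n (path \<omega>) = x} *\<^sub>R F x)"
proof -
  have "F (path \<omega>) = (\<Sum>x\<in>sign_paths n.
      indicator {\<omega> \<in> space M. restrict_path n (path \<omega>) = x} \<omega> *\<^sub>R F x)" if "\<omega> \<in> space M" for \<omega>
  proof -
    have "(\<Sum>x\<in>sign_paths n. indicator {\<omega> \<in> space M. restrict_path n (path \<omega>) = x} \<omega> *\<^sub>R F x)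
        = (\<Sum>x\<in>sign_paths n. if x = restrict_path n (path \<omega>) then F x else 0)"
      using that by (intro sum.cong) (auto simp: indicator_def)
    also have "\<dots> = F (path \<omega>)"
      using assms restrict_path_in_sign_paths by (simp add: finite_sign_paths adaptedD)
    finally show ?thesis by simp
  qed
  then have "(\<integral>\<omega>. F (path \<omega>) \<partial>M) = (\<integral>\<omega>. (\<Sum>x\<in>sign_paths n.
      indicator {\<omega> \<in> space M. restrict_path n (path \<omega>) = x} \<omega> *\<^sub>R F x) \<partial>M)"
    by (intro Bochner_Integration.integral_cong) auto
  also have "\<dots> = (\<Sum>x\<in>sign_paths n.
      prob {\<omega> \<in> space M. restrict_path n (path \<omega>) = x} *\<^sub>R F x)"
    by (subst Bochner_Integration.integral_sum)
      (auto simp: past_event_measurable less_top[symmetric] intro!: sum.cong)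
  finally show ?thesis .
qed

lemma choice_event:
  "{\<omega> \<in> space M. (K n \<omega>, B n \<omega>) = c}
    \<in> sets (vimage_algebra (space M) (\<lambda>\<omega>. (K n \<omega>, B n \<omega>)) (count_space UNIV))"
  using in_vimage_algebra[of "{c}" "count_space UNIV" "\<lambda>\<omega>. (K n \<omega>, B n \<omega>)" "space M"]
  by (simp add: vimage_def Collect_conj_eq Int_commute)

lemma choice_event_measurable:
  "n \<ge> 1 \<Longrightarrow> {\<omega> \<in> space M. (K n \<omega>, B n \<omega>) = c} \<in> events"
  using measurable_sets[OF choice_measurable, of n "{c}"]
  by (simp add: vimage_def Collect_conj_eq Int_commute)

lemma prob_choice:
  assumes "n \<ge> 1" "j \<in> {1..n}"
  shows "prob {\<omega> \<in> space M. (K n \<omega>, B n \<omega>) = (j, b)} = (if b then p else 1 - p) / n"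
proof -
  have "prob {\<omega> \<in> space M. (K n \<omega>, B n \<omega>) = (j, b)}
      = measure (distr M (count_space UNIV) (\<lambda>\<omega>. (K n \<omega>, B n \<omega>))) {(j, b)}"
    by (subst measure_distr[OF choice_measurable[OF assms(1)]])
      (simp_all add: vimage_def Collect_conj_eq Int_commute)
  also have "\<dots> = pmf (pair_pmf (pmf_of_set {1..n}) (bernoulli_pmf p)) (j, b)"
    by (simp add: choice_law[OF assms(1)] pmf.rep_eq)
  also have "\<dots> = (if b then p else 1 - p) / n"
    using assms p_bounds by (cases b) (simp_all add: pmf_pair)
  finally show ?thesis .
qed

lemma AE_choice_range:
  assumes "n \<ge> 1"
  shows "AE \<omega> in M. K n \<omega> \<in> {1..n}"
proof -
  have "AE c in distr M (count_space UNIV) (\<lambda>\<omega>. (K n \<omega>, B n \<omega>)). fst c \<in> {1..n}"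
    using assms unfolding choice_law[OF assms] by (auto simp: AE_measure_pmf_iff)
  then show ?thesis
    by (subst (asm) AE_distr_iff[OF choice_measurable[OF assms]]) auto
qed

lemma adapted_next_mean:
  assumes "adapted (Suc n) F"
  shows "adapted n (next_mean n F)"
proof -
  have "F ((restrict_path n x)(Suc n := s)) = F (x(Suc n := s))" for x s
    using adaptedD[OF assms, of "x(Suc n := s)"] by (simp add: restrict_path_Suc_upd)
  then show ?thesis by (simp add: adapted_def next_mean_def)
qed

text \<open>The first step is a sign because \<open>q\<close> and \<open>1 - q\<close> add up to 1;
  every later step is plus or minus an earlier one, since the recalled index lies in
  \<open>{1..n}\<close>. Countably many null sets are discarded.\<close>

lemma AE_path_eq: "AE \<omega> in M. \<forall>k\<ge>1. path \<omega> k = X k \<omega>"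
proof -
  have "AE \<omega> in M. X 1 \<omega> = 1 \<or> X 1 \<omega> = -1"
  proof -
    have ev: "{\<omega> \<in> space M. X 1 \<omega> = c} \<in> events" for c
      using measurable_sets[OF step_measurable[of 1], of "{c}"]
      by (simp add: vimage_def Collect_conj_eq Int_commute)
    have "prob ({\<omega> \<in> space M. X 1 \<omega> = 1} \<union> {\<omega> \<in> space M. X 1 \<omega> = -1}) 
        = prob {\<omega> \<in> space M. X 1 \<omega> = 1} + prob {\<omega> \<in> space M. X 1 \<omega> = -1}"
      by (rule finite_measure_Union[OF ev ev]) auto
    then have "prob ({\<omega> \<in> space M. X 1 \<omega> = 1} \<union> {\<omega> \<in> space M. X 1 \<omega> = -1}) = 1"
      by (simp only: first_step)
    then have "AE \<omega> in M. \<omega> \<in> {\<omega> \<in> space M. X 1 \<omega> = 1} \<union> {\<omega> \<in> space M. X 1 \<omega> = -1}"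
      by (intro AE_prob_1)
    then show ?thesis by auto
  qed
  moreover have "AE \<omega> in M. \<forall>n\<ge>1. K n \<omega> \<in> {1..n}"
    using AE_choice_range by (auto simp: AE_all_countable)
  moreover have "AE \<omega> in M. \<forall>n\<ge>1. X (n + 1) \<omega> = (if B n \<omega> then X (K n \<omega>) \<omega> else - X (K n \<omega>) \<omega>)"
    using next_step by (auto simp: AE_all_countable)
  ultimately show ?thesis
  proof eventually_elim
    case (elim \<omega>)
    have signs: "X k \<omega> = 1 \<or> X k \<omega> = -1" if "k \<ge> 1" for k
      using that
    proof (induction k rule: less_induct)
      case (less k)
      show ?case
      proof (cases "k = 1")
        case True
        then show ?thesis using elim(1) by simp
      next
        case False
        define n where "n = k - 1"
        have n: "n \<ge> 1" "k = n + 1" using False less.prems by (auto simp: n_def)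
        have "K n \<omega> \<in> {1..n}" using elim(2) n(1) by blast
        then have IH: "X (K n \<omega>) \<omega> = 1 \<or> X (K n \<omega>) \<omega> = -1"
          using n(2) by (intro less.IH) auto
        have "X k \<omega> = X (K n \<omega>) \<omega> \<or> X k \<omega> = - X (K n \<omega>) \<omega>"
          using elim(3)[rule_format, OF n(1)] unfolding n(2) by (simp split: if_splits)
        with IH show ?thesis by (elim disjE) simp_all
      qed
    qed
    show ?case
    proof (intro allI impI)
      fix k :: nat assume "k \<ge> 1"
      from signs[OF this] show "path \<omega> k = X k \<omega>" by (auto simp: path_def)
    qed
  qed
qed

text \<open>The tower property. Splitting by the past \<open>x\<close> and the choice
  \<open>(j, b)\<close>, independence factorises the probability; summing over \<open>b\<close>
  gives \<open>(1 + memory * x j) / 2\<close> for a step +1, and averaging over the uniform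
  \<open>j\<close> turns \<open>x j\<close> into \<open>mean_position x n\<close>.\<close>

lemma expectation_next:
  fixes F :: "(nat \<Rightarrow> real) \<Rightarrow> 'b::{banach, second_countable_topology}"
  assumes F: "adapted (Suc n) F" and n: "n \<ge> 1"
  shows "(\<integral>\<omega>. F (path \<omega>) \<partial>M) = (\<integral>\<omega>. next_mean n F (path \<omega>) \<partial>M)"
proof -
  let ?E = "\<lambda>x. {\<omega> \<in> space M. restrict_path n (path \<omega>) = x}"
  let ?C = "\<lambda>c. {\<omega> \<in> space M. (K n \<omega>, B n \<omega>) = c}"
  \<comment> \<open>\<open>?s x c\<close> is the step that the choice \<open>c\<close> produces
    after the past \<open>x\<close>.\<close>
  let ?s = "\<lambda>x c. if snd c then x (fst c) else - x (fst c) :: real"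
  let ?I = "sign_paths n \<times> ({1..n} \<times> (UNIV :: bool set))"
  have fin: "finite ?I" using finite_sign_paths by auto
  have meas: "?E x \<inter> ?C c \<in> events" if "x \<in> sign_paths n" for x c
    using past_event_measurable[OF that] choice_event_measurable[OF n] by blast
  let ?G = "\<lambda>i \<omega>. indicator (?E (fst i) \<inter> ?C (snd i)) \<omega>
    *\<^sub>R F ((fst i)(Suc n := ?s (fst i) (snd i)))"
  have hbi: "has_bochner_integral M (?G i)
      (prob (?E (fst i) \<inter> ?C (snd i)) *\<^sub>R F ((fst i)(Suc n := ?s (fst i) (snd i))))" if "i \<in> ?I" for i
  proof (rule has_bochner_integral_indicator)
    show "?E (fst i) \<inter> ?C (snd i) \<in> events" using meas that by (simp only: mem_Times_iff)
    show "emeasure M (?E (fst i) \<inter> ?C (snd i)) < \<infinity>" by (simp only: emeasure_finite less_top[symmetric] infinity_ennreal_def not_False_eq_True)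
  qed
  note int = integrable.intros[OF hbi]
  have "AE \<omega> in M. F (path \<omega>) = (\<Sum>i\<in>?I. ?G i \<omega>)"
    using AE_path_eq AE_choice_range[OF n] next_step[OF n] AE_space
  proof eventually_elim
    case (elim \<omega>)
    let ?x = "restrict_path n (path \<omega>)" and ?c = "(K n \<omega>, B n \<omega>)"
    have "(\<Sum>i\<in>?I. ?G i \<omega>)
        = (\<Sum>i\<in>?I. if i = (?x, ?c) then F (?x(Suc n := ?s ?x ?c)) else 0)"
      using elim(4) by (intro sum.cong) (auto simp: indicator_def)
    also have "\<dots> = F (?x(Suc n := ?s ?x ?c))"
      using elim(2) restrict_path_in_sign_paths by (subst sum.delta[OF fin]) auto
    also have "?s ?x ?c = path \<omega> (Suc n)"
      using elim(1-3) by auto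
    also have "?x(Suc n := path \<omega> (Suc n)) = restrict_path (Suc n) (path \<omega>)"
      using restrict_path_Suc_upd[of n "path \<omega>" "path \<omega> (Suc n)"] by simp
    finally show ?case unfolding adaptedD[OF F] by (rule sym)
  qed
  then have "(\<integral>\<omega>. F (path \<omega>) \<partial>M) = (\<integral>\<omega>. (\<Sum>i\<in>?I. ?G i \<omega>) \<partial>M)"
    using int measurable_adapted[OF F]
    by (intro integral_cong_AE borel_measurable_integrable[OF Bochner_Integration.integrable_sum[OF int]])
  also have "\<dots> = (\<Sum>i\<in>?I. (\<integral>\<omega>. ?G i \<omega> \<partial>M))"
    by (rule Bochner_Integration.integral_sum[OF int])
  also have "\<dots> = (\<Sum>i\<in>?I. prob (?E (fst i) \<inter> ?C (snd i))
      *\<^sub>R F ((fst i)(Suc n := ?s (fst i) (snd i))))"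
    using hbi by (intro sum.cong refl has_bochner_integral_integral_eq)
  also have "\<dots> = (\<Sum>x\<in>sign_paths n. \<Sum>j\<in>{1..n}. \<Sum>b\<in>UNIV.
      (prob (?E x) * ((if b then p else 1 - p) / n)) *\<^sub>R F (x(Suc n := ?s x (j, b))))"
    unfolding sum.cartesian_product case_prod_unfold
  proof (intro sum.cong refl, goal_cases)
    case (1 i)
    then have "prob (?E (fst i) \<inter> ?C (snd i)) = prob (?C (snd i) \<inter> ?E (fst i))"
      by (simp add: Int_commute)
    also have "\<dots> = prob (?C (snd i)) * prob (?E (fst i))"
      using 1 by (intro indep_setD[OF choice_indep[OF n]] choice_event past_event) auto
    also have "prob (?C (snd i)) = (if snd (snd i) then p else 1 - p) / n"
      using 1 prob_choice[OF n, of "fst (snd i)" "snd (snd i)"] by auto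
    finally show ?case by (simp add: mult.commute)
  qed
  also have "\<dots> = (\<Sum>x\<in>sign_paths n. prob (?E x) *\<^sub>R next_mean n F x)"
  proof (intro sum.cong refl)
    fix x assume x: "x \<in> sign_paths n"
    \<comment> \<open>For a sign \<open>x j\<close>, \<open>(1 + memory * x j) / 2\<close> is
      \<open>p\<close> or \<open>1 - p\<close>; this affine formula covers both cases and can be
      summed over \<open>j\<close>.\<close>
    have split: "(\<Sum>b\<in>UNIV. (prob (?E x) * ((if b then p else 1 - p) / n)) *\<^sub>R F (x(Suc n := ?s x (j, b))))
        = prob (?E x) *\<^sub>R (((1 + memory * x j) / (2 * n)) *\<^sub>R F (x(Suc n := 1))
            + ((1 - memory * x j) / (2 * n)) *\<^sub>R F (x(Suc n := -1)))" if "j \<in> {1..n}" for j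
    proof -
      have "x j = 1 \<or> x j = -1" using x that by (auto simp: sign_paths_def)
      then show ?thesis
      proof
        assume j: "x j = 1"
        have coeff: "(1 + memory * x j) / (2 * n) = p / n" "(1 - memory * x j) / (2 * n) = (1 - p) / n"
          using n j by (simp_all add: field_simps)
        show ?thesis unfolding coeff using j by (simp add: UNIV_bool scaleR_add_right)
      next
        assume j: "x j = -1"
        have coeff: "(1 + memory * x j) / (2 * n) = (1 - p) / n" "(1 - memory * x j) / (2 * n) = p / n"
          using n j by (simp_all add: field_simps)
        show ?thesis unfolding coeff using j by (simp add: UNIV_bool scaleR_add_right)
      qed
    qed
    have "(\<Sum>j\<in>{1..n}. (1 + c * x j) / (2 * n)) = (1 + c * mean_position x n) / 2" for c
      using n by (simp add: sum_divide_distrib[symmetric] sum.distrib position_def field_simps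
          sum_distrib_left[symmetric])
    from this[of memory] this[of "- memory"]
    have sums: "(\<Sum>j\<in>{1..n}. (1 + memory * x j) / (2 * n)) = (1 + memory * mean_position x n) / 2"
      "(\<Sum>j\<in>{1..n}. (1 - memory * x j) / (2 * n)) = (1 - memory * mean_position x n) / 2"
      by (simp_all only: mult_minus_left add_uminus_conv_diff)
    have "(\<Sum>j\<in>{1..n}. \<Sum>b\<in>UNIV. (prob (?E x) * ((if b then p else 1 - p) / n)) *\<^sub>R F (x(Suc n := ?s x (j, b))))
        = (\<Sum>j\<in>{1..n}. prob (?E x) *\<^sub>R (((1 + memory * x j) / (2 * n)) *\<^sub>R F (x(Suc n := 1))
            + ((1 - memory * x j) / (2 * n)) *\<^sub>R F (x(Suc n := -1))))"
      by (rule sum.cong[OF refl split])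
    also have "\<dots> = prob (?E x) *\<^sub>R next_mean n F x"
      unfolding scaleR_sum_right[symmetric] sum.distrib scaleR_sum_left[symmetric] sums next_mean_def ..
    finally show "(\<Sum>j\<in>{1..n}. \<Sum>b\<in>UNIV. (prob (?E x) * ((if b then p else 1 - p) / n)) *\<^sub>R F (x(Suc n := ?s x (j, b))))
        = prob (?E x) *\<^sub>R next_mean n F x" .
  qed
  also have "\<dots> = (\<integral>\<omega>. next_mean n F (path \<omega>) \<partial>M)"
    using F by (intro expectation_adapted[symmetric] adapted_next_mean)
  finally show ?thesis .
qed

end

subsection \<open>Moments and the law of large numbers\<close>

text \<open>\<open>harm n - ln n\<close> decreases and equals 1 at \<open>n = 1\<close>; the
  sequence in the cited fact is indexed from 0.\<close>

lemma harm_le_ln: "n \<ge> 1 \<Longrightarrow> harm n \<le> ln (real n) + 1"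
  using decseqD[OF decseq_harm_diff_ln, of 0 "n - 1"] by (simp add: harm_Suc harm_expand)

lemma ln_le_harm': "n \<ge> 1 \<Longrightarrow> ln (real n) \<le> harm n"
  using ln_le_harm[of n] ln_mono[of "real n" "real n + 1"] by linarith

lemma sum_inverse_le_harm: "(\<Sum>k=1..<n. 1 / real k) \<le> harm n"
  unfolding harm_def by (auto simp: inverse_eq_divide intro!: sum_mono2)

lemma sum_inverse_Suc: "n \<ge> 1 \<Longrightarrow> (\<Sum>k=1..<n. 1 / real (Suc k)) = harm n - 1"
  by (induction n rule: dec_induct) (simp_all add: harm_Suc harm_expand inverse_eq_divide)

lemma sum_inverse_mult_Suc: "n \<ge> 1 \<Longrightarrow> (\<Sum>k=1..<n. 1 / (real k * real (Suc k))) = 1 - 1 / n"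
proof (induction n rule: dec_induct)
  case (step n)
  have "1 / (real n * real (Suc n)) = 1 / n - 1 / Suc n"
    using step by (simp add: field_simps)
  with step show ?case by simp
qed simp

lemma sum_inverse_square_le: "(\<Sum>k=1..<n. 1 / (real k)\<^sup>2) \<le> 2"
proof (cases "n \<ge> 1")
  case True
  have "(\<Sum>k=1..<n. 1 / (real k)\<^sup>2) \<le> (\<Sum>k=1..<n. 2 * (1 / (real k * real (Suc k))))"
  proof (rule sum_mono)
    fix k assume k: "k \<in> {1..<n}"
    then have "real k * real (Suc k) \<le> 2 * (real k)\<^sup>2"
      by (simp add: power2_eq_square algebra_simps)
    with k have "2 / (2 * (real k)\<^sup>2) \<le> 2 / (real k * real (Suc k))"
      by (intro divide_left_mono) auto
    then show "1 / (real k)\<^sup>2 \<le> 2 * (1 / (real k * real (Suc k)))" by simp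
  qed
  also have "\<dots> = 2 * (1 - 1 / n)"
    by (simp only: sum_distrib_left[symmetric] sum_inverse_mult_Suc[OF True])
  finally show ?thesis using True by (simp add: algebra_simps) (smt (verit) divide_nonneg_nonneg of_nat_0_le_iff)
qed simp

lemma (in prob_space) expectation_abs_le_sqrt:
  fixes f :: "'a \<Rightarrow> real"
  assumes "integrable M f" "integrable M (\<lambda>\<omega>. (f \<omega>)\<^sup>2)"
  shows "expectation (\<lambda>\<omega>. \<bar>f \<omega>\<bar>) \<le> sqrt (expectation (\<lambda>\<omega>. (f \<omega>)\<^sup>2))"
proof -
  have "0 \<le> variance (\<lambda>\<omega>. \<bar>f \<omega>\<bar>)" by (rule variance_positive)
  also have "\<dots> = expectation (\<lambda>\<omega>. (f \<omega>)\<^sup>2) - (expectation (\<lambda>\<omega>. \<bar>f \<omega>\<bar>))\<^sup>2"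
    using assms by (subst variance_eq) simp_all
  finally show ?thesis by (intro real_le_rsqrt) simp
qed

lemma adapted_sum:
  fixes g :: "'i \<Rightarrow> (nat \<Rightarrow> real) \<Rightarrow> 'b::comm_monoid_add"
  assumes "\<And>i. i \<in> A \<Longrightarrow> adapted n (g i)"
  shows "adapted n (\<lambda>x. \<Sum>i\<in>A. g i x)"
  using assms unfolding adapted_def by (auto intro!: sum.cong)

definition sum_mean_squares :: "(nat \<Rightarrow> real) \<Rightarrow> nat \<Rightarrow> real" where
  "sum_mean_squares x n = (\<Sum>k=1..<n. (mean_position x k)\<^sup>2)"

text \<open>The sum stops at \<open>n - 1\<close>, so its value at \<open>Suc m\<close> is known
  after \<open>m\<close> steps. This predictability keeps the cut-off weights of the central limit
  theorem adapted.\<close>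

lemma sum_mean_squares_restrict_path [simp]:
  "n \<le> Suc m \<Longrightarrow> sum_mean_squares (restrict_path m x) n = sum_mean_squares x n"
  by (auto simp: sum_mean_squares_def intro!: sum.cong)

section \<open>Martingale estimates and moments of the walk\<close>

context elephant_random_walk
begin

definition innovation :: "nat \<Rightarrow> (nat \<Rightarrow> real) \<Rightarrow> real" where
  "innovation k x = x (Suc k) - memory * mean_position x k"

lemma adapted_innovation: "k \<ge> 1 \<Longrightarrow> adapted (Suc k) (innovation k)"
  by (simp add: adapted_def innovation_def)

lemma memory_bounds: "-1 \<le> memory" "memory \<le> 1" "\<bar>memory\<bar> \<le> 1"
  using p_bounds by auto

lemma abs_position_le: "\<bar>position (path \<omega>) n\<bar> \<le> n"
proof -
  have "\<bar>position (path \<omega>) n\<bar> \<le> (\<Sum>k=1..n. \<bar>path \<omega> k\<bar>)"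
    unfolding position_def by (rule sum_abs)
  then show ?thesis by simp
qed

lemma abs_mean_position_le: "\<bar>mean_position (path \<omega>) n\<bar> \<le> 1"
  using abs_position_le[of \<omega> n] by (cases "n = 0") simp_all

lemma integrable_position:
  fixes f :: "real \<Rightarrow> real"
  shows "integrable M (\<lambda>\<omega>. f (position (path \<omega>) n))"
  by (rule integrable_adapted[of n "\<lambda>x. f (position x n)"]) (simp add: adapted_def)

text \<open>The law of the next step depends on the past only through \<open>S n\<close>, so a
  moment recursion reduces to an inequality in one real variable.\<close>

lemma expectation_position_Suc_le:
  fixes f g :: "real \<Rightarrow> real"
  assumes n: "n \<ge> 1"
    and le: "\<And>s. (1 + memory * (s / n)) / 2 * f (s + 1) + (1 - memory * (s / n)) / 2 * f (s - 1) \<le> g s"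
  shows "expectation (\<lambda>\<omega>. f (position (path \<omega>) (Suc n))) \<le> expectation (\<lambda>\<omega>. g (position (path \<omega>) n))"
proof -
  let ?F = "\<lambda>x. f (position x (Suc n))"
  have F: "adapted (Suc n) ?F" by (simp add: adapted_def)
  have "expectation (\<lambda>\<omega>. ?F (path \<omega>)) = expectation (\<lambda>\<omega>. next_mean n ?F (path \<omega>))"
    by (rule expectation_next[OF F n])
  also have "\<dots> \<le> expectation (\<lambda>\<omega>. g (position (path \<omega>) n))"
    using le integrable_adapted[OF adapted_next_mean[OF F]]
    by (intro integral_mono integrable_position) (simp_all add: next_mean_def position_Suc)
  finally show ?thesis .
qed

text \<open>A factor known at time \<open>n\<close> is pulled out of the conditional
  expectation.\<close>

lemma expectation_mult_next:
  fixes G g :: "(nat \<Rightarrow> real) \<Rightarrow> real"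
  assumes "adapted n G" "adapted (Suc n) g" "n \<ge> 1"
  shows "expectation (\<lambda>\<omega>. G (path \<omega>) * g (path \<omega>))
    = expectation (\<lambda>\<omega>. G (path \<omega>) * next_mean n g (path \<omega>))"
proof -
  have "adapted (Suc n) (\<lambda>x. G x * g x)"
    using adapted_mono[OF assms(1), of "Suc n"] assms(2) by (simp add: adapted_def)
  from expectation_next[OF this assms(3)] show ?thesis
    by (simp add: next_mean_def adapted_upd[OF assms(1)] algebra_simps)
qed

text \<open>Pythagoras for martingale differences. Orthogonality is a hypothesis, instead of a
  vanishing \<open>next_mean\<close>, because the score increments are conditionally centered only
  off a null set.\<close>

lemma expectation_orthogonal_sum:
  fixes g :: "nat \<Rightarrow> (nat \<Rightarrow> real) \<Rightarrow> real"
  assumes g: "\<And>k. k \<ge> 1 \<Longrightarrow> adapted (Suc k) (g k)"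
    and orth: "\<And>k. k \<ge> 1 \<Longrightarrow> expectation (\<lambda>\<omega>. (\<Sum>j=1..<k. g j (path \<omega>)) * g k (path \<omega>)) = 0"
    and "n \<ge> 1"
  shows "expectation (\<lambda>\<omega>. (\<Sum>k=1..<n. g k (path \<omega>))\<^sup>2) = (\<Sum>k=1..<n. expectation (\<lambda>\<omega>. (g k (path \<omega>))\<^sup>2))"
  using \<open>n \<ge> 1\<close>
proof (induction n rule: dec_induct)
  case (step n)
  let ?G = "\<lambda>x. \<Sum>k=1..<n. g k x"
  have G: "adapted n ?G"
    by (intro adapted_sum adapted_mono[OF g]) auto
  have G': "adapted (Suc n) ?G" and gn: "adapted (Suc n) (g n)"
    using adapted_mono[OF G] g step by auto
  have int: "integrable M (\<lambda>\<omega>. (?G (path \<omega>))\<^sup>2)" "integrable M (\<lambda>\<omega>. (g n (path \<omega>))\<^sup>2)"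
    "integrable M (\<lambda>\<omega>. ?G (path \<omega>) * g n (path \<omega>))"
    by (rule integrable_adapted[where n = "Suc n" and F = "\<lambda>x. (?G x)\<^sup>2"]
        integrable_adapted[where n = "Suc n" and F = "\<lambda>x. (g n x)\<^sup>2"]
        integrable_adapted[where n = "Suc n" and F = "\<lambda>x. ?G x * g n x"],
        use G' gn in \<open>simp add: adapted_def\<close>)+
  have "expectation (\<lambda>\<omega>. (\<Sum>k=1..<Suc n. g k (path \<omega>))\<^sup>2)
      = expectation (\<lambda>\<omega>. (?G (path \<omega>))\<^sup>2 + (g n (path \<omega>))\<^sup>2 + 2 * (?G (path \<omega>) * g n (path \<omega>)))"
    using step by (simp add: power2_sum mult.assoc)
  also have "\<dots> = expectation (\<lambda>\<omega>. (?G (path \<omega>))\<^sup>2) + expectation (\<lambda>\<omega>. (g n (path \<omega>))\<^sup>2)"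
    using int orth[of n] step by simp
  finally show ?case using step by simp
qed simp

text \<open>Under \<open>next_mean\<close> the innovation takes the values 1 - m and -1 - m with
  weights (1 + m) / 2 and (1 - m) / 2, where m is \<open>memory * mean_position x k\<close>;
  \<open>u\<close> is a constant factor.\<close>

lemma next_mean_innovation:
  assumes "adapted k u"
  shows "next_mean k (\<lambda>x. u x * innovation k x) x = 0"
    and "next_mean k (\<lambda>x. (u x * innovation k x)\<^sup>2) x = (u x)\<^sup>2 * (1 - (memory * mean_position x k)\<^sup>2)"
  by (simp_all add: next_mean_def innovation_def adapted_upd[OF assms])
    (simp_all add: power2_eq_square algebra_simps add_divide_distrib diff_divide_distrib)

text \<open>The terms are orthogonal, and each innovation has conditional second moment at most
  1.\<close>

lemma expectation_innovation_sum_sq_le: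
  fixes u :: "nat \<Rightarrow> (nat \<Rightarrow> real) \<Rightarrow> real"
  assumes u: "\<And>k. k \<ge> 1 \<Longrightarrow> adapted k (u k)" and n: "n \<ge> 1"
  shows "expectation (\<lambda>\<omega>. (\<Sum>k=1..<n. u k (path \<omega>) * innovation k (path \<omega>))\<^sup>2)
    \<le> (\<Sum>k=1..<n. expectation (\<lambda>\<omega>. (u k (path \<omega>))\<^sup>2))"
proof -
  let ?g = "\<lambda>k x. u k x * innovation k x"
  have g: "adapted (Suc k) (?g k)" if "k \<ge> 1" for k
    using adapted_mono[OF u, of k "Suc k"] adapted_innovation[of k] that by (simp add: adapted_def)
  have "expectation (\<lambda>\<omega>. (\<Sum>k=1..<n. ?g k (path \<omega>))\<^sup>2)
      = (\<Sum>k=1..<n. expectation (\<lambda>\<omega>. (?g k (path \<omega>))\<^sup>2))"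
  proof (rule expectation_orthogonal_sum[OF g _ n])
    fix k :: nat assume k: "k \<ge> 1"
    have "adapted k (\<lambda>x. \<Sum>j=1..<k. ?g j x)"
      by (intro adapted_sum adapted_mono[OF g]) auto
    from expectation_mult_next[OF this g[OF k] k]
    show "expectation (\<lambda>\<omega>. (\<Sum>j=1..<k. ?g j (path \<omega>)) * ?g k (path \<omega>)) = 0"
      by (simp add: next_mean_innovation[OF u[OF k]])
  qed
  also have "\<dots> \<le> (\<Sum>k=1..<n. expectation (\<lambda>\<omega>. (u k (path \<omega>))\<^sup>2))"
  proof (rule sum_mono)
    fix k assume "k \<in> {1..<n}"
    then have k: "k \<ge> 1" by simp
    have ad: "adapted (Suc k) (\<lambda>x. (?g k x)\<^sup>2)" using g[OF k] by (simp add: adapted_def)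
    have "expectation (\<lambda>\<omega>. (?g k (path \<omega>))\<^sup>2) = expectation (\<lambda>\<omega>. next_mean k (\<lambda>x. (?g k x)\<^sup>2) (path \<omega>))"
      by (rule expectation_next[OF ad k])
    also have "\<dots> \<le> expectation (\<lambda>\<omega>. (u k (path \<omega>))\<^sup>2)"
    proof (rule integral_mono)
      show "integrable M (\<lambda>\<omega>. next_mean k (\<lambda>x. (?g k x)\<^sup>2) (path \<omega>))"
        by (rule integrable_adapted[OF adapted_next_mean[OF ad]])
      show "integrable M (\<lambda>\<omega>. (u k (path \<omega>))\<^sup>2)"
        using u[OF k] by (intro integrable_adapted[of k "\<lambda>x. (u k x)\<^sup>2"]) (simp add: adapted_def)
      show "next_mean k (\<lambda>x. (?g k x)\<^sup>2) (path \<omega>) \<le> (u k (path \<omega>))\<^sup>2" for \<omega>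
        unfolding next_mean_innovation(2)[OF u[OF k]] by (rule mult_left_le) auto
    qed
    finally show "expectation (\<lambda>\<omega>. (?g k (path \<omega>))\<^sup>2) \<le> expectation (\<lambda>\<omega>. (u k (path \<omega>))\<^sup>2)" .
  qed
  finally show ?thesis .
qed

text \<open>The increment of S^2 / n is 1 / (n+1) + 2 S X / (n+1) - S^2 / (n (n+1)). Writing X as
  innovation plus drift a S / n leaves -(1 - 2 a) S^2 / (n (n+1)), and n / (n+1) = 1 - 1 / (n+1)
  splits off the first sum on the right. The isolated 1 is the square of the first step.\<close>

lemma sum_mean_squares_identity:
  assumes "n \<ge> 1"
  shows "(1 - 2 * memory) * sum_mean_squares (path \<omega>) n =
    (1 - 2 * memory) * (\<Sum>k=1..<n. (mean_position (path \<omega>) k)\<^sup>2 / Suc k)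
      + 1 - (position (path \<omega>) n)\<^sup>2 / n + (\<Sum>k=1..<n. 1 / Suc k)
      + 2 * (\<Sum>k=1..<n. position (path \<omega>) k / Suc k * innovation k (path \<omega>))"
  using assms
proof (induction n rule: dec_induct)
  case base
  show ?case by (simp add: sum_mean_squares_def position_def)
next
  case (step n)
  define s where "s = position (path \<omega>) n"
  define x where "x = path \<omega> (Suc n)"
  have x: "x * x = 1" using path_sq[of \<omega> "Suc n"] by (simp add: x_def power2_eq_square)
  have n: "real n > 0" using step by simp
  have "(1 - 2 * memory) * (s / n)\<^sup>2 = (1 - 2 * memory) * ((s / n)\<^sup>2 / Suc n)
      + s\<^sup>2 / n - (s + x)\<^sup>2 / Suc n + 1 / Suc n + 2 * (s / Suc n * (x - memory * (s / n)))"
  proof -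
    have sq: "(s + x)\<^sup>2 = s\<^sup>2 + 2 * s * x + 1" using x by (simp add: power2_eq_square algebra_simps)
    obtain r where r: "real (Suc n) = r" "r = real n + 1" "r > 0" by simp
    show ?thesis unfolding sq r(1) using n r(3)
      by (simp add: divide_simps) (simp add: r(2) power2_eq_square algebra_simps)
  qed
  with step show ?case
    by (simp add: sum_mean_squares_def position_Suc innovation_def s_def x_def algebra_simps)
qed

context
  assumes diffusive: "p < 3 / 4"
begin

text \<open>Averaging (s + 1)^j and (s - 1)^j gives the leading factor 1 + j a / n and lower even
  powers, whose means are already of order at most n^(j/2 - 1). The sixth moment serves the Fisher
  information, where p = 0 costs a factor k.\<close>

lemma mean_position_moments:
  obtains c where "c \<ge> 0" "\<And>n. n \<ge> 1 \<Longrightarrow> expectation (\<lambda>\<omega>. (mean_position (path \<omega>) n)\<^sup>2) \<le> c / n"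
    "\<And>n. n \<ge> 1 \<Longrightarrow> expectation (\<lambda>\<omega>. (mean_position (path \<omega>) n) ^ 4) \<le> c / real n ^ 2"
    "\<And>n. n \<ge> 1 \<Longrightarrow> expectation (\<lambda>\<omega>. (mean_position (path \<omega>) n) ^ 6) \<le> c / real n ^ 3"
proof -
  \<comment> \<open>\<open>polynomial_growth\<close> needs a nonnegative rate, while
    \<open>memory\<close> is negative for p < 1/2.\<close>
  define b where "b = max 0 memory"
  have b: "0 \<le> b" "b < 1 / 2" "memory \<le> b" using diffusive unfolding b_def by linarith+
  let ?E = "\<lambda>j n. expectation (\<lambda>\<omega>. (position (path \<omega>) n) ^ j)"
  note int = integrable_position[of "\<lambda>s. s ^ j" for j]
  have ms: "memory * (s ^ j / real n) \<le> b * (s ^ j / real n)" if "even j" for s j n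
    using b that by (intro mult_right_mono divide_nonneg_nonneg) (auto simp: zero_le_even_power)
  have mn: "memory / real n \<le> 1" if "n \<ge> 1" for n
    using that memory_bounds by (simp add: divide_le_eq)
  have rec2: "?E 2 (Suc n) \<le> (1 + (2 * b) / n) * ?E 2 n + 1 * real n ^ 0" if n: "n \<ge> 1" for n
  proof -
    have "?E 2 (Suc n) \<le> expectation (\<lambda>\<omega>. (1 + (2 * b) / n) * (position (path \<omega>) n) ^ 2 + 1)"
    proof (rule expectation_position_Suc_le[OF n])
      fix s
      define c where slope_def: "c = memory / n"
      have slope: "memory * (t / n) = c * t" for t by (simp add: slope_def)
      have "(1 + memory * (s / n)) / 2 * (s + 1) ^ 2 + (1 - memory * (s / n)) / 2 * (s - 1) ^ 2
        = s ^ 2 + 2 * (memory * (s ^ 2 / n)) + 1"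
        unfolding slope by (simp add: field_simps power2_eq_square)
      also have "\<dots> \<le> s ^ 2 + 2 * (b * (s ^ 2 / n)) + 1"
        using ms[of 2 s n] by (intro add_mono mult_left_mono order_refl) auto
      also have "\<dots> = (1 + (2 * b) / n) * s ^ 2 + 1"
        by (simp add: algebra_simps)
      finally show "(1 + memory * (s / n)) / 2 * (s + 1) ^ 2 + (1 - memory * (s / n)) / 2 * (s - 1) ^ 2
        \<le> (1 + (2 * b) / n) * s ^ 2 + 1" .
    qed
    also have "\<dots> = (1 + (2 * b) / n) * ?E 2 n + 1"
      using int by (simp add: prob_space)
    finally show ?thesis by simp
  qed
  obtain c2 where c2: "c2 \<ge> 0" "\<And>n. n \<ge> 1 \<Longrightarrow> ?E 2 n \<le> c2 * real n ^ Suc 0"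
    using polynomial_growth[where e = "?E 2", OF rec2] b by auto
  have rec4: "?E 4 (Suc n) \<le> (1 + (4 * b) / n) * ?E 4 n + (10 * c2 + 1) * real n ^ 1" if n: "n \<ge> 1" for n
  proof -
    have "?E 4 (Suc n) \<le> expectation (\<lambda>\<omega>. (1 + (4 * b) / n) * (position (path \<omega>) n) ^ 4
        + 10 * (position (path \<omega>) n) ^ 2 + 1)"
    proof (rule expectation_position_Suc_le[OF n])
      fix s
      define c where slope_def: "c = memory / n"
      have slope: "memory * (t / n) = c * t" for t by (simp add: slope_def)
      have "(1 + memory * (s / n)) / 2 * (s + 1) ^ 4 + (1 - memory * (s / n)) / 2 * (s - 1) ^ 4
        = s ^ 4 + 4 * (memory * (s ^ 4 / n)) + 6 * s ^ 2 + 4 * (memory / n * s ^ 2) + 1"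
        unfolding slope slope_def[symmetric] by (simp add: field_simps eval_nat_numeral)
      \<comment> \<open>By \<open>memory / n \<le> 1\<close> the coefficients 6 and 4 of s^2 merge
        into 10; in degree six, 15 + 20 and 15 + 6 give 35 and 21.\<close>
      also have "\<dots> \<le> s ^ 4 + 4 * (b * (s ^ 4 / n)) + 6 * s ^ 2 + 4 * (1 * s ^ 2) + 1"
        using ms[of 4 s n] mult_right_mono[OF mn[OF n], of "s ^ 2"]
        by (intro add_mono order_refl) simp_all
      also have "\<dots> = (1 + (4 * b) / n) * s ^ 4 + 10 * s ^ 2 + 1"
        by (simp add: algebra_simps)
      finally show "(1 + memory * (s / n)) / 2 * (s + 1) ^ 4 + (1 - memory * (s / n)) / 2 * (s - 1) ^ 4
        \<le> (1 + (4 * b) / n) * s ^ 4 + 10 * s ^ 2 + 1" .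
    qed
    also have "\<dots> = (1 + (4 * b) / n) * ?E 4 n + (10 * ?E 2 n + 1)"
      using int by (simp add: prob_space)
    also have "10 * ?E 2 n + 1 \<le> (10 * c2 + 1) * real n ^ 1"
      using c2(2)[OF n] n by (simp add: algebra_simps)
    finally show ?thesis by simp
  qed
  obtain c4 where c4: "c4 \<ge> 0" "\<And>n. n \<ge> 1 \<Longrightarrow> ?E 4 n \<le> c4 * real n ^ Suc 1"
    using polynomial_growth[where e = "?E 4", OF rec4] b by auto
  have rec6: "?E 6 (Suc n) \<le> (1 + (6 * b) / n) * ?E 6 n + (35 * c4 + 21 * c2 + 1) * real n ^ 2"
    if n: "n \<ge> 1" for n
  proof -
    have "?E 6 (Suc n) \<le> expectation (\<lambda>\<omega>. (1 + (6 * b) / n) * (position (path \<omega>) n) ^ 6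
        + 35 * (position (path \<omega>) n) ^ 4 + 21 * (position (path \<omega>) n) ^ 2 + 1)"
    proof (rule expectation_position_Suc_le[OF n])
      fix s
      define c where slope_def: "c = memory / n"
      have slope: "memory * (t / n) = c * t" for t by (simp add: slope_def)
      have "(1 + memory * (s / n)) / 2 * (s + 1) ^ 6 + (1 - memory * (s / n)) / 2 * (s - 1) ^ 6
        = s ^ 6 + 6 * (memory * (s ^ 6 / n)) + 15 * s ^ 4 + 20 * (memory / n * s ^ 4)
          + 15 * s ^ 2 + 6 * (memory / n * s ^ 2) + 1"
        unfolding slope slope_def[symmetric] by (simp add: field_simps eval_nat_numeral)
      also have "\<dots> \<le> s ^ 6 + 6 * (b * (s ^ 6 / n)) + 15 * s ^ 4 + 20 * (1 * s ^ 4)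
          + 15 * s ^ 2 + 6 * (1 * s ^ 2) + 1"
        using ms[of 6 s n] mult_right_mono[OF mn[OF n], of "s ^ 2"] mult_right_mono[OF mn[OF n], of "s ^ 4"]
        by (intro add_mono order_refl) simp_all
      also have "\<dots> = (1 + (6 * b) / n) * s ^ 6 + 35 * s ^ 4 + 21 * s ^ 2 + 1"
        by (simp add: algebra_simps)
      finally show "(1 + memory * (s / n)) / 2 * (s + 1) ^ 6 + (1 - memory * (s / n)) / 2 * (s - 1) ^ 6
        \<le> (1 + (6 * b) / n) * s ^ 6 + 35 * s ^ 4 + 21 * s ^ 2 + 1" .
    qed
    also have "\<dots> = (1 + (6 * b) / n) * ?E 6 n + (35 * ?E 4 n + 21 * ?E 2 n + 1)"
      using int by (simp add: prob_space)
    also have "35 * ?E 4 n + 21 * ?E 2 n + 1 \<le> (35 * c4 + 21 * c2 + 1) * real n ^ 2"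
    proof -
      have "real n \<le> real n ^ 2" "1 \<le> real n ^ 2" using n by (simp_all add: self_le_power)
      then have "c2 * real n \<le> c2 * real n ^ 2" using c2(1) by (intro mult_left_mono)
      with c2(2)[OF n] c4(2)[OF n] \<open>1 \<le> real n ^ 2\<close> show ?thesis
        by (simp add: algebra_simps numeral_2_eq_2)
    qed
    finally show ?thesis by simp
  qed
  obtain c6 where c6: "c6 \<ge> 0" "\<And>n. n \<ge> 1 \<Longrightarrow> ?E 6 n \<le> c6 * real n ^ Suc 2"
    using polynomial_growth[where e = "?E 6", OF rec6] b by auto
  let ?c = "c2 + c4 + c6"
  have "?E 2 n \<le> ?c * real n" "?E 4 n \<le> ?c * real n ^ 2" "?E 6 n \<le> ?c * real n ^ 3" if "n \<ge> 1" for n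
  proof -
    have "c2 * real n ^ 1 \<le> ?c * real n ^ 1" "c4 * real n ^ 2 \<le> ?c * real n ^ 2" "c6 * real n ^ 3 \<le> ?c * real n ^ 3"
      using c2(1) c4(1) c6(1) by (auto intro!: mult_right_mono)
    with c2(2)[OF that] c4(2)[OF that] c6(2)[OF that]
    show "?E 2 n \<le> ?c * real n" "?E 4 n \<le> ?c * real n ^ 2" "?E 6 n \<le> ?c * real n ^ 3"
      by (simp_all add: numeral_2_eq_2[symmetric] numeral_3_eq_3[symmetric])
  qed
  then have "?E 2 n / real n ^ 2 \<le> ?c / n" "?E 4 n / real n ^ 4 \<le> ?c / real n ^ 2" "?E 6 n / real n ^ 6 \<le> ?c / real n ^ 3"
    if "n \<ge> 1" for n using that by (simp_all add: field_simps eval_nat_numeral)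
  then show thesis
    using c2(1) c4(1) c6(1) by (intro that[of ?c]) (simp_all add: power_divide)
qed

text \<open>In the identity divided by (1 - 2 a) ln n, the sum \<open>R\<close> and the boundary
  term \<open>T\<close> have bounded mean, and the martingale \<open>N\<close> has mean square O(ln
  n), so its L^1 norm is negligible against ln n.\<close>

lemma sum_mean_squares_L1:
  "(\<lambda>n. expectation (\<lambda>\<omega>. \<bar>sum_mean_squares (path \<omega>) n / ln n - 1 / (3 - 4 * p)\<bar>)) \<longlonglongrightarrow> 0"
proof -
  obtain c where c: "c \<ge> 0" "\<And>n. n \<ge> 1 \<Longrightarrow> expectation (\<lambda>\<omega>. (mean_position (path \<omega>) n)\<^sup>2) \<le> c / n"
    using mean_position_moments by metis
  define d where "d = 1 - 2 * memory"
  have d: "d > 0" "d = 3 - 4 * p" using diffusive by (simp_all add: d_def)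
  define R where "R n x = (\<Sum>k=1..<n. (mean_position x k)\<^sup>2 / Suc k)" for n :: nat and x :: "nat \<Rightarrow> real"
  define T where "T n x = (position x n)\<^sup>2 / n" for n :: nat and x :: "nat \<Rightarrow> real"
  define N where "N n x = (\<Sum>k=1..<n. position x k / Suc k * innovation k x)" for n :: nat and x
  \<comment> \<open>\<open>d * c\<close> comes from \<open>R\<close>, \<open>c\<close> from
    \<open>T\<close> and the square roots from \<open>N\<close>; the 2 covers the constant 1 and
    \<open>harm n - 1 - ln n\<close>, which lies between -1 and 0.\<close>
  have bound: "expectation (\<lambda>\<omega>. \<bar>sum_mean_squares (path \<omega>) n / ln n - 1 / d\<bar>)
      \<le> ((d * c + 2 + c) + 2 * (sqrt c * sqrt (ln n + 1))) / (d * ln n)" if n: "n \<ge> 2" for n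
  proof -
    have n1: "n \<ge> 1" using n by simp
    have ln: "ln (real n) > 0" using n by simp
    have intR: "integrable M (\<lambda>\<omega>. R n (path \<omega>))"
      by (intro integrable_adapted[of n]) (auto simp: adapted_def R_def intro!: sum.cong)
    have intT: "integrable M (\<lambda>\<omega>. T n (path \<omega>))"
      by (intro integrable_adapted[of n]) (auto simp: adapted_def T_def)
    have adN: "adapted n (N n)"
      by (auto simp: adapted_def N_def innovation_def intro!: sum.cong)
    have intN: "integrable M (\<lambda>\<omega>. N n (path \<omega>))" "integrable M (\<lambda>\<omega>. (N n (path \<omega>))\<^sup>2)"
      using integrable_adapted[OF adN] integrable_adapted[of n "\<lambda>x. (N n x)\<^sup>2"] adN
      by (auto simp: adapted_def)
    have intA: "integrable M (\<lambda>\<omega>. sum_mean_squares (path \<omega>) n)"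
      by (intro integrable_adapted[of n "\<lambda>x. sum_mean_squares x n"]) (auto simp: adapted_def)
    have R0: "R n x \<ge> 0" and T0: "T n x \<ge> 0" for x by (auto simp: R_def T_def intro!: sum_nonneg)
    have ER: "expectation (\<lambda>\<omega>. R n (path \<omega>)) \<le> c"
    proof -
      have "expectation (\<lambda>\<omega>. R n (path \<omega>)) = (\<Sum>k=1..<n. expectation (\<lambda>\<omega>. (mean_position (path \<omega>) k)\<^sup>2) / Suc k)"
        unfolding R_def using integrable_position[of "\<lambda>s. (s / real k)\<^sup>2" k for k]
        by (subst Bochner_Integration.integral_sum) auto
      also have "\<dots> \<le> (\<Sum>k=1..<n. c / k / Suc k)"
        using c(2) by (intro sum_mono divide_right_mono) auto
      also have "\<dots> = c * (\<Sum>k=1..<n. 1 / (real k * real (Suc k)))"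
        by (simp add: sum_distrib_left)
      also have "\<dots> \<le> c * 1"
        unfolding sum_inverse_mult_Suc[OF n1] using c(1) by (intro mult_left_mono) auto
      finally show ?thesis by simp
    qed
    have ET: "expectation (\<lambda>\<omega>. T n (path \<omega>)) \<le> c"
    proof -
      have "T n x = real n * (mean_position x n)\<^sup>2" for x
        using n by (simp add: T_def power_divide power2_eq_square)
      then have "expectation (\<lambda>\<omega>. T n (path \<omega>)) = real n * expectation (\<lambda>\<omega>. (mean_position (path \<omega>) n)\<^sup>2)"
        by simp
      also have "\<dots> \<le> real n * (c / n)" using c(2)[OF n1] by (intro mult_left_mono) auto
      finally show ?thesis using n by simp
    qed
    have EN: "expectation (\<lambda>\<omega>. \<bar>N n (path \<omega>)\<bar>) \<le> sqrt c * sqrt (ln n + 1)"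
    proof -
      have "expectation (\<lambda>\<omega>. (N n (path \<omega>))\<^sup>2) \<le> (\<Sum>k=1..<n. expectation (\<lambda>\<omega>. (position (path \<omega>) k / Suc k)\<^sup>2))"
        unfolding N_def
        by (rule expectation_innovation_sum_sq_le[OF _ n1]) (simp add: adapted_def)
      also have "\<dots> \<le> (\<Sum>k=1..<n. c / k)"
      proof (rule sum_mono)
        fix k assume k: "k \<in> {1..<n}"
        have "expectation (\<lambda>\<omega>. (position (path \<omega>) k / Suc k)\<^sup>2) \<le> expectation (\<lambda>\<omega>. (mean_position (path \<omega>) k)\<^sup>2)"
          using k by (intro integral_mono integrable_position[of "\<lambda>s. (s / real (Suc k))\<^sup>2" k]
              integrable_position[of "\<lambda>s. (s / real k)\<^sup>2" k])
            (auto simp: power_divide intro!: divide_left_mono power_mono)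
        with c(2)[of k] k show "expectation (\<lambda>\<omega>. (position (path \<omega>) k / Suc k)\<^sup>2) \<le> c / k" by simp
      qed
      also have "\<dots> = c * (\<Sum>k=1..<n. 1 / real k)" by (simp add: sum_distrib_left)
      also have "\<dots> \<le> c * (ln n + 1)"
        using c(1) sum_inverse_le_harm[of n] harm_le_ln[OF n1] by (intro mult_left_mono) linarith
      finally have "sqrt (expectation (\<lambda>\<omega>. (N n (path \<omega>))\<^sup>2)) \<le> sqrt c * sqrt (ln n + 1)"
        by (simp add: real_sqrt_mult[symmetric])
      with expectation_abs_le_sqrt[OF intN] show ?thesis by linarith
    qed
    have pointwise: "\<bar>sum_mean_squares (path \<omega>) n / ln n - 1 / d\<bar>
        \<le> (d * R n (path \<omega>) + 2 + T n (path \<omega>) + 2 * \<bar>N n (path \<omega>)\<bar>) / (d * ln n)" for \<omega>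
    proof -
      have "d * sum_mean_squares (path \<omega>) n - ln n
          = d * R n (path \<omega>) + 1 - T n (path \<omega>) + (harm n - 1 - ln n) + 2 * N n (path \<omega>)"
        using sum_mean_squares_identity[OF n1, of \<omega>]
        unfolding sum_inverse_Suc[OF n1] d_def[symmetric] R_def T_def N_def by simp
      also have "\<bar>\<dots>\<bar> \<le> d * R n (path \<omega>) + 2 + T n (path \<omega>) + 2 * \<bar>N n (path \<omega>)\<bar>"
      proof -
        have "0 \<le> d * R n (path \<omega>)" using d R0 by simp
        with T0[of "path \<omega>"] harm_le_ln[OF n1] ln_le_harm'[OF n1] show ?thesis by linarith
      qed
      finally have "\<bar>d * sum_mean_squares (path \<omega>) n - ln n\<bar> / (d * ln n)
          \<le> (d * R n (path \<omega>) + 2 + T n (path \<omega>) + 2 * \<bar>N n (path \<omega>)\<bar>) / (d * ln n)"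
        using d ln by (intro divide_right_mono) auto
      moreover have "sum_mean_squares (path \<omega>) n / ln n - 1 / d
          = (d * sum_mean_squares (path \<omega>) n - ln n) / (d * ln n)"
        using d ln by (simp add: field_simps)
      ultimately show ?thesis using d ln by (simp add: abs_divide abs_mult)
    qed
    have "expectation (\<lambda>\<omega>. \<bar>sum_mean_squares (path \<omega>) n / ln n - 1 / d\<bar>)
        \<le> expectation (\<lambda>\<omega>. (d * R n (path \<omega>) + 2 + T n (path \<omega>) + 2 * \<bar>N n (path \<omega>)\<bar>) / (d * ln n))"
      using intA intR intT intN by (intro integral_mono pointwise) auto
    also have "\<dots> = (d * expectation (\<lambda>\<omega>. R n (path \<omega>)) + 2 + expectation (\<lambda>\<omega>. T n (path \<omega>))
        + 2 * expectation (\<lambda>\<omega>. \<bar>N n (path \<omega>)\<bar>)) / (d * ln n)"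
      using intR intT intN by (simp add: prob_space)
    also have "\<dots> \<le> (d * c + 2 + c + 2 * (sqrt c * sqrt (ln n + 1))) / (d * ln n)"
      using ER ET EN d ln by (intro divide_right_mono add_mono mult_left_mono) auto
    finally show ?thesis .
  qed
  have lim: "(\<lambda>n. ((d * c + 2 + c) + 2 * (sqrt c * sqrt (ln (real n) + 1))) / (d * ln n)) \<longlonglongrightarrow> 0"
  proof -
    define C1 where "C1 = (d * c + 2 + c) / d"
    define C2 where "C2 = 2 * sqrt c / d"
    have "(\<lambda>n. 1 / ln (real n)) \<longlonglongrightarrow> 0" "(\<lambda>n. sqrt (ln (real n) + 1) / ln n) \<longlonglongrightarrow> 0"
      by real_asymp+
    then have "(\<lambda>n. C1 * (1 / ln (real n)) + C2 * (sqrt (ln (real n) + 1) / ln n)) \<longlonglongrightarrow> C1 * 0 + C2 * 0"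
      by (intro tendsto_intros)
    moreover have "C1 * (1 / l) + C2 * (s / l) = ((d * c + 2 + c) + 2 * (sqrt c * s)) / (d * l)" for l s
      using d by (simp add: C1_def C2_def add_divide_distrib)
    ultimately show ?thesis by simp
  qed
  show ?thesis
    unfolding d(2)[symmetric]
    by (rule tendsto_sandwich[OF _ _ tendsto_const lim])
      (auto simp: bound eventually_at_top_linorder intro!: exI[of _ 2] AE_I2 integral_nonneg_AE)
qed

end

end

subsection \<open>The martingale central limit theorem\<close>

text \<open>For the upper bound, exp (-y) is at most the reciprocal of 1 + y + y^2 / 2, and this
  polynomial times 1 - y + y^2 / 2 is 1 + y^4 / 4.\<close>

lemma exp_minus_quadratic:
  fixes y :: real
  assumes "y \<ge> 0"
  shows "\<bar>exp (- y) - (1 - y)\<bar> \<le> y\<^sup>2 / 2"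
proof -
  have pos: "1 + y + y\<^sup>2 / 2 > 0" using assms by (intro add_pos_nonneg) auto
  have "exp (- y) \<le> inverse (1 + y + y\<^sup>2 / 2)"
    unfolding exp_minus using exp_lower_Taylor_quadratic[OF assms] pos by (rule le_imp_inverse_le)
  also have "\<dots> \<le> 1 - y + y\<^sup>2 / 2"
  proof -
    have "(1 - y + y\<^sup>2 / 2) * (1 + y + y\<^sup>2 / 2) = 1 + (y\<^sup>2)\<^sup>2 / 4"
      by (simp add: power2_eq_square algebra_simps)
    then have "1 \<le> (1 - y + y\<^sup>2 / 2) * (1 + y + y\<^sup>2 / 2)" by simp
    with pos show ?thesis by (simp add: inverse_eq_divide divide_le_eq)
  qed
  finally show ?thesis using exp_ge_add_one_self[of "- y"] by simp
qed

lemma abs_one_minus_exp_le: "\<bar>1 - exp s\<bar> \<le> \<bar>s\<bar> * exp \<bar>s\<bar>" for s :: real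
proof (cases "s \<ge> 0")
  case True
  have "(1 - s) * exp s \<le> exp (- s) * exp s"
    using exp_ge_add_one_self[of "- s"] by (intro mult_right_mono) auto
  then have "exp s - 1 \<le> s * exp s" by (simp add: exp_minus algebra_simps)
  with True show ?thesis by simp
next
  case False
  have "1 - exp s \<le> \<bar>s\<bar> * 1" using exp_ge_add_one_self[of s] False by linarith
  also have "\<dots> \<le> \<bar>s\<bar> * exp \<bar>s\<bar>" by (intro mult_left_mono) auto
  finally show ?thesis using False by simp
qed

text \<open>
  The law giving mass \<open>(1 \<plusminus> m) / 2\<close> to \<open>\<plusminus>1 - m\<close> is centered with variance \<open>1 - m\<^sup>2\<close>; its
  characteristic function is compared with that of the standard Gaussian, at the cost of the
  term \<open>u\<^sup>2 * m\<^sup>2 / 2\<close>.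
\<close>

lemma cmod_two_point_char_diff_le:
  fixes m u :: real
  assumes "\<bar>m\<bar> \<le> 1"
  shows "cmod (of_real ((1 + m) / 2) * iexp (u * (1 - m)) + of_real ((1 - m) / 2) * iexp (u * (- 1 - m))
      - of_real (exp (- (u\<^sup>2 / 2))))
    \<le> 4 / 3 * \<bar>u\<bar> ^ 3 + u\<^sup>2 * m\<^sup>2 / 2 + u ^ 4 / 8"
proof -
  define x y a b where "x = u * (1 - m)" and "y = u * (- 1 - m)"
    and "a = (1 + m) / 2" and "b = (1 - m) / 2"
  \<comment> \<open>\<open>h\<close> is the Taylor remainder of third order; keeping the quadratic
    part exact lets mean and variance be inserted.\<close>
  define h where "h z = iexp z - (1 + \<i> * of_real z - of_real (z\<^sup>2 / 2))" for z :: real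
  have h: "cmod (h z) \<le> \<bar>z\<bar> ^ 3 / 6" for z
    using iexp_approx1[of z 2]
    by (simp add: h_def eval_nat_numeral power2_eq_square algebra_simps)
  have ab: "a \<ge> 0" "b \<ge> 0" "a + b = 1" using assms by (auto simp: a_def b_def field_simps)
  have mean: "a * x + b * y = 0" and var: "a * x\<^sup>2 + b * y\<^sup>2 = u\<^sup>2 - u\<^sup>2 * m\<^sup>2"
    by (simp_all add: a_def b_def x_def y_def field_simps power2_eq_square)
  have "of_real a * iexp x + of_real b * iexp y - of_real (exp (- (u\<^sup>2 / 2)))
      = of_real a * h x + of_real b * h y + of_real (u\<^sup>2 * m\<^sup>2 / 2)
        - of_real (exp (- (u\<^sup>2 / 2)) - (1 - u\<^sup>2 / 2))"
  proof -
    have "of_real a * h x + of_real b * h y = of_real a * iexp x + of_real b * iexp y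
        - of_real (a + b) - \<i> * of_real (a * x + b * y) + of_real ((a * x\<^sup>2 + b * y\<^sup>2) / 2)"
      by (simp add: h_def field_simps)
    then have eq: "of_real a * iexp x + of_real b * iexp y
        = of_real a * h x + of_real b * h y + 1 - of_real ((u\<^sup>2 - u\<^sup>2 * m\<^sup>2) / 2)"
      unfolding mean var ab(3) by (simp add: algebra_simps)
    show ?thesis unfolding eq by (simp add: diff_divide_distrib)
  qed
  also have "cmod \<dots> \<le> a * cmod (h x) + b * cmod (h y) + u\<^sup>2 * m\<^sup>2 / 2
      + \<bar>exp (- (u\<^sup>2 / 2)) - (1 - u\<^sup>2 / 2)\<bar>"
  proof -
    have "cmod (of_real a * h x) = a * cmod (h x)" "cmod (of_real b * h y) = b * cmod (h y)"
      using ab by (simp_all add: norm_mult)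
    moreover have "cmod (of_real (u\<^sup>2 * m\<^sup>2 / 2)) = u\<^sup>2 * m\<^sup>2 / 2"
      unfolding norm_of_real by simp
    ultimately show ?thesis
      using norm_triangle_ineq4[of "of_real a * h x + of_real b * h y + of_real (u\<^sup>2 * m\<^sup>2 / 2)"
          "of_real (exp (- (u\<^sup>2 / 2)) - (1 - u\<^sup>2 / 2))"]
        norm_triangle_ineq[of "of_real a * h x + of_real b * h y" "of_real (u\<^sup>2 * m\<^sup>2 / 2)"]
        norm_triangle_ineq[of "of_real a * h x" "of_real b * h y"]
      unfolding norm_of_real[of "exp (- (u\<^sup>2 / 2)) - (1 - u\<^sup>2 / 2)"] by linarith
  qed
  \<comment> \<open>Both |1 - m| and |-1 - m| are at most 2, whence the factor 2^3; the last term is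
    \<open>exp_minus_quadratic\<close> at u^2 / 2.\<close>
  also have "\<dots> \<le> a * (8 * \<bar>u\<bar> ^ 3 / 6) + b * (8 * \<bar>u\<bar> ^ 3 / 6) + u\<^sup>2 * m\<^sup>2 / 2 + u ^ 4 / 8"
  proof -
    have cube: "\<bar>z\<bar> ^ 3 / 6 \<le> 8 * \<bar>u\<bar> ^ 3 / 6" if "\<bar>z\<bar> \<le> 2 * \<bar>u\<bar>" for z
      using power_mono[OF that abs_ge_zero, of 3] by (simp add: power_mult_distrib)
    have "\<bar>x\<bar> \<le> 2 * \<bar>u\<bar>" "\<bar>y\<bar> \<le> 2 * \<bar>u\<bar>"
    proof -
      have "\<bar>1 - m\<bar> \<le> 2" "\<bar>- 1 - m\<bar> \<le> 2" using assms by linarith+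
      then show "\<bar>x\<bar> \<le> 2 * \<bar>u\<bar>" "\<bar>y\<bar> \<le> 2 * \<bar>u\<bar>"
        unfolding x_def y_def abs_mult mult.commute[of "\<bar>u\<bar>"] by (intro mult_right_mono; simp)+
    qed
    from this[THEN cube] have "cmod (h x) \<le> 8 * \<bar>u\<bar> ^ 3 / 6" "cmod (h y) \<le> 8 * \<bar>u\<bar> ^ 3 / 6"
      using h[of x] h[of y] by linarith+
    moreover have "\<bar>exp (- (u\<^sup>2 / 2)) - (1 - u\<^sup>2 / 2)\<bar> \<le> u ^ 4 / 8"
      using exp_minus_quadratic[of "u\<^sup>2 / 2"] by (simp add: power_divide)
    ultimately show ?thesis using ab by (intro add_mono mult_left_mono order_refl)
  qed
  also have "\<dots> = (a + b) * (4 / 3 * \<bar>u\<bar> ^ 3) + u\<^sup>2 * m\<^sup>2 / 2 + u ^ 4 / 8"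
    by (simp add: field_simps)
  finally show ?thesis unfolding ab(3) mult_1_left by (simp only: x_def y_def a_def b_def)
qed

text \<open>Partial sums increase, so the test keeps an initial block of terms, whose total is a
  partial sum not exceeding \<open>r\<close>. Testing \<open>S (Suc k)\<close>, which includes
  \<open>y k\<close>, rules out an overshoot.\<close>

lemma truncated_sum:
  fixes y :: "nat \<Rightarrow> real"
  assumes y: "\<And>k. y k \<ge> 0" and r: "r \<ge> 0"
  defines "S \<equiv> \<lambda>n. \<Sum>k=1..<n. y k"
  shows "(\<Sum>k=1..<n. if S (Suc k) \<le> r then y k else 0) \<le> r"
    and "S n \<le> r \<Longrightarrow> k \<in> {1..<n} \<Longrightarrow> S (Suc k) \<le> r"
proof -
  have mono: "S m \<le> S n" if "m \<le> n" for m n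
    unfolding S_def using y that by (intro sum_mono2) auto
  show *: "S (Suc k) \<le> r" if "S n \<le> r" "k \<in> {1..<n}" for n k
    using mono[of "Suc k" n] that by auto
  show "(\<Sum>k=1..<n. if S (Suc k) \<le> r then y k else 0) \<le> r"
  proof (induction n)
    case (Suc n)
    show ?case
    proof (cases "S (Suc n) \<le> r")
      case True
      have "(\<Sum>k=1..<Suc n. if S (Suc k) \<le> r then y k else 0) = S (Suc n)"
      proof -
        have eq: "(if S (Suc k) \<le> r then y k else 0) = y k" if "k \<in> {1..<Suc n}" for k
          using *[OF True that] by simp
        have "(\<Sum>k=1..<Suc n. if S (Suc k) \<le> r then y k else 0) = (\<Sum>k=1..<Suc n. y k)"
          by (rule sum.cong[OF refl eq])
        then show ?thesis by (simp only: S_def)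
      qed
      with True show ?thesis by simp
    next
      case False
      then show ?thesis using Suc r by (cases "n \<ge> 1") auto
    qed
  qed (use r in simp)
qed

text \<open>The martingale N n of the overview; with \<open>a\<close> as a parameter, the formula
  for the estimation error is purely algebraic and needs no locale.\<close>

definition innovation_sum :: "real \<Rightarrow> (nat \<Rightarrow> real) \<Rightarrow> nat \<Rightarrow> real" where
  "innovation_sum a x n = (\<Sum>k=1..<n. mean_position x k * (x (Suc k) - a * mean_position x k))"

section \<open>Exponential comparison and the limit law of the martingale\<close>

context elephant_random_walk
begin

lemma abs_memory_mean_position_le: "\<bar>memory * mean_position (path \<omega>) k\<bar> \<le> 1"
  unfolding abs_mult using memory_bounds abs_mean_position_le[of \<omega> k]
  by (intro mult_le_one) auto

text \<open>With Gaussian innovations of unit conditional variance, exp (V / 2 + i N) would be a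
  martingale starting at 1. Replacing the conditional characteristic function of one step by exp
  (-u^2 / 2) costs \<open>err\<close> times a factor of modulus at most exp (b / 2), and these
  errors add up.\<close>

lemma innovation_exponential_bound:
  fixes u :: "nat \<Rightarrow> (nat \<Rightarrow> real) \<Rightarrow> real"
  assumes u: "\<And>k. k \<ge> 1 \<Longrightarrow> adapted k (u k)"
    and b: "\<And>\<omega>. (\<Sum>k=1..<n. (u k (path \<omega>))\<^sup>2) \<le> b"
    and n: "n \<ge> 1"
  defines "err \<equiv> \<lambda>k x. 4 / 3 * \<bar>u k x\<bar> ^ 3 + (u k x)\<^sup>2 * (memory * mean_position x k)\<^sup>2 / 2 + u k x ^ 4 / 8"
  shows "cmod ((\<integral>\<omega>. of_real (exp ((\<Sum>k=1..<n. (u k (path \<omega>))\<^sup>2) / 2))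
      * iexp (\<Sum>k=1..<n. u k (path \<omega>) * innovation k (path \<omega>)) \<partial>M) - 1)
    \<le> exp (b / 2) * (\<Sum>k=1..<n. expectation (\<lambda>\<omega>. err k (path \<omega>)))"
proof -
  define V where "V m x = (\<Sum>k=1..<m. (u k x)\<^sup>2)" for m x
  define N where "N m x = (\<Sum>k=1..<m. u k x * innovation k x)" for m x
  define R where "R m x = complex_of_real (exp (V m x / 2)) * iexp (N m x)" for m x
  have adV: "adapted m (V m)" if "m \<ge> 1" for m
    unfolding V_def using adapted_mono[OF u, of _ m] by (intro adapted_sum) (auto simp: adapted_def)
  have adN: "adapted m (N m)" if "m \<ge> 1" for m
    unfolding N_def using adapted_mono[OF u, of _ m] adapted_mono[OF adapted_innovation, of _ m]
    by (intro adapted_sum) (auto simp: adapted_def)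
  have adR: "adapted m (R m)" if "m \<ge> 1" for m
    using adV[OF that] adN[OF that] by (simp add: adapted_def R_def)
  have "cmod ((\<integral>\<omega>. R m (path \<omega>) \<partial>M) - 1)
      \<le> exp (b / 2) * (\<Sum>k=1..<m. expectation (\<lambda>\<omega>. err k (path \<omega>)))" if "1 \<le> m" "m \<le> n" for m
    using that
  proof (induction m rule: dec_induct)
    case base
    show ?case by (simp add: R_def V_def N_def prob_space)
  next
    case (step k)
    have k: "k \<ge> 1" "k < n" using step by auto
    define \<psi> where "\<psi> x = of_real ((1 + memory * mean_position x k) / 2) * iexp (u k x * (1 - memory * mean_position x k))
      + of_real ((1 - memory * mean_position x k) / 2) * iexp (u k x * (- 1 - memory * mean_position x k))" for x
    \<comment> \<open>The weight \<open>u k\<close> is known at time \<open>k\<close>, so exp (u^2 /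
      2) belongs to the adapted factor.\<close>
    define G where "G x = R k x * of_real (exp ((u k x)\<^sup>2 / 2))" for x
    have adG: "adapted k G" using adR[OF k(1)] u[OF k(1)] by (simp add: adapted_def G_def)
    have ad\<psi>: "adapted k \<psi>" using u[OF k(1)] by (simp add: adapted_def \<psi>_def)
    have R_Suc: "R (Suc k) x = G x * iexp (u k x * innovation k x)" for x
      using k by (simp add: G_def R_def V_def N_def add_divide_distrib exp_add algebra_simps)
    have next_R: "next_mean k (R (Suc k)) x = G x * \<psi> x" for x
      unfolding next_mean_def R_Suc
      by (simp add: adapted_upd[OF adG] adapted_upd[OF u[OF k(1)]] innovation_def \<psi>_def
          scaleR_conv_of_real distrib_left) (simp add: mult_ac)
    have R_k: "R k x = G x * of_real (exp (- ((u k x)\<^sup>2 / 2)))" for x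
      by (simp add: G_def mult.assoc exp_minus flip: of_real_mult)
    have int: "integrable M (\<lambda>\<omega>. G (path \<omega>) * \<psi> (path \<omega>))"
        "integrable M (\<lambda>\<omega>. G (path \<omega>) * of_real (exp (- ((u k (path \<omega>))\<^sup>2 / 2))))"
      by (rule integrable_adapted[where n = k and F = "\<lambda>x. G x * \<psi> x"]
          integrable_adapted[where n = k and F = "\<lambda>x. G x * of_real (exp (- ((u k x)\<^sup>2 / 2)))"],
          use adG ad\<psi> u[OF k(1)] in \<open>simp add: adapted_def\<close>)+
    have interr: "integrable M (\<lambda>\<omega>. err k (path \<omega>))"
      using u[OF k(1)] by (intro integrable_adapted[of k]) (simp add: adapted_def err_def)
    have "(\<integral>\<omega>. R (Suc k) (path \<omega>) \<partial>M) - (\<integral>\<omega>. R k (path \<omega>) \<partial>M)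
        = (\<integral>\<omega>. G (path \<omega>) * (\<psi> (path \<omega>) - of_real (exp (- ((u k (path \<omega>))\<^sup>2 / 2)))) \<partial>M)"
      unfolding expectation_next[OF adR[of "Suc k", simplified] k(1)] next_R R_k
      using int by (simp add: right_diff_distrib)
    also have "cmod \<dots> \<le> expectation (\<lambda>\<omega>. cmod (G (path \<omega>) * (\<psi> (path \<omega>) - of_real (exp (- ((u k (path \<omega>))\<^sup>2 / 2))))))"
      by (rule integral_norm_bound)
    also have "\<dots> \<le> expectation (\<lambda>\<omega>. exp (b / 2) * err k (path \<omega>))"
    proof (rule integral_mono)
      show "integrable M (\<lambda>\<omega>. cmod (G (path \<omega>) * (\<psi> (path \<omega>) - of_real (exp (- ((u k (path \<omega>))\<^sup>2 / 2))))))"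
        unfolding right_diff_distrib using int by (intro integrable_norm Bochner_Integration.integrable_diff)
      show "integrable M (\<lambda>\<omega>. exp (b / 2) * err k (path \<omega>))" using interr by simp
      fix \<omega>
      \<comment> \<open>The bound \<open>b\<close> is given for the full sum; monotonicity in the
        index passes it to earlier times, which is why the induction stays below
        \<open>n\<close>.\<close>
      have "V (Suc k) (path \<omega>) \<le> V n (path \<omega>)"
        unfolding V_def using k by (intro sum_mono2) auto
      also have "\<dots> \<le> b" unfolding V_def by (rule b)
      finally have "cmod (G (path \<omega>)) \<le> exp (b / 2)"
        using k by (simp add: G_def R_def norm_mult V_def flip: exp_add)
      moreover have "cmod (\<psi> (path \<omega>) - of_real (exp (- ((u k (path \<omega>))\<^sup>2 / 2)))) \<le> err k (path \<omega>)"
        unfolding \<psi>_def err_def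
        by (rule cmod_two_point_char_diff_le[OF abs_memory_mean_position_le])
      ultimately show "cmod (G (path \<omega>) * (\<psi> (path \<omega>) - of_real (exp (- ((u k (path \<omega>))\<^sup>2 / 2)))))
          \<le> exp (b / 2) * err k (path \<omega>)"
        unfolding norm_mult by (intro mult_mono) auto
    qed
    also have "\<dots> = exp (b / 2) * expectation (\<lambda>\<omega>. err k (path \<omega>))" by simp
    finally have "cmod ((\<integral>\<omega>. R (Suc k) (path \<omega>) \<partial>M) - (\<integral>\<omega>. R k (path \<omega>) \<partial>M))
        \<le> exp (b / 2) * expectation (\<lambda>\<omega>. err k (path \<omega>))" .
    with step.IH k show ?case
      using norm_triangle_ineq[of "(\<integral>\<omega>. R (Suc k) (path \<omega>) \<partial>M) - (\<integral>\<omega>. R k (path \<omega>) \<partial>M)"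
          "(\<integral>\<omega>. R k (path \<omega>) \<partial>M) - 1"]
      by (simp add: distrib_left)
  qed
  from this[OF n order_refl] show ?thesis unfolding R_def V_def N_def .
qed

lemma adapted_innovation_sum: "adapted n (\<lambda>x. innovation_sum memory x n)"
  by (auto simp: adapted_def innovation_sum_def intro!: sum.cong)

lemma adapted_sum_mean_squares: "adapted n (\<lambda>x. sum_mean_squares x n)"
  by (simp add: adapted_def)

context
  assumes diffusive: "p < 3 / 4"
begin

text \<open>E (Y k)^2 is at most of order 1 / k, which sums to ln n, while E (Y k)^4 is
  summable.\<close>

lemma sum_moments_bound:
  obtains c where "c \<ge> 0"
    "\<And>n. n \<ge> 1 \<Longrightarrow> (\<Sum>k=1..<n. expectation (\<lambda>\<omega>. (mean_position (path \<omega>) k)\<^sup>2)) \<le> c * (ln n + 1)"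
    "\<And>n. (\<Sum>k=1..<n. expectation (\<lambda>\<omega>. (mean_position (path \<omega>) k) ^ 4)) \<le> 2 * c"
proof -
  obtain c where c: "c \<ge> 0" "\<And>n. n \<ge> 1 \<Longrightarrow> expectation (\<lambda>\<omega>. (mean_position (path \<omega>) n)\<^sup>2) \<le> c / n"
    "\<And>n. n \<ge> 1 \<Longrightarrow> expectation (\<lambda>\<omega>. (mean_position (path \<omega>) n) ^ 4) \<le> c / real n ^ 2"
    using mean_position_moments[OF diffusive] by metis
  show thesis
  proof (rule that[OF c(1)])
    fix n :: nat assume n: "n \<ge> 1"
    have "(\<Sum>k=1..<n. expectation (\<lambda>\<omega>. (mean_position (path \<omega>) k)\<^sup>2)) \<le> (\<Sum>k=1..<n. c / k)"
      by (intro sum_mono c(2)) auto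
    also have "\<dots> = c * (\<Sum>k=1..<n. 1 / real k)" by (simp add: sum_distrib_left)
    also have "\<dots> \<le> c * (ln n + 1)"
      using c(1) sum_inverse_le_harm[of n] harm_le_ln[OF n] by (intro mult_left_mono) linarith
    finally show "(\<Sum>k=1..<n. expectation (\<lambda>\<omega>. (mean_position (path \<omega>) k)\<^sup>2)) \<le> c * (ln n + 1)" .
  next
    fix n :: nat
    have "(\<Sum>k=1..<n. expectation (\<lambda>\<omega>. (mean_position (path \<omega>) k) ^ 4)) \<le> (\<Sum>k=1..<n. c / real k ^ 2)"
      by (intro sum_mono c(3)) auto
    also have "\<dots> = c * (\<Sum>k=1..<n. 1 / (real k)\<^sup>2)" by (simp add: sum_distrib_left)
    also have "\<dots> \<le> c * 2"
      using c(1) sum_inverse_square_le by (intro mult_left_mono)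
    finally show "(\<Sum>k=1..<n. expectation (\<lambda>\<omega>. (mean_position (path \<omega>) k) ^ 4)) \<le> 2 * c" by simp
  qed
qed

text \<open>Supplies the L^1 bound that \<open>char_slutsky\<close> asks of its leading factor; it
  follows from the second moment.\<close>

lemma expectation_innovation_sum_bounded:
  obtains C where "\<forall>\<^sub>F n in sequentially.
    expectation (\<lambda>\<omega>. \<bar>innovation_sum memory (path \<omega>) n / sqrt (ln n)\<bar>) \<le> C"
proof -
  obtain c where c: "c \<ge> 0"
    "\<And>n. n \<ge> 1 \<Longrightarrow> (\<Sum>k=1..<n. expectation (\<lambda>\<omega>. (mean_position (path \<omega>) k)\<^sup>2)) \<le> c * (ln n + 1)"
    "\<And>n. (\<Sum>k=1..<n. expectation (\<lambda>\<omega>. (mean_position (path \<omega>) k) ^ 4)) \<le> 2 * c"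
    by (rule sum_moments_bound) (rule that)
  have "\<forall>\<^sub>F n :: nat in sequentially. ln (real n) \<ge> 1" by real_asymp
  then have "\<forall>\<^sub>F n in sequentially.
    expectation (\<lambda>\<omega>. \<bar>innovation_sum memory (path \<omega>) n / sqrt (ln n)\<bar>) \<le> sqrt (2 * c)"
    using eventually_ge_at_top[of 1]
  proof eventually_elim
    case (elim n)
    let ?N = "\<lambda>\<omega>. innovation_sum memory (path \<omega>) n"
    have int: "integrable M ?N" "integrable M (\<lambda>\<omega>. (?N \<omega>)\<^sup>2)"
      by (rule integrable_adapted[OF adapted_innovation_sum]
          integrable_adapted[where n = n and F = "\<lambda>x. (innovation_sum memory x n)\<^sup>2"],
          (use adapted_innovation_sum in \<open>simp add: adapted_def\<close>)?)+
    have "expectation (\<lambda>\<omega>. (?N \<omega>)\<^sup>2) \<le> (\<Sum>k=1..<n. expectation (\<lambda>\<omega>. (mean_position (path \<omega>) k)\<^sup>2))"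
      using expectation_innovation_sum_sq_le[of "\<lambda>k x. mean_position x k" n] elim
      by (simp add: innovation_sum_def innovation_def adapted_def)
    also have "\<dots> \<le> c * (ln n + 1)" using c(2) elim by simp
    also have "\<dots> \<le> 2 * c * ln n" using elim mult_left_mono[OF elim(1) c(1)] by (simp add: algebra_simps)
    finally have "sqrt (expectation (\<lambda>\<omega>. (?N \<omega>)\<^sup>2)) \<le> sqrt (2 * c) * sqrt (ln n)"
      by (simp flip: real_sqrt_mult)
    with expectation_abs_le_sqrt[OF int]
    have "expectation (\<lambda>\<omega>. \<bar>?N \<omega>\<bar>) \<le> sqrt (2 * c) * sqrt (ln n)" by linarith
    moreover have "sqrt (ln (real n)) > 0" using elim by (intro real_sqrt_gt_zero) linarith
    ultimately have "expectation (\<lambda>\<omega>. \<bar>?N \<omega>\<bar>) / sqrt (ln n) \<le> sqrt (2 * c)"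
      by (simp only: pos_divide_le_eq)
    moreover have "\<bar>sqrt (ln (real n))\<bar> = sqrt (ln n)" using elim by simp
    ultimately show ?case by (simp only: abs_divide integral_divide_zero)
  qed
  then show thesis by (rule that)
qed

text \<open>
  The weights are cut off before their sum of squares exceeds twice its limit, so that the
  exponential bound applies; the cut-off changes nothing outside an event of vanishing probability.
\<close>

lemma innovation_sum_char_tendsto:
  "(\<lambda>n. char (distr M borel (\<lambda>\<omega>. innovation_sum memory (path \<omega>) n / sqrt (ln n))) t)
    \<longlonglongrightarrow> exp (- (t\<^sup>2 / (3 - 4 * p)) / 2)"
proof -
  obtain c where c: "c \<ge> 0"
    "\<And>n. n \<ge> 1 \<Longrightarrow> (\<Sum>k=1..<n. expectation (\<lambda>\<omega>. (mean_position (path \<omega>) k)\<^sup>2)) \<le> c * (ln n + 1)"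
    "\<And>n. (\<Sum>k=1..<n. expectation (\<lambda>\<omega>. (mean_position (path \<omega>) k) ^ 4)) \<le> 2 * c"
    by (rule sum_moments_bound) (rule that)
  define v where "v = 1 / (3 - 4 * p)"
  have v: "v > 0" using diffusive by (simp add: v_def)
  define \<alpha> where "\<alpha> n = expectation (\<lambda>\<omega>. \<bar>sum_mean_squares (path \<omega>) n / ln n - v\<bar>)" for n :: nat
  \<comment> \<open>The summed one-step error for weights with \<theta> = t / sqrt (ln n): cubic and
    quartic terms meet second moments, the variance defect meets fourth moments.\<close>
  define \<beta> where "\<beta> n = (4 / 3 * \<bar>t\<bar> ^ 3 / sqrt (ln (real n)) ^ 3 + t ^ 4 / (ln (real n))\<^sup>2) * (c * (ln n + 1))
      + t\<^sup>2 / ln (real n) * (2 * c)" for n :: nat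
  \<comment> \<open>Three comparisons: cutting off the weights; inserting exp ((V - v t^2) / 2),
    which is 1 when V has its limit value; and the exponential bound. The first two cost a multiple
    of \<open>\<alpha> n\<close>, the last one \<open>\<beta> n\<close>.\<close>
  have bound: "cmod (char (distr M borel (\<lambda>\<omega>. innovation_sum memory (path \<omega>) n / sqrt (ln n))) t
        - exp (- (v * t\<^sup>2 / 2)))
      \<le> 2 / v * \<alpha> n + t\<^sup>2 / 2 * exp (v * t\<^sup>2 / 2) * \<alpha> n + exp (v * t\<^sup>2) * \<beta> n" if n: "n \<ge> 2" for n
  proof -
    define L where "L = ln (real n)"
    have L: "L > 0" using n by (simp add: L_def)
    define \<theta> where "\<theta> = t / sqrt L"
    define r where "r = 2 * v * L"
    have r: "r \<ge> 0" using v L by (simp add: r_def)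
    have \<theta>_sq: "\<theta>\<^sup>2 = t\<^sup>2 / L" using L by (simp add: \<theta>_def power_divide)
    \<comment> \<open>The test reads \<open>sum_mean_squares x (Suc k)\<close>, a function of the
      first \<open>k\<close> steps, so \<open>u k\<close> is adapted at time
      \<open>k\<close>.\<close>
    define u where "u k x = (if sum_mean_squares x (Suc k) \<le> r then \<theta> * mean_position x k else 0)"
      for k :: nat and x
    have u: "adapted k (u k)" for k by (simp add: adapted_def u_def)
    define \<Phi> where "\<Phi> x = (\<Sum>k=1..<n. u k x * innovation k x)" for x
    define V where "V x = (\<Sum>k=1..<n. (u k x)\<^sup>2)" for x
    define A where "A x = sum_mean_squares x n / L" for x
    define Z where "Z x = innovation_sum memory x n / sqrt L" for x
    have V_eq: "V x = \<theta>\<^sup>2 * (\<Sum>k=1..<n. if sum_mean_squares x (Suc k) \<le> r then (mean_position x k)\<^sup>2 else 0)" for x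
      unfolding V_def sum_distrib_left by (intro sum.cong) (auto simp: u_def power_mult_distrib power_divide)
    have V_bounds: "0 \<le> V x" "V x \<le> 2 * v * t\<^sup>2" for x
    proof -
      show "0 \<le> V x" unfolding V_def by (intro sum_nonneg) auto
      have "V x \<le> \<theta>\<^sup>2 * r" unfolding V_eq sum_mean_squares_def
        using truncated_sum(1)[of "\<lambda>k. (mean_position x k)\<^sup>2" r n] r by (intro mult_left_mono) auto
      also have "\<dots> = 2 * v * t\<^sup>2" using L by (simp add: \<theta>_sq r_def)
      finally show "V x \<le> 2 * v * t\<^sup>2" .
    qed
    have untruncated: "\<Phi> x = t * Z x" "V x = t\<^sup>2 * A x" if "A x \<le> 2 * v" for x
    proof -
      have "sum_mean_squares x n \<le> r" using that L by (simp add: A_def r_def divide_le_eq)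
      then have le: "sum_mean_squares x (Suc k) \<le> r" if "k \<in> {1..<n}" for k
        using truncated_sum(2)[of "\<lambda>k. (mean_position x k)\<^sup>2" r n k] that r by (simp add: sum_mean_squares_def)
      show "\<Phi> x = t * Z x"
        using le by (simp add: \<Phi>_def Z_def innovation_sum_def innovation_def u_def \<theta>_def sum_distrib_left
            sum_divide_distrib mult_ac)
      show "V x = t\<^sup>2 * A x"
        using le by (simp add: V_eq A_def \<theta>_sq sum_mean_squares_def)
    qed
    \<comment> \<open>Where the cut-off may act, \<open>A\<close> misses its limit by at least
      \<open>v\<close>, so a bounded error there is a multiple of
      \<open>\<bar>A x - v\<bar>\<close>.\<close>
    have truncated: "v \<le> \<bar>A x - v\<bar>" if "\<not> A x \<le> 2 * v" for x
      using that by linarith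
    have adZ: "adapted n Z" using adapted_innovation_sum by (simp add: adapted_def Z_def)
    have adA: "adapted n A" by (simp add: adapted_def A_def)
    have ad\<Phi>: "adapted n \<Phi>"
      unfolding \<Phi>_def using adapted_mono[OF u, of _ n] adapted_mono[OF adapted_innovation, of _ n]
      by (intro adapted_sum) (auto simp: adapted_def)
    have adV: "adapted n V"
      unfolding V_def using adapted_mono[OF u, of _ n] by (intro adapted_sum) (auto simp: adapted_def)
    let ?E = "\<lambda>F. (\<integral>\<omega>. F (path \<omega>) \<partial>M)"
    have triangle: "cmod (a - d) \<le> cmod (a - b) + cmod (b - c) + cmod (c - d)" for a b c d
      using norm_triangle_ineq[of "a - b" "b - d"] norm_triangle_ineq[of "b - c" "c - d"] by simp
    have intA: "integrable M (\<lambda>\<omega>. \<bar>A (path \<omega>) - v\<bar>)"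
      using adA by (intro integrable_adapted[of n "\<lambda>x. \<bar>A x - v\<bar>"]) (simp add: adapted_def)
    have \<alpha>: "\<alpha> n = expectation (\<lambda>\<omega>. \<bar>A (path \<omega>) - v\<bar>)" by (simp add: \<alpha>_def A_def L_def)
    have int: "integrable M (\<lambda>\<omega>. iexp (t * Z (path \<omega>)))" "integrable M (\<lambda>\<omega>. iexp (\<Phi> (path \<omega>)))"
      "integrable M (\<lambda>\<omega>. of_real (exp (V (path \<omega>) / 2)) * iexp (\<Phi> (path \<omega>)))"
      "integrable M (\<lambda>\<omega>. of_real (exp ((V (path \<omega>) - v * t\<^sup>2) / 2)) * iexp (\<Phi> (path \<omega>)))"
      by (rule integrable_adapted[where n = n and F = "\<lambda>x. iexp (t * Z x)"]
          integrable_adapted[where n = n and F = "\<lambda>x. iexp (\<Phi> x)"]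
          integrable_adapted[where n = n and F = "\<lambda>x. of_real (exp (V x / 2)) * iexp (\<Phi> x)"]
          integrable_adapted[where n = n and F = "\<lambda>x. of_real (exp ((V x - v * t\<^sup>2) / 2)) * iexp (\<Phi> x)"],
          use adZ ad\<Phi> adV in \<open>simp add: adapted_def\<close>)+
    have "cmod (?E (\<lambda>x. iexp (t * Z x)) - ?E (\<lambda>x. iexp (\<Phi> x))) \<le> 2 / v * \<alpha> n"
    proof -
      have "cmod (?E (\<lambda>x. iexp (t * Z x)) - ?E (\<lambda>x. iexp (\<Phi> x)))
          \<le> expectation (\<lambda>\<omega>. cmod (iexp (t * Z (path \<omega>)) - iexp (\<Phi> (path \<omega>))))"
        using integral_norm_bound[of M "\<lambda>\<omega>. iexp (t * Z (path \<omega>)) - iexp (\<Phi> (path \<omega>))"] int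
        by (simp del: of_real_mult)
      also have "\<dots> \<le> expectation (\<lambda>\<omega>. 2 / v * \<bar>A (path \<omega>) - v\<bar>)"
      proof (rule integral_mono)
        show "integrable M (\<lambda>\<omega>. cmod (iexp (t * Z (path \<omega>)) - iexp (\<Phi> (path \<omega>))))"
          using int by (intro integrable_norm Bochner_Integration.integrable_diff)
        show "integrable M (\<lambda>\<omega>. 2 / v * \<bar>A (path \<omega>) - v\<bar>)" using intA by simp
        fix \<omega>
        show "cmod (iexp (t * Z (path \<omega>)) - iexp (\<Phi> (path \<omega>))) \<le> 2 / v * \<bar>A (path \<omega>) - v\<bar>"
        proof (cases "A (path \<omega>) \<le> 2 * v")
          case True
          then show ?thesis using untruncated(1)[OF True] v by simp
        next
          case False
          have "2 \<le> 2 / v * \<bar>A (path \<omega>) - v\<bar>" using truncated[OF False] v by (simp add: field_simps)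
          with cmod_iexp_diff_le_2[of "t * Z (path \<omega>)" "\<Phi> (path \<omega>)"] show ?thesis by linarith
        qed
      qed
      finally show ?thesis using \<alpha> by simp
    qed
    moreover have "cmod (?E (\<lambda>x. iexp (\<Phi> x)) - ?E (\<lambda>x. of_real (exp ((V x - v * t\<^sup>2) / 2)) * iexp (\<Phi> x)))
        \<le> t\<^sup>2 / 2 * exp (v * t\<^sup>2 / 2) * \<alpha> n"
    proof -
      have "cmod (?E (\<lambda>x. iexp (\<Phi> x)) - ?E (\<lambda>x. of_real (exp ((V x - v * t\<^sup>2) / 2)) * iexp (\<Phi> x)))
          \<le> expectation (\<lambda>\<omega>. cmod (iexp (\<Phi> (path \<omega>))
              - of_real (exp ((V (path \<omega>) - v * t\<^sup>2) / 2)) * iexp (\<Phi> (path \<omega>))))"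
        using integral_norm_bound[of M "\<lambda>\<omega>. iexp (\<Phi> (path \<omega>))
              - of_real (exp ((V (path \<omega>) - v * t\<^sup>2) / 2)) * iexp (\<Phi> (path \<omega>))"]
        by (simp only: Bochner_Integration.integral_diff[OF int(2) int(4)])
      also have "\<dots> \<le> expectation (\<lambda>\<omega>. t\<^sup>2 / 2 * exp (v * t\<^sup>2 / 2) * \<bar>A (path \<omega>) - v\<bar>)"
      proof (rule integral_mono)
        show "integrable M (\<lambda>\<omega>. cmod (iexp (\<Phi> (path \<omega>))
              - of_real (exp ((V (path \<omega>) - v * t\<^sup>2) / 2)) * iexp (\<Phi> (path \<omega>))))"
          using int by (intro integrable_norm Bochner_Integration.integrable_diff)
        show "integrable M (\<lambda>\<omega>. t\<^sup>2 / 2 * exp (v * t\<^sup>2 / 2) * \<bar>A (path \<omega>) - v\<bar>)" using intA by simp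
        fix \<omega>
        let ?x = "path \<omega>"
        let ?s = "(V ?x - v * t\<^sup>2) / 2"
        have "iexp (\<Phi> ?x) - of_real (exp ?s) * iexp (\<Phi> ?x) = of_real (1 - exp ?s) * iexp (\<Phi> ?x)"
          by (simp add: algebra_simps)
        then have "cmod (iexp (\<Phi> ?x) - of_real (exp ?s) * iexp (\<Phi> ?x)) = \<bar>1 - exp ?s\<bar>"
          by (simp only: norm_mult norm_of_real norm_exp_i_times mult_1_right)
        also have "\<dots> \<le> \<bar>?s\<bar> * exp \<bar>?s\<bar>" by (rule abs_one_minus_exp_le)
        also have "\<dots> \<le> (t\<^sup>2 / 2 * \<bar>A ?x - v\<bar>) * exp (v * t\<^sup>2 / 2)"
        proof (rule mult_mono)
          \<comment> \<open>\<open>V\<close> lies between 0 and 2 v t^2, an interval centred at v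
            t^2.\<close>
          have s: "\<bar>?s\<bar> \<le> v * t\<^sup>2 / 2" using V_bounds[of ?x] by (auto simp: abs_le_iff)
          then show "exp \<bar>?s\<bar> \<le> exp (v * t\<^sup>2 / 2)" by simp
          show "\<bar>?s\<bar> \<le> t\<^sup>2 / 2 * \<bar>A ?x - v\<bar>"
          proof (cases "A ?x \<le> 2 * v")
            case True
            have eq: "?s = t\<^sup>2 / 2 * (A ?x - v)" using untruncated(2)[OF True] by (simp add: algebra_simps)
            show ?thesis unfolding eq abs_mult by simp
          next
            case False
            have "v * t\<^sup>2 / 2 \<le> t\<^sup>2 / 2 * \<bar>A ?x - v\<bar>"
              using mult_left_mono[OF truncated[OF False], of "t\<^sup>2 / 2"] by (simp add: mult.commute)
            with s show ?thesis by linarith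
          qed
        qed auto
        finally show "cmod (iexp (\<Phi> ?x) - of_real (exp ?s) * iexp (\<Phi> ?x))
            \<le> t\<^sup>2 / 2 * exp (v * t\<^sup>2 / 2) * \<bar>A ?x - v\<bar>" by (simp add: mult_ac)
      qed
      finally show ?thesis using \<alpha> by simp
    qed
    moreover have "cmod (?E (\<lambda>x. of_real (exp ((V x - v * t\<^sup>2) / 2)) * iexp (\<Phi> x)) - exp (- (v * t\<^sup>2 / 2)))
        \<le> exp (v * t\<^sup>2) * \<beta> n"
    proof -
      define err where "err k x = 4 / 3 * \<bar>u k x\<bar> ^ 3 + (u k x)\<^sup>2 * (memory * mean_position x k)\<^sup>2 / 2
        + u k x ^ 4 / 8" for k x
      have "?E (\<lambda>x. of_real (exp ((V x - v * t\<^sup>2) / 2)) * iexp (\<Phi> x))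
          = of_real (exp (- (v * t\<^sup>2 / 2))) * ?E (\<lambda>x. of_real (exp (V x / 2)) * iexp (\<Phi> x))"
      proof -
        have "of_real (exp ((V x - v * t\<^sup>2) / 2)) * iexp (\<Phi> x)
            = of_real (exp (- (v * t\<^sup>2 / 2))) * (of_real (exp (V x / 2)) * iexp (\<Phi> x))" for x
        proof -
          have "exp ((V x - v * t\<^sup>2) / 2) = exp (- (v * t\<^sup>2 / 2)) * exp (V x / 2)"
            by (simp add: diff_divide_distrib flip: exp_add)
          then show ?thesis by (simp only: of_real_mult mult.assoc)
        qed
        then show ?thesis by (simp only: integral_mult_right_zero)
      qed
      then have "cmod (?E (\<lambda>x. of_real (exp ((V x - v * t\<^sup>2) / 2)) * iexp (\<Phi> x)) - exp (- (v * t\<^sup>2 / 2)))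
          = cmod (of_real (exp (- (v * t\<^sup>2 / 2))) * (?E (\<lambda>x. of_real (exp (V x / 2)) * iexp (\<Phi> x)) - 1))"
        by (simp only: right_diff_distrib mult_1_right)
      also have "\<dots> = exp (- (v * t\<^sup>2 / 2)) * cmod (?E (\<lambda>x. of_real (exp (V x / 2)) * iexp (\<Phi> x)) - 1)"
        by (simp only: norm_mult norm_of_real abs_exp_cancel)
      also have "\<dots> \<le> 1 * cmod (?E (\<lambda>x. of_real (exp (V x / 2)) * iexp (\<Phi> x)) - 1)"
        using v by (intro mult_right_mono) auto
      also have "\<dots> \<le> exp (2 * v * t\<^sup>2 / 2) * (\<Sum>k=1..<n. expectation (\<lambda>\<omega>. err k (path \<omega>)))"
        unfolding mult_1_left \<Phi>_def V_def err_def
        by (rule innovation_exponential_bound[OF u]) (use V_bounds(2) n in \<open>auto simp: V_def\<close>)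
      also have "\<dots> \<le> exp (2 * v * t\<^sup>2 / 2) * \<beta> n"
      proof (rule mult_left_mono)
        let ?Y = "\<lambda>k \<omega>. mean_position (path \<omega>) k"
        note intY = integrable_position[of "\<lambda>s. (s / real k) ^ j" k for k j]
        \<comment> \<open>\<theta>^3 ln n and \<theta>^4 ln n tend to 0, so there the powers of |Y|
          \<le> 1 may be lowered to the square; \<theta>^2 ln n equals t^2, so that term must keep
          the fourth power.\<close>
        let ?c = "4 / 3 * \<bar>\<theta>\<bar> ^ 3 + \<theta> ^ 4"
        have "expectation (\<lambda>\<omega>. err k (path \<omega>)) \<le> ?c * expectation (\<lambda>\<omega>. (?Y k \<omega>)\<^sup>2)
            + \<theta>\<^sup>2 * expectation (\<lambda>\<omega>. (?Y k \<omega>) ^ 4)" for k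
        proof -
          have "expectation (\<lambda>\<omega>. err k (path \<omega>)) \<le> expectation (\<lambda>\<omega>. ?c * (?Y k \<omega>)\<^sup>2 + \<theta>\<^sup>2 * (?Y k \<omega>) ^ 4)"
          proof (rule integral_mono)
            show "integrable M (\<lambda>\<omega>. err k (path \<omega>))"
              using u[of k] by (intro integrable_adapted[of k]) (simp add: adapted_def err_def)
            show "integrable M (\<lambda>\<omega>. ?c * (?Y k \<omega>)\<^sup>2 + \<theta>\<^sup>2 * (?Y k \<omega>) ^ 4)"
              using intY by (intro Bochner_Integration.integrable_add integrable_mult_right)
            fix \<omega>
            define y where "y = \<bar>?Y k \<omega>\<bar>"
            have y: "0 \<le> y" "y \<le> 1" using abs_mean_position_le by (auto simp: y_def)
            have uy: "\<bar>u k (path \<omega>)\<bar> \<le> \<bar>\<theta>\<bar> * y" by (simp add: u_def y_def abs_mult)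
            have "\<bar>u k (path \<omega>)\<bar> ^ 3 \<le> \<bar>\<theta>\<bar> ^ 3 * y\<^sup>2"
            proof -
              have "\<bar>u k (path \<omega>)\<bar> ^ 3 \<le> (\<bar>\<theta>\<bar> * y) ^ 3" using uy by (intro power_mono) auto
              also have "\<dots> \<le> \<bar>\<theta>\<bar> ^ 3 * y\<^sup>2"
                unfolding power_mult_distrib using y by (intro mult_left_mono power_decreasing) auto
              finally show ?thesis .
            qed
            moreover have "(u k (path \<omega>))\<^sup>2 * (memory * ?Y k \<omega>)\<^sup>2 / 2 \<le> \<theta>\<^sup>2 * y ^ 4"
            proof -
              have "(u k (path \<omega>))\<^sup>2 \<le> (\<bar>\<theta>\<bar> * y)\<^sup>2" using uy by (metis abs_ge_zero power2_abs power_mono)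
              moreover have "(memory * ?Y k \<omega>)\<^sup>2 \<le> y\<^sup>2"
                using memory_bounds mult_right_mono[of "\<bar>memory\<bar>" 1 y] y
                by (simp add: y_def flip: abs_le_square_iff) (simp add: abs_mult)
              ultimately have "(u k (path \<omega>))\<^sup>2 * (memory * ?Y k \<omega>)\<^sup>2 \<le> (\<bar>\<theta>\<bar> * y)\<^sup>2 * y\<^sup>2"
                by (intro mult_mono) auto
              also have "\<dots> = \<theta>\<^sup>2 * y ^ 4" by (simp add: power_mult_distrib eval_nat_numeral)
              finally have "(u k (path \<omega>))\<^sup>2 * (memory * ?Y k \<omega>)\<^sup>2 \<le> \<theta>\<^sup>2 * y ^ 4" .
              moreover have "0 \<le> \<theta>\<^sup>2 * y ^ 4" by simp
              ultimately show ?thesis by linarith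
            qed
            moreover have "u k (path \<omega>) ^ 4 / 8 \<le> \<theta> ^ 4 * y\<^sup>2"
            proof -
              have "u k (path \<omega>) ^ 4 = \<bar>u k (path \<omega>)\<bar> ^ 4" by (simp add: power_even_abs)
              also have "\<dots> \<le> (\<bar>\<theta>\<bar> * y) ^ 4" using uy by (intro power_mono) auto
              also have "\<dots> = \<theta> ^ 4 * y ^ 4" by (simp add: power_mult_distrib power_even_abs)
              also have "\<dots> \<le> \<theta> ^ 4 * y\<^sup>2"
                using y by (intro mult_left_mono power_decreasing) auto
              finally have "u k (path \<omega>) ^ 4 \<le> \<theta> ^ 4 * y\<^sup>2" .
              moreover have "0 \<le> \<theta> ^ 4 * y\<^sup>2" by simp
              ultimately show ?thesis by linarith
            qed
            ultimately have "err k (path \<omega>) \<le> 4 / 3 * (\<bar>\<theta>\<bar> ^ 3 * y\<^sup>2) + \<theta>\<^sup>2 * y ^ 4 + \<theta> ^ 4 * y\<^sup>2"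
              unfolding err_def by linarith
            also have "\<dots> = ?c * y\<^sup>2 + \<theta>\<^sup>2 * y ^ 4" by (simp add: algebra_simps)
            also have "y\<^sup>2 = (?Y k \<omega>)\<^sup>2" unfolding y_def by (rule power2_abs)
            also have "y ^ 4 = (?Y k \<omega>) ^ 4" unfolding y_def by (rule power_even_abs) simp
            finally show "err k (path \<omega>) \<le> ?c * (?Y k \<omega>)\<^sup>2 + \<theta>\<^sup>2 * (?Y k \<omega>) ^ 4" .
          qed
          also have "\<dots> = ?c * expectation (\<lambda>\<omega>. (?Y k \<omega>)\<^sup>2) + \<theta>\<^sup>2 * expectation (\<lambda>\<omega>. (?Y k \<omega>) ^ 4)"
            using intY by (subst Bochner_Integration.integral_add) (auto intro: integrable_mult_right)
          finally show ?thesis .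
        qed
        then have "(\<Sum>k=1..<n. expectation (\<lambda>\<omega>. err k (path \<omega>)))
            \<le> (\<Sum>k=1..<n. ?c * expectation (\<lambda>\<omega>. (?Y k \<omega>)\<^sup>2) + \<theta>\<^sup>2 * expectation (\<lambda>\<omega>. (?Y k \<omega>) ^ 4))"
          by (rule sum_mono)
        also have "\<dots> = ?c * (\<Sum>k=1..<n. expectation (\<lambda>\<omega>. (?Y k \<omega>)\<^sup>2))
            + \<theta>\<^sup>2 * (\<Sum>k=1..<n. expectation (\<lambda>\<omega>. (?Y k \<omega>) ^ 4))"
          by (simp only: sum.distrib sum_distrib_left)
        also have "\<dots> \<le> ?c * (c * (ln n + 1)) + \<theta>\<^sup>2 * (2 * c)"
          using c n by (intro add_mono mult_left_mono) auto
        also have "\<dots> = \<beta> n"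
        proof -
          have "\<bar>\<theta>\<bar> ^ 3 = \<bar>t\<bar> ^ 3 / sqrt L ^ 3" using L by (simp add: \<theta>_def power_divide abs_divide)
          moreover have "\<theta> ^ 4 = t ^ 4 / L\<^sup>2"
          proof -
            have "\<theta> ^ 4 = (\<theta>\<^sup>2)\<^sup>2" by simp
            then show ?thesis unfolding \<theta>_sq by (simp add: power_divide)
          qed
          ultimately show ?thesis using \<theta>_sq by (simp add: \<beta>_def L_def)
        qed
        finally show "(\<Sum>k=1..<n. expectation (\<lambda>\<omega>. err k (path \<omega>))) \<le> \<beta> n" .
      qed auto
      finally show ?thesis by (simp add: mult_ac)
    qed
    ultimately have "cmod (?E (\<lambda>x. iexp (t * Z x)) - exp (- (v * t\<^sup>2 / 2)))
        \<le> 2 / v * \<alpha> n + t\<^sup>2 / 2 * exp (v * t\<^sup>2 / 2) * \<alpha> n + exp (v * t\<^sup>2) * \<beta> n"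
      by (rule order_trans[OF triangle add_mono[OF add_mono]])
    moreover have "char (distr M borel (\<lambda>\<omega>. Z (path \<omega>))) t = ?E (\<lambda>x. iexp (t * Z x))"
      unfolding char_def using measurable_adapted[OF adZ] by (subst integral_distr) auto
    ultimately show ?thesis by (simp add: Z_def L_def)
  qed
  have \<alpha>_lim: "\<alpha> \<longlonglongrightarrow> 0"
    using sum_mean_squares_L1[OF diffusive] by (simp add: \<alpha>_def[abs_def] v_def)
  have \<beta>_lim: "\<beta> \<longlonglongrightarrow> 0"
  proof -
    have lims: "(\<lambda>n. (ln (real n) + 1) / sqrt (ln (real n)) ^ 3) \<longlonglongrightarrow> 0"
      "(\<lambda>n. (ln (real n) + 1) / (ln (real n))\<^sup>2) \<longlonglongrightarrow> 0" "(\<lambda>n. 1 / ln (real n)) \<longlonglongrightarrow> 0"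
      by real_asymp+
    have "(\<lambda>n. (4 / 3 * \<bar>t\<bar> ^ 3 * c) * ((ln (real n) + 1) / sqrt (ln (real n)) ^ 3)
        + t ^ 4 * c * ((ln (real n) + 1) / (ln (real n))\<^sup>2) + t\<^sup>2 * (2 * c) * (1 / ln (real n)))
      \<longlonglongrightarrow> (4 / 3 * \<bar>t\<bar> ^ 3 * c) * 0 + t ^ 4 * c * 0 + t\<^sup>2 * (2 * c) * 0"
      by (intro tendsto_intros lims)
    moreover have "\<beta> = (\<lambda>n. (4 / 3 * \<bar>t\<bar> ^ 3 * c) * ((ln (real n) + 1) / sqrt (ln (real n)) ^ 3)
        + t ^ 4 * c * ((ln (real n) + 1) / (ln (real n))\<^sup>2) + t\<^sup>2 * (2 * c) * (1 / ln (real n)))"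
      by (simp add: \<beta>_def fun_eq_iff algebra_simps add_divide_distrib)
    ultimately show ?thesis by simp
  qed
  have "(\<lambda>n. 2 / v * \<alpha> n + t\<^sup>2 / 2 * exp (v * t\<^sup>2 / 2) * \<alpha> n + exp (v * t\<^sup>2) * \<beta> n)
      \<longlonglongrightarrow> 2 / v * 0 + t\<^sup>2 / 2 * exp (v * t\<^sup>2 / 2) * 0 + exp (v * t\<^sup>2) * 0"
    by (intro tendsto_intros \<alpha>_lim \<beta>_lim)
  then have lim0: "(\<lambda>n. 2 / v * \<alpha> n + t\<^sup>2 / 2 * exp (v * t\<^sup>2 / 2) * \<alpha> n + exp (v * t\<^sup>2) * \<beta> n) \<longlonglongrightarrow> 0" by simp
  have "(\<lambda>n. char (distr M borel (\<lambda>\<omega>. innovation_sum memory (path \<omega>) n / sqrt (ln n))) t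
      - exp (- (v * t\<^sup>2 / 2))) \<longlonglongrightarrow> 0"
    by (rule Lim_null_comparison[OF eventually_sequentiallyI[of 2, OF bound] lim0])
  then show ?thesis by (simp add: LIM_zero_iff v_def)
qed

end

end

subsection \<open>The estimator and the Fisher information\<close>

lemma p_hat_restrict_path [simp]: "p_hat (restrict_path n x) n = p_hat x n"
  unfolding p_hat_def by (intro arg_cong2[of _ _ _ _ "(/)"] arg_cong[of _ _ "\<lambda>s. 2 * s"] sum.cong) auto

lemma p_hat_diff:
  assumes "sum_mean_squares x n > 0"
  shows "p_hat x n - p = innovation_sum (2 * p - 1) x n / (2 * sum_mean_squares x n)"
proof -
  have "(\<Sum>k=1..<n. mean_position x k * (x (k + 1) + mean_position x k))
      = innovation_sum (2 * p - 1) x n + 2 * p * sum_mean_squares x n"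
    unfolding innovation_sum_def sum_mean_squares_def sum_distrib_left sum.distrib[symmetric]
    by (intro sum.cong) (auto simp: power2_eq_square algebra_simps)
  then have "p_hat x n = (innovation_sum (2 * p - 1) x n + 2 * p * sum_mean_squares x n)
      / (2 * sum_mean_squares x n)"
    by (simp add: p_hat_def sum_mean_squares_def)
  with assms show ?thesis by (simp add: field_simps)
qed

text \<open>
  Where a factor of the likelihood vanishes at \<open>p\<close> without vanishing identically, the logarithm has
  no derivative, and \<^const>\<open>deriv\<close> returns the junk value of \<open>SOME\<close> on an empty predicate. Such
  paths form a null set, but the formula is needed for the measurability of the score.
\<close>

lemma score_eq:
  "score q x n p = (if 1 + (2 * q - 1) * x 1 = 0 then 0
     else if \<forall>k\<in>{1..<n}. 1 + (2 * p - 1) * x (k + 1) * mean_position x k \<noteq> 0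
     then \<Sum>k=1..<n. 2 * x (k + 1) * mean_position x k / (1 + (2 * p - 1) * x (k + 1) * mean_position x k)
     else SOME D. False)"
proof -
  define c where "c = (1 + (2 * q - 1) * x 1) / 2"
  define h where "h k t = (1 + (2 * t - 1) * x (k + 1) * mean_position x k) / 2" for k t
  have lik: "likelihood q x n t = c * (\<Prod>k=1..<n. h k t)" for t
    by (simp add: likelihood_def c_def h_def)
  consider "c = 0" | "c \<noteq> 0" "\<forall>k\<in>{1..<n}. h k p \<noteq> 0" | "c \<noteq> 0" "\<exists>k\<in>{1..<n}. h k p = 0"
    by blast
  then show ?thesis
  proof cases
    case 1
    \<comment> \<open>The likelihood vanishes for every \<open>t\<close>, and
      \<open>ln 0 = 0\<close> is constant.\<close>
    then have "score q x n p = 0" by (simp add: score_def lik)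
    with 1 show ?thesis by (simp add: c_def)
  next
    case 2
    have cont: "isCont (h k) p" for k unfolding h_def by (intro continuous_intros) auto
    have "eventually (\<lambda>t. h k t \<noteq> 0) (nhds p)" if "k \<in> {1..<n}" for k
    proof -
      have "(h k \<longlongrightarrow> h k p) (nhds p)"
        using cont[of k] by (simp add: isCont_def tendsto_at_iff_tendsto_nhds)
      moreover have "h k p \<noteq> 0" using 2(2) that by blast
      ultimately show ?thesis by (rule tendsto_imp_eventually_ne)
    qed
    then have "eventually (\<lambda>t. \<forall>k\<in>{1..<n}. h k t \<noteq> 0) (nhds p)"
      by (intro eventually_ball_finite ballI) auto
    then have ev: "eventually (\<lambda>t. ln (likelihood q x n t) = ln c + (\<Sum>k=1..<n. ln (h k t))) (nhds p)"
    proof eventually_elim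
      case (elim t)
      \<comment> \<open>For nonzero arguments \<open>ln\<close> is the logarithm of the absolute
        value, so nonzero factors of either sign are allowed.\<close>
      then have "ln (\<Prod>k=1..<n. h k t) = (\<Sum>k=1..<n. ln (h k t))" by (intro ln_prod) auto
      then show ?case using elim 2(1) by (simp add: lik ln_mult)
    qed
    have abs_ln: "((\<lambda>t. ln (h k t)) has_real_derivative
        (2 * x (k + 1) * mean_position x k / (1 + (2 * p - 1) * x (k + 1) * mean_position x k))) (at p)"
      if k: "k \<in> {1..<n}" for k
    proof -
      have D: "(h k has_real_derivative x (k + 1) * mean_position x k) (at p)"
        unfolding h_def using k by (auto intro!: derivative_eq_intros simp: field_simps)
      have "(ln has_real_derivative 1 / h k p) (at (h k p))"
      proof (cases "h k p > 0")
        case True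
        then show ?thesis by (rule DERIV_ln_divide)
      next
        case False
        with 2(2) k have neg: "- h k p > 0" by (auto simp: less_eq_real_def not_less)
        have "((\<lambda>y. ln (- y)) has_real_derivative (1 / (- h k p)) * (- 1)) (at (h k p))"
          using neg by (auto intro!: derivative_eq_intros simp: field_simps)
        then show ?thesis by (simp add: ln_minus)
      qed
      note chain = DERIV_chain2[OF this D]
      have "1 / (w / 2) * (z * y) = 2 * z * y / w" for w z y :: real by simp
      then show ?thesis by (intro DERIV_cong[OF chain]) (simp only: h_def)
    qed
    have "((\<lambda>t. ln c + (\<Sum>k=1..<n. ln (h k t))) has_real_derivative
        (\<Sum>k=1..<n. 2 * x (k + 1) * mean_position x k / (1 + (2 * p - 1) * x (k + 1) * mean_position x k))) (at p)"
      using DERIV_add[OF DERIV_const[of "ln c"] DERIV_sum[of "{1..<n}", OF abs_ln]]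
      by (simp only: add_0_left)
    then have "((\<lambda>t. ln (likelihood q x n t)) has_real_derivative
        (\<Sum>k=1..<n. 2 * x (k + 1) * mean_position x k / (1 + (2 * p - 1) * x (k + 1) * mean_position x k))) (at p)"
      using DERIV_cong_ev[OF refl ev refl] by simp
    then have "score q x n p = (\<Sum>k=1..<n. 2 * x (k + 1) * mean_position x k
        / (1 + (2 * p - 1) * x (k + 1) * mean_position x k))"
      unfolding score_def by (rule DERIV_imp_deriv)
    with 2 show ?thesis by (simp add: c_def h_def)
  next
    case 3
    let ?f = "\<lambda>t. ln (likelihood q x n t)"
    have zero: "likelihood q x n p = 0" using 3(2) by (auto simp: lik)
    \<comment> \<open>Continuity would make exp (ln (likelihood)) tend to exp (ln 0) = 1, yet near
      \<open>p\<close> it is the absolute value of the likelihood, which tends to 0.\<close>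
    have "\<not> (?f has_real_derivative D) (at p)" for D
    proof
      assume "(?f has_real_derivative D) (at p)"
      then have "isCont ?f p" by (rule DERIV_isCont)
      then have "((\<lambda>t. exp (?f t)) \<longlongrightarrow> exp (?f p)) (at p)"
        by (intro tendsto_exp) (simp add: isCont_def)
      then have lim1: "((\<lambda>t. exp (?f t)) \<longlongrightarrow> 1) (at p)" by (simp add: zero)
      have "eventually (\<lambda>t. \<forall>k\<in>{1..<n}. h k t \<noteq> 0) (at p)"
      proof (intro eventually_ball_finite ballI)
        fix k
        let ?y = "x (k + 1) * mean_position x k"
        \<comment> \<open>A factor that varies with \<open>t\<close> is affine and vanishes at this
          single point; a constant factor is 1/2.\<close>
        have "eventually (\<lambda>t. t \<noteq> (1 - 1 / ?y) / 2) (at p)" by (rule eventually_neq_at_within)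
        then show "eventually (\<lambda>t. h k t \<noteq> 0) (at p)"
        proof eventually_elim
          case (elim t)
          show ?case
          proof (cases "?y = 0")
            case False
            with elim show ?thesis by (auto simp: h_def field_simps)
          qed (auto simp: h_def)
        qed
      qed simp
      then have ev: "eventually (\<lambda>t. exp (?f t) = \<bar>likelihood q x n t\<bar>) (at p)"
        by eventually_elim (use 3(1) in \<open>simp add: lik exp_ln_abs\<close>)
      have "isCont (\<lambda>t. \<bar>likelihood q x n t\<bar>) p"
        unfolding lik h_def by (intro continuous_intros) auto
      then have "((\<lambda>t. \<bar>likelihood q x n t\<bar>) \<longlongrightarrow> 0) (at p)"
        using zero by (simp add: isCont_def)
      with ev have "((\<lambda>t. exp (?f t)) \<longlongrightarrow> 0) (at p)" by (simp add: tendsto_cong)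
      with lim1 show False using tendsto_unique[OF trivial_limit_at] by force
    qed
    then have "score q x n p = (SOME D. False)" by (simp add: score_def deriv_def)
    with 3 show ?thesis by (auto simp: c_def h_def)
  qed
qed

section \<open>Score increments, Fisher information and the two limit laws\<close>

context elephant_random_walk
begin

text \<open>Measurability is assumed for \<open>X k\<close> with k \<ge> 1; truncation puts 0 at
  index 0, and the statistics read only the indices 1 to \<open>n\<close>.\<close>

lemma measurable_X_restrict [measurable]:
  "(\<lambda>\<omega>. restrict_path n (\<lambda>k. X k \<omega>) k) \<in> borel_measurable M"
proof (cases "k \<in> {1..n}")
  case True
  then show ?thesis using step_measurable[of k] by simp
next
  case False
  then have "restrict_path n x k = 0" for x by (auto simp: restrict_path_def)
  then show ?thesis by simp
qed

lemma AE_adapted_eq: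
  assumes "adapted n F"
  shows "AE \<omega> in M. F (\<lambda>k. X k \<omega>) = F (path \<omega>)"
  using AE_path_eq
proof eventually_elim
  case (elim \<omega>)
  then have "restrict_path n (\<lambda>k. X k \<omega>) = restrict_path n (path \<omega>)"
    by (auto simp: restrict_path_def fun_eq_iff)
  then show ?case using assms unfolding adapted_def by metis
qed

lemma measurable_p_hat: "(\<lambda>\<omega>. p_hat (\<lambda>k. X k \<omega>) n) \<in> borel_measurable M"
proof -
  have "(\<lambda>\<omega>. p_hat (restrict_path n (\<lambda>k. X k \<omega>)) n) \<in> borel_measurable M"
    unfolding p_hat_def position_def by measurable
  then show ?thesis by simp
qed

text \<open>The term k = 1 is the square of the first step, so the denominator of
  \<open>p_hat\<close> stays away from 0.\<close>

lemma sum_mean_squares_ge_1: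
  assumes "n \<ge> 2"
  shows "sum_mean_squares (path \<omega>) n \<ge> 1"
proof -
  have "(mean_position (path \<omega>) 1)\<^sup>2 \<le> sum_mean_squares (path \<omega>) n"
    unfolding sum_mean_squares_def using assms by (intro member_le_sum) auto
  then show ?thesis by (simp add: position_def)
qed

text \<open>Derivative at \<open>p\<close> of the logarithm of the \<open>k\<close>-th transition
  factor of the likelihood.\<close>

definition score_increment :: "nat \<Rightarrow> (nat \<Rightarrow> real) \<Rightarrow> real" where
  "score_increment k x = 2 * x (k + 1) * mean_position x k / (1 + memory * x (k + 1) * mean_position x k)"

lemma adapted_score_increment: "k \<ge> 1 \<Longrightarrow> adapted (Suc k) (score_increment k)"
  by (simp add: adapted_def score_increment_def)

text \<open>The expression is twice the conditional probability of the step just taken, and a step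
  of probability zero is almost surely not taken: in \<open>next_mean\<close> each weight multiplies
  the indicator of its own vanishing.\<close>

lemma AE_transition_pos:
  "AE \<omega> in M. \<forall>k\<ge>1. 1 + memory * path \<omega> (k + 1) * mean_position (path \<omega>) k \<noteq> 0"
proof -
  have "AE \<omega> in M. 1 + memory * path \<omega> (k + 1) * mean_position (path \<omega>) k \<noteq> 0" if k: "k \<ge> 1" for k
  proof -
    define F :: "(nat \<Rightarrow> real) \<Rightarrow> real"
      where "F x = of_bool (1 + memory * x (k + 1) * mean_position x k = 0)" for x
    have F: "adapted (Suc k) F" using k by (simp add: adapted_def F_def)
    have "next_mean k F x = 0" for x
    proof -
      define m where "m = memory * mean_position x k"
      have "memory * s * mean_position x k = m * s" for s by (simp add: m_def)
      then have "F (x(Suc k := s)) = of_bool (1 + m * s = 0)" for s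
        by (simp only: F_def Suc_eq_plus1[symmetric] fun_upd_same position_upd[OF order_refl])
      then show ?thesis unfolding next_mean_def m_def[symmetric] by auto
    qed
    with expectation_next[OF F k] have "(\<integral>\<omega>. F (path \<omega>) \<partial>M) = 0" by simp
    then have "AE \<omega> in M. F (path \<omega>) = 0"
      using integrable_adapted[OF F] by (subst (asm) integral_nonneg_eq_0_iff_AE) (auto simp: F_def)
    then show ?thesis by eventually_elim (auto simp: F_def split: if_splits)
  qed
  then show ?thesis by (auto simp: AE_all_countable)
qed

text \<open>The factor vanishes only for q = 0 with first step +1, or q = 1 with first step
  -1.\<close>

lemma AE_first_step_pos: "AE \<omega> in M. 1 + (2 * q - 1) * path \<omega> 1 \<noteq> 0"
proof -
  have ev: "{\<omega> \<in> space M. X 1 \<omega> = c} \<in> events" for c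
    using measurable_sets[OF step_measurable[of 1], of "{c}"]
    by (simp add: vimage_def Collect_conj_eq Int_commute)
  have "AE \<omega> in M. q = 0 \<longrightarrow> X 1 \<omega> \<noteq> 1"
    using first_step(1) prob_eq_0[OF ev[of 1]] by (cases "q = 0") auto
  moreover have "AE \<omega> in M. q = 1 \<longrightarrow> X 1 \<omega> \<noteq> -1"
    using first_step(2) prob_eq_0[OF ev[of "-1"]] by (cases "q = 1") auto
  ultimately show ?thesis using AE_path_eq
  proof eventually_elim
    case (elim \<omega>)
    then have "path \<omega> 1 = X 1 \<omega>" by blast
    with elim(1,2) path_cases[of \<omega> 1] show ?case by auto
  qed
qed

lemma fisher_info_eq:
  assumes n: "n \<ge> 1"
  shows "fisher_info M p q X n = expectation (\<lambda>\<omega>. (\<Sum>k=1..<n. score_increment k (path \<omega>))\<^sup>2)"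
  unfolding fisher_info_def
proof (rule integral_cong_AE)
  have ad: "adapted n (\<lambda>x. score q x n p)"
  proof -
    have "score q (restrict_path n x) n p = score q x n p" for x
      unfolding score_eq using n by (auto intro!: sum.cong)
    then show ?thesis by (simp add: adapted_def)
  qed
  have "(\<lambda>\<omega>. score q (restrict_path n (\<lambda>k. X k \<omega>)) n p) \<in> borel_measurable M"
    unfolding score_eq position_def by measurable
  then show "(\<lambda>\<omega>. (score q (\<lambda>k. X k \<omega>) n p)\<^sup>2) \<in> borel_measurable M"
    using ad by (simp add: adapted_def)
  have "adapted n (\<lambda>x. (\<Sum>k=1..<n. score_increment k x)\<^sup>2)"
    using adapted_sum[of "{1..<n}" n score_increment] adapted_mono[OF adapted_score_increment, of _ n]
    by (simp add: adapted_def)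
  then show "(\<lambda>\<omega>. (\<Sum>k=1..<n. score_increment k (path \<omega>))\<^sup>2) \<in> borel_measurable M"
    by (rule measurable_adapted)
  show "AE \<omega> in M. (score q (\<lambda>k. X k \<omega>) n p)\<^sup>2 = (\<Sum>k=1..<n. score_increment k (path \<omega>))\<^sup>2"
    using AE_adapted_eq[OF ad] AE_transition_pos AE_first_step_pos
  proof eventually_elim
    case (elim \<omega>)
    then have "score q (path \<omega>) n p = (\<Sum>k=1..<n. score_increment k (path \<omega>))"
      unfolding score_eq by (simp add: score_increment_def)
    with elim(1) show ?case by simp
  qed
qed

text \<open>For \<open>p = 0\<close> the second step is opposite to the first one, so that the walk stays away from \<open>\<plusminus>k\<close>.\<close>

lemma AE_abs_position_le:
  assumes "memory = -1"
  shows "AE \<omega> in M. \<forall>k\<ge>2. \<bar>position (path \<omega>) k\<bar> \<le> real k - 2"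
  using AE_transition_pos
proof eventually_elim
  case (elim \<omega>)
  have "1 - path \<omega> 2 * path \<omega> 1 \<noteq> 0"
    using elim[rule_format, of 1] unfolding assms by (simp add: position_def numeral_2_eq_2)
  then have two: "path \<omega> 1 + path \<omega> 2 = 0"
    using path_cases[of \<omega> 1] path_cases[of \<omega> 2] by auto
  show ?case
  proof (intro allI impI)
    fix k :: nat assume "k \<ge> 2"
    then show "\<bar>position (path \<omega>) k\<bar> \<le> real k - 2"
    proof (induction k rule: dec_induct)
      case base
      show ?case using two by (simp add: position_def numeral_2_eq_2)
    next
      case (step k)
      have "\<bar>position (path \<omega>) (Suc k)\<bar> \<le> \<bar>position (path \<omega>) k\<bar> + \<bar>path \<omega> (Suc k)\<bar>"
        unfolding position_Suc by (rule abs_triangle_ineq)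
      then have "\<bar>position (path \<omega>) (Suc k)\<bar> \<le> \<bar>position (path \<omega>) k\<bar> + 1" by simp
      with step.IH show ?case by simp
    qed
  qed
qed

context
  assumes diffusive: "p < 3 / 4"
begin

text \<open>Controls the excess of the conditional information over 4 y^2. For |a| < 1 the
  denominator is bounded below by 1 - a^2. For a = -1 it is at least 1 / k, and when y^2 > 1/2 one
  has y^4 \<le> 2 y^6, so the price is k y^6, whose mean is again O(k^-2). The value a = 1 is
  excluded by \<open>diffusive\<close>.\<close>

lemma AE_transition_nondegenerate:
  obtains C where "C \<ge> 0"
    "AE \<omega> in M. \<forall>k\<ge>2. (memory * mean_position (path \<omega>) k)\<^sup>2 < 1
      \<and> (mean_position (path \<omega>) k) ^ 4 / (1 - (memory * mean_position (path \<omega>) k)\<^sup>2)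
        \<le> C * ((mean_position (path \<omega>) k) ^ 4 + real k * (mean_position (path \<omega>) k) ^ 6)"
proof (cases "memory = -1")
  case False
  with memory_bounds diffusive have m: "\<bar>memory\<bar> < 1" by linarith
  then have m2: "memory\<^sup>2 < 1" by (simp add: abs_square_less_1)
  show thesis
  proof (rule that[of "1 / (1 - memory\<^sup>2)"])
    show "1 / (1 - memory\<^sup>2) \<ge> 0" using m2 by simp
    show "AE \<omega> in M. \<forall>k\<ge>2. (memory * mean_position (path \<omega>) k)\<^sup>2 < 1
      \<and> (mean_position (path \<omega>) k) ^ 4 / (1 - (memory * mean_position (path \<omega>) k)\<^sup>2)
        \<le> 1 / (1 - memory\<^sup>2) * ((mean_position (path \<omega>) k) ^ 4 + real k * (mean_position (path \<omega>) k) ^ 6)"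
    proof (intro AE_I2 allI impI)
      fix \<omega> k
      let ?y = "mean_position (path \<omega>) k"
      have y2: "?y\<^sup>2 \<le> 1" using abs_mean_position_le[of \<omega> k] by (simp only: abs_square_le_1)
      have le: "(memory * ?y)\<^sup>2 \<le> memory\<^sup>2"
        unfolding power_mult_distrib using y2 by (rule mult_left_le) simp
      have "?y ^ 4 / (1 - (memory * ?y)\<^sup>2) \<le> ?y ^ 4 / (1 - memory\<^sup>2)"
      proof (rule divide_left_mono)
        show "1 - memory\<^sup>2 \<le> 1 - (memory * ?y)\<^sup>2" using le by linarith
        show "0 < (1 - (memory * ?y)\<^sup>2) * (1 - memory\<^sup>2)"
          using le m2 by (intro mult_pos_pos) linarith+
      qed simp
      also have "\<dots> = 1 / (1 - memory\<^sup>2) * ?y ^ 4" by simp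
      also have "\<dots> \<le> 1 / (1 - memory\<^sup>2) * (?y ^ 4 + real k * ?y ^ 6)"
        using m2 by (intro mult_left_mono) auto
      finally show "(memory * ?y)\<^sup>2 < 1 \<and> ?y ^ 4 / (1 - (memory * ?y)\<^sup>2)
          \<le> 1 / (1 - memory\<^sup>2) * (?y ^ 4 + real k * ?y ^ 6)"
        using le m2 by (intro conjI) linarith+
    qed
  qed
next
  case True
  show thesis
  proof (rule that[of 2])
    show "AE \<omega> in M. \<forall>k\<ge>2. (memory * mean_position (path \<omega>) k)\<^sup>2 < 1
      \<and> (mean_position (path \<omega>) k) ^ 4 / (1 - (memory * mean_position (path \<omega>) k)\<^sup>2)
        \<le> 2 * ((mean_position (path \<omega>) k) ^ 4 + real k * (mean_position (path \<omega>) k) ^ 6)"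
      using AE_abs_position_le[OF True]
    proof eventually_elim
      case (elim \<omega>)
      show ?case
      proof (intro allI impI)
        fix k :: nat assume k: "k \<ge> 2"
        let ?y = "mean_position (path \<omega>) k"
        have y: "\<bar>?y\<bar> \<le> 1 - 2 / k" using elim[rule_format, OF k] k by (simp add: field_simps)
        have y1: "\<bar>?y\<bar> \<le> 1" by (rule abs_mean_position_le)
        have "?y\<^sup>2 = \<bar>?y\<bar> * \<bar>?y\<bar>" by (simp add: power2_eq_square)
        also have "\<dots> \<le> \<bar>?y\<bar> * 1" using y1 by (intro mult_left_mono) auto
        finally have "?y\<^sup>2 \<le> \<bar>?y\<bar>" by simp
        moreover have "2 / real k = 2 * (1 / real k)" "0 \<le> 1 / real k" by simp_all
        ultimately have gap: "1 / k \<le> 1 - ?y\<^sup>2" using y by linarith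
        have "0 < 1 / real k" using k by simp
        with gap have pos: "0 < 1 - ?y\<^sup>2" by linarith
        have six: "r * z ^ 4 * (2 * z\<^sup>2) = 2 * (r * z ^ 6)" for r z :: real
          by (simp add: eval_nat_numeral)
        have "?y ^ 4 / (1 - ?y\<^sup>2) \<le> 2 * (?y ^ 4 + real k * ?y ^ 6)"
        proof (cases "?y\<^sup>2 \<le> 1 / 2")
          case True
          have "?y ^ 4 / (1 - ?y\<^sup>2) \<le> ?y ^ 4 / (1 / 2)"
            using True pos by (intro divide_left_mono) auto
          also have "\<dots> \<le> 2 * (?y ^ 4 + real k * ?y ^ 6)" by simp
          finally show ?thesis .
        next
          case False
          have "?y ^ 4 / (1 - ?y\<^sup>2) \<le> ?y ^ 4 / (1 / k)"
            using gap pos k by (intro divide_left_mono) auto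
          also have "\<dots> = real k * ?y ^ 4 * 1" by simp
          also have "\<dots> \<le> real k * ?y ^ 4 * (2 * ?y\<^sup>2)"
            using False by (intro mult_left_mono) auto
          also have "\<dots> = 2 * (real k * ?y ^ 6)" by (rule six)
          also have "\<dots> \<le> 2 * (?y ^ 4 + real k * ?y ^ 6)" by simp
          finally show ?thesis .
        qed
        moreover have "(memory * ?y)\<^sup>2 = ?y\<^sup>2" unfolding True by simp
        ultimately show "(memory * ?y)\<^sup>2 < 1 \<and> ?y ^ 4 / (1 - (memory * ?y)\<^sup>2)
            \<le> 2 * (?y ^ 4 + real k * ?y ^ 6)" using pos by simp
      qed
    qed
  qed simp
qed

text \<open>The weight of each step cancels its denominator, leaving y and -y; for the squares one
  denominator survives, giving 2 y^2 / (1 + m) + 2 y^2 / (1 - m).\<close>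

lemma next_mean_score_increment:
  assumes "(memory * mean_position x k)\<^sup>2 < 1"
  shows "next_mean k (score_increment k) x = 0"
    and "next_mean k (\<lambda>x. (score_increment k x)\<^sup>2) x
      = 4 * (mean_position x k)\<^sup>2 / (1 - (memory * mean_position x k)\<^sup>2)"
proof -
  define y m where "y = mean_position x k" and "m = memory * y"
  have "\<bar>m\<bar> < 1" using assms by (simp add: m_def y_def abs_square_less_1)
  then have m: "1 + m \<noteq> 0" "1 - m \<noteq> 0" "1 - m\<^sup>2 \<noteq> 0"
    by (auto simp: power2_eq_1_iff)
  have "memory * s * y = m * s" for s by (simp add: m_def)
  then have "score_increment k (x(Suc k := s)) = 2 * s * y / (1 + m * s)" for s
    by (simp only: score_increment_def Suc_eq_plus1[symmetric] fun_upd_same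
        position_upd[OF order_refl] y_def[symmetric])
  from this[of 1] this[of "-1"]
  have incr: "score_increment k (x(Suc k := 1)) = 2 * y / (1 + m)"
    "score_increment k (x(Suc k := -1)) = - (2 * y) / (1 - m)"
    by simp_all
  show "next_mean k (score_increment k) x = 0"
    unfolding next_mean_def incr y_def[symmetric] m_def[symmetric] using m by (simp add: field_simps)
  have prod: "1 - m\<^sup>2 = (1 + m) * (1 - m)" by (simp add: power2_eq_square algebra_simps)
  show "next_mean k (\<lambda>x. (score_increment k x)\<^sup>2) x
      = 4 * (mean_position x k)\<^sup>2 / (1 - (memory * mean_position x k)\<^sup>2)"
    unfolding next_mean_def incr y_def[symmetric] m_def[symmetric] prod
    using m(1,2) by (simp add: divide_simps power2_eq_square) (simp add: algebra_simps)
qed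

text \<open>The conditional excess 4 y^2 a^2 y^2 / (1 - a^2 y^2) is at most 4 y^4 / (1 - a^2 y^2),
  which \<open>AE_transition_nondegenerate\<close> bounds by moments of order k^-2.\<close>

lemma fisher_info_increment:
  obtains D where "D \<ge> 0" "\<And>k. k \<ge> 1 \<Longrightarrow>
    \<bar>expectation (\<lambda>\<omega>. (score_increment k (path \<omega>))\<^sup>2) - 4 * expectation (\<lambda>\<omega>. (mean_position (path \<omega>) k)\<^sup>2)\<bar>
      \<le> D / (real k)\<^sup>2"
proof -
  obtain c where c: "c \<ge> 0" "\<And>n. n \<ge> 1 \<Longrightarrow> expectation (\<lambda>\<omega>. (mean_position (path \<omega>) n)\<^sup>2) \<le> c / n"
    "\<And>n. n \<ge> 1 \<Longrightarrow> expectation (\<lambda>\<omega>. (mean_position (path \<omega>) n) ^ 4) \<le> c / real n ^ 2"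
    "\<And>n. n \<ge> 1 \<Longrightarrow> expectation (\<lambda>\<omega>. (mean_position (path \<omega>) n) ^ 6) \<le> c / real n ^ 3"
    by (rule mean_position_moments[OF diffusive]) (rule that)
  obtain C where C: "C \<ge> 0"
    "AE \<omega> in M. \<forall>k\<ge>2. (memory * mean_position (path \<omega>) k)\<^sup>2 < 1
      \<and> (mean_position (path \<omega>) k) ^ 4 / (1 - (memory * mean_position (path \<omega>) k)\<^sup>2)
        \<le> C * ((mean_position (path \<omega>) k) ^ 4 + real k * (mean_position (path \<omega>) k) ^ 6)"
    by (rule AE_transition_nondegenerate) (rule that)
  let ?d = "\<lambda>k. \<bar>expectation (\<lambda>\<omega>. (score_increment k (path \<omega>))\<^sup>2) - 4 * expectation (\<lambda>\<omega>. (mean_position (path \<omega>) k)\<^sup>2)\<bar>"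
  have main: "?d k \<le> 8 * C * c / (real k)\<^sup>2" if k: "k \<ge> 2" for k
  proof -
    let ?Y = "\<lambda>\<omega>. mean_position (path \<omega>) k"
    have k1: "k \<ge> 1" using k by simp
    have ad: "adapted (Suc k) (\<lambda>x. (score_increment k x)\<^sup>2)"
      using adapted_score_increment[OF k1] by (simp add: adapted_def)
    note intY = integrable_position[of "\<lambda>s. (s / real k) ^ j" k for j]
    have intn: "integrable M (\<lambda>\<omega>. next_mean k (\<lambda>x. (score_increment k x)\<^sup>2) (path \<omega>))"
      by (rule integrable_adapted[OF adapted_next_mean[OF ad]])
    have "?d k = \<bar>expectation (\<lambda>\<omega>. next_mean k (\<lambda>x. (score_increment k x)\<^sup>2) (path \<omega>) - 4 * (?Y \<omega>)\<^sup>2)\<bar>"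
      unfolding expectation_next[OF ad k1] using intn intY[of 2]
      by (subst Bochner_Integration.integral_diff) (simp_all only: integrable_mult_right integral_mult_right_zero)
    also have "\<dots> \<le> expectation (\<lambda>\<omega>. \<bar>next_mean k (\<lambda>x. (score_increment k x)\<^sup>2) (path \<omega>) - 4 * (?Y \<omega>)\<^sup>2\<bar>)"
      by (rule integral_abs_bound)
    also have "\<dots> \<le> expectation (\<lambda>\<omega>. 4 * C * ((?Y \<omega>) ^ 4 + real k * (?Y \<omega>) ^ 6))"
    proof (rule integral_mono_AE)
      show "integrable M (\<lambda>\<omega>. \<bar>next_mean k (\<lambda>x. (score_increment k x)\<^sup>2) (path \<omega>) - 4 * (?Y \<omega>)\<^sup>2\<bar>)"
        using intn intY[of 2] by (intro integrable_abs Bochner_Integration.integrable_diff integrable_mult_right)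
      show "integrable M (\<lambda>\<omega>. 4 * C * ((?Y \<omega>) ^ 4 + real k * (?Y \<omega>) ^ 6))"
        using intY by (intro Bochner_Integration.integrable_add integrable_mult_right)
      show "AE \<omega> in M. \<bar>next_mean k (\<lambda>x. (score_increment k x)\<^sup>2) (path \<omega>) - 4 * (?Y \<omega>)\<^sup>2\<bar>
          \<le> 4 * C * ((?Y \<omega>) ^ 4 + real k * (?Y \<omega>) ^ 6)"
        using C(2)
      proof eventually_elim
        case (elim \<omega>)
        define y where "y = ?Y \<omega>"
        have lt: "(memory * y)\<^sup>2 < 1" and le: "y ^ 4 / (1 - (memory * y)\<^sup>2) \<le> C * (y ^ 4 + real k * y ^ 6)"
          using elim k unfolding y_def by blast+
        have nm: "next_mean k (\<lambda>x. (score_increment k x)\<^sup>2) (path \<omega>) = 4 * y\<^sup>2 / (1 - (memory * y)\<^sup>2)"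
          unfolding y_def by (rule next_mean_score_increment(2)) (use lt in \<open>simp only: y_def\<close>)
        have "next_mean k (\<lambda>x. (score_increment k x)\<^sup>2) (path \<omega>) - 4 * y\<^sup>2
            = 4 * (y\<^sup>2 * m2 / (1 - m2))" if "m2 = (memory * y)\<^sup>2" for m2
          unfolding nm that[symmetric] using lt that by (simp add: field_simps)
        from this[OF refl] have "\<bar>next_mean k (\<lambda>x. (score_increment k x)\<^sup>2) (path \<omega>) - 4 * y\<^sup>2\<bar>
            = \<bar>4 * (y\<^sup>2 * (memory * y)\<^sup>2 / (1 - (memory * y)\<^sup>2))\<bar>" by (rule arg_cong)
        also have "\<dots> = 4 * (y\<^sup>2 * (memory * y)\<^sup>2 / (1 - (memory * y)\<^sup>2))"
          using lt by (intro abs_of_nonneg mult_nonneg_nonneg divide_nonneg_nonneg) auto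
        also have "\<dots> \<le> 4 * (y ^ 4 / (1 - (memory * y)\<^sup>2))"
        proof (intro mult_left_mono divide_right_mono)
          have "memory\<^sup>2 \<le> 1" using memory_bounds(3) by (simp only: abs_square_le_1)
          then have "(memory * y)\<^sup>2 \<le> 1 * y\<^sup>2"
            unfolding power_mult_distrib by (intro mult_right_mono) auto
          then have "y\<^sup>2 * (memory * y)\<^sup>2 \<le> y\<^sup>2 * (1 * y\<^sup>2)" by (intro mult_left_mono) auto
          then show "y\<^sup>2 * (memory * y)\<^sup>2 \<le> y ^ 4" by (simp add: eval_nat_numeral)
        qed (use lt in auto)
        also have "\<dots> \<le> 4 * (C * (y ^ 4 + real k * y ^ 6))" using le by (intro mult_left_mono) auto
        finally show ?case unfolding y_def by (simp only: mult.assoc)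
      qed
    qed
    also have "\<dots> = 4 * C * (expectation (\<lambda>\<omega>. (?Y \<omega>) ^ 4) + real k * expectation (\<lambda>\<omega>. (?Y \<omega>) ^ 6))"
      using intY[of 4] intY[of 6] by (simp only: integral_mult_right_zero Bochner_Integration.integral_add integrable_mult_right)
    also have "\<dots> \<le> 4 * C * (c / real k ^ 2 + real k * (c / real k ^ 3))"
      using C(1) c(3)[OF k1] c(4)[OF k1] by (intro mult_left_mono add_mono) auto
    also have "\<dots> = 8 * C * c / (real k)\<^sup>2"
      using k by (simp add: field_simps eval_nat_numeral)
    finally show ?thesis .
  qed
  show thesis
  proof (rule that[of "8 * C * c + ?d 1"])
    show "8 * C * c + ?d 1 \<ge> 0" using C(1) c(1) by simp
    fix k :: nat assume k: "k \<ge> 1"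
    show "?d k \<le> (8 * C * c + ?d 1) / (real k)\<^sup>2"
    proof (cases "k = 1")
      case True
      then show ?thesis using C(1) c(1) by simp
    next
      case False
      then have "?d k \<le> 8 * C * c / (real k)\<^sup>2" using k by (intro main) auto
      also have "\<dots> \<le> (8 * C * c + ?d 1) / (real k)\<^sup>2" by (intro divide_right_mono) auto
      finally show ?thesis .
    qed
  qed
qed

text \<open>For k = 1 the preceding sum is empty; from k = 2 on the increment has conditional mean 0
  off a null set.\<close>

lemma fisher_info_sum:
  assumes n: "n \<ge> 1"
  shows "fisher_info M p q X n = (\<Sum>k=1..<n. expectation (\<lambda>\<omega>. (score_increment k (path \<omega>))\<^sup>2))"
  unfolding fisher_info_eq[OF n]
proof (rule expectation_orthogonal_sum[OF adapted_score_increment _ n])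
  fix k :: nat assume k: "k \<ge> 1"
  show "expectation (\<lambda>\<omega>. (\<Sum>j=1..<k. score_increment j (path \<omega>)) * score_increment k (path \<omega>)) = 0"
  proof (cases "k = 1")
    case False
    then have k2: "k \<ge> 2" using k by simp
    obtain C where C: "C \<ge> 0"
      "AE \<omega> in M. \<forall>k\<ge>2. (memory * mean_position (path \<omega>) k)\<^sup>2 < 1
        \<and> (mean_position (path \<omega>) k) ^ 4 / (1 - (memory * mean_position (path \<omega>) k)\<^sup>2)
          \<le> C * ((mean_position (path \<omega>) k) ^ 4 + real k * (mean_position (path \<omega>) k) ^ 6)"
      by (rule AE_transition_nondegenerate) (rule that)
    have "AE \<omega> in M. (\<Sum>j=1..<k. score_increment j (path \<omega>)) * next_mean k (score_increment k) (path \<omega>) = 0"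
      using C(2)
    proof eventually_elim
      case (elim \<omega>)
      then have "(memory * mean_position (path \<omega>) k)\<^sup>2 < 1" using k2 by blast
      then show ?case by (simp add: next_mean_score_increment)
    qed
    then have "expectation (\<lambda>\<omega>. (\<Sum>j=1..<k. score_increment j (path \<omega>))
        * next_mean k (score_increment k) (path \<omega>)) = 0"
      by (rule integral_eq_zero_AE)
    moreover have ad: "adapted k (\<lambda>x. \<Sum>j=1..<k. score_increment j x)"
      by (intro adapted_sum adapted_mono[OF adapted_score_increment]) auto
    ultimately show ?thesis
      by (simp only: expectation_mult_next[OF ad adapted_score_increment[OF k] k])
  qed simp
qed

lemma fisher_info_tendsto: "(\<lambda>n. fisher_info M p q X n / ln n) \<longlonglongrightarrow> 4 / (3 - 4 * p)"
proof -
  obtain D where D: "D \<ge> 0" "\<And>k. k \<ge> 1 \<Longrightarrow>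
    \<bar>expectation (\<lambda>\<omega>. (score_increment k (path \<omega>))\<^sup>2) - 4 * expectation (\<lambda>\<omega>. (mean_position (path \<omega>) k)\<^sup>2)\<bar>
      \<le> D / (real k)\<^sup>2"
    by (rule fisher_info_increment) (rule that)
  let ?A = "\<lambda>n. expectation (\<lambda>\<omega>. sum_mean_squares (path \<omega>) n)"
  have A: "?A n = (\<Sum>k=1..<n. expectation (\<lambda>\<omega>. (mean_position (path \<omega>) k)\<^sup>2))" for n
    unfolding sum_mean_squares_def using integrable_position[of "\<lambda>s. (s / real k)\<^sup>2" k for k]
    by (intro Bochner_Integration.integral_sum) auto
  have bound: "\<bar>fisher_info M p q X n / ln n - 4 * (?A n / ln n)\<bar> \<le> 2 * D * (1 / ln n)" if n: "n \<ge> 2" for n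
  proof -
    have "\<bar>fisher_info M p q X n - 4 * ?A n\<bar> \<le> (\<Sum>k=1..<n. D / (real k)\<^sup>2)"
      using n unfolding A sum_distrib_left
      by (subst fisher_info_sum) (auto simp: sum_subtractf[symmetric] intro!: order_trans[OF sum_abs] sum_mono D(2))
    also have "\<dots> = D * (\<Sum>k=1..<n. 1 / (real k)\<^sup>2)" by (simp add: sum_distrib_left)
    also have "\<dots> \<le> D * 2" using D(1) sum_inverse_square_le by (intro mult_left_mono)
    finally have "\<bar>fisher_info M p q X n - 4 * ?A n\<bar> / ln n \<le> D * 2 / ln n"
      using n by (intro divide_right_mono) auto
    moreover have "\<bar>fisher_info M p q X n / ln n - 4 * (?A n / ln n)\<bar> = \<bar>fisher_info M p q X n - 4 * ?A n\<bar> / ln n"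
      using n by (simp add: diff_divide_distrib[symmetric])
    ultimately show ?thesis by (simp add: mult.commute)
  qed
  have "(\<lambda>n. 1 / ln (real n)) \<longlonglongrightarrow> 0" by real_asymp
  from tendsto_mult_right_zero[OF this, of "2 * D"]
  have "(\<lambda>n. fisher_info M p q X n / ln n - 4 * (?A n / ln n)) \<longlonglongrightarrow> 0"
    by (rule Lim_null_comparison[rotated]) (auto intro!: eventually_sequentiallyI[of 2] bound[simplified])
  note diff = this
  have lim: "(\<lambda>n. ?A n / ln n) \<longlonglongrightarrow> 1 / (3 - 4 * p)"
  proof -
    have "\<bar>?A n / ln n - 1 / (3 - 4 * p)\<bar>
        \<le> expectation (\<lambda>\<omega>. \<bar>sum_mean_squares (path \<omega>) n / ln n - 1 / (3 - 4 * p)\<bar>)" for n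
    proof -
      have "?A n / ln n - 1 / (3 - 4 * p) = expectation (\<lambda>\<omega>. sum_mean_squares (path \<omega>) n / ln n - 1 / (3 - 4 * p))"
        using integrable_adapted[OF adapted_sum_mean_squares, of n] by (simp add: prob_space)
      then show ?thesis by (simp only: integral_abs_bound)
    qed
    then have "(\<lambda>n. ?A n / ln n - 1 / (3 - 4 * p)) \<longlonglongrightarrow> 0"
      by (intro Lim_null_comparison[OF always_eventually sum_mean_squares_L1[OF diffusive]]) simp
    then show ?thesis by (rule LIM_zero_cancel)
  qed
  from tendsto_add[OF diff tendsto_mult_left[OF lim, of 4]] show ?thesis by simp
qed

text \<open>Common form of both limit theorems: the normalised martingale times \<open>g\<close> of
  A n / ln n, which tends to 1 / (3 - 4 p), and of N n / ln n, which tends to 0 as an L^1-bounded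
  sequence divided by sqrt (ln n). The second argument lets \<open>g\<close> involve the estimator
  itself.\<close>

lemma statistic_converges_in_law:
  fixes stat :: "(nat \<Rightarrow> real) \<Rightarrow> nat \<Rightarrow> real" and g :: "real \<times> real \<Rightarrow> real"
  assumes g: "isCont g (1 / (3 - 4 * p), 0)" "g (1 / (3 - 4 * p), 0) \<noteq> 0"
    and ad: "\<And>n. adapted n (\<lambda>x. stat x n)"
    and meas: "\<And>n. (\<lambda>\<omega>. stat (\<lambda>k. X k \<omega>) n) \<in> borel_measurable M"
    and stat: "\<And>n \<omega>. n \<ge> 2 \<Longrightarrow> stat (path \<omega>) n = innovation_sum memory (path \<omega>) n / sqrt (ln n)
      * g (sum_mean_squares (path \<omega>) n / ln n, innovation_sum memory (path \<omega>) n / ln n)"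
  shows "converges_in_law M (\<lambda>n \<omega>. stat (\<lambda>k. X k \<omega>) n)
    (centered_gaussian ((g (1 / (3 - 4 * p), 0))\<^sup>2 / (3 - 4 * p)))"
proof -
  define v where "v = 1 / (3 - 4 * p)"
  define Z where "Z n \<omega> = innovation_sum memory (path \<omega>) n / sqrt (ln n)" for n :: nat and \<omega>
  define U where "U n \<omega> = sum_mean_squares (path \<omega>) n / ln n" for n :: nat and \<omega>
  define W where "W n \<omega> = innovation_sum memory (path \<omega>) n / ln n" for n :: nat and \<omega>
  have v: "v > 0" using diffusive by (simp add: v_def)
  obtain C where "\<forall>\<^sub>F n in sequentially.
      expectation (\<lambda>\<omega>. \<bar>innovation_sum memory (path \<omega>) n / sqrt (ln n)\<bar>) \<le> C"
    by (rule expectation_innovation_sum_bounded[OF diffusive]) (rule that)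
  then have C: "\<forall>\<^sub>F n in sequentially. expectation (\<lambda>\<omega>. \<bar>Z n \<omega>\<bar>) \<le> C"
    unfolding Z_def .
  have intN: "integrable M (\<lambda>\<omega>. innovation_sum memory (path \<omega>) n)" for n
    by (rule integrable_adapted[OF adapted_innovation_sum])
  have intA: "integrable M (\<lambda>\<omega>. sum_mean_squares (path \<omega>) n)" for n
    by (rule integrable_adapted[OF adapted_sum_mean_squares])
  have int: "integrable M (Z n)" "integrable M (U n)" "integrable M (W n)" for n
    unfolding Z_def U_def W_def using intN intA by auto
  have U_lim: "(\<lambda>n. expectation (\<lambda>\<omega>. \<bar>U n \<omega> - v\<bar>)) \<longlonglongrightarrow> 0"
    unfolding U_def v_def by (rule sum_mean_squares_L1[OF diffusive])
  have W_lim: "(\<lambda>n. expectation (\<lambda>\<omega>. \<bar>W n \<omega> - 0\<bar>)) \<longlonglongrightarrow> 0"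
  proof -
    have "(\<lambda>n. C * (1 / sqrt (ln (real n)))) \<longlonglongrightarrow> C * 0"
      by (intro tendsto_intros) real_asymp
    then have lim: "(\<lambda>n. C * (1 / sqrt (ln (real n)))) \<longlonglongrightarrow> 0" by simp
    have "\<forall>\<^sub>F n in sequentially. norm (expectation (\<lambda>\<omega>. \<bar>W n \<omega> - 0\<bar>)) \<le> C * (1 / sqrt (ln (real n)))"
      using C eventually_ge_at_top[of 2]
    proof eventually_elim
      case (elim n)
      have "\<bar>W n \<omega>\<bar> = \<bar>Z n \<omega>\<bar> * (1 / sqrt (ln n))" for \<omega>
        using elim(2) by (simp add: W_def Z_def abs_divide)
      then have "expectation (\<lambda>\<omega>. \<bar>W n \<omega>\<bar>) = expectation (\<lambda>\<omega>. \<bar>Z n \<omega>\<bar>) * (1 / sqrt (ln n))"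
        by (simp only: integral_mult_left_zero)
      also have "\<dots> \<le> C * (1 / sqrt (ln n))"
        using elim by (intro mult_right_mono) auto
      finally show ?case by (simp add: abs_of_nonneg[OF integral_nonneg_AE])
    qed
    then show ?thesis by (rule Lim_null_comparison[OF _ lim])
  qed
  \<comment> \<open>Continuity of \<open>g\<close> is known at one point only; measurability comes
    from the finitely many values of its arguments.\<close>
  have meas_g: "(\<lambda>\<omega>. g (U n \<omega>, W n \<omega>)) \<in> borel_measurable M" for n
    unfolding U_def W_def
    by (rule measurable_adapted[where n = n and F = "\<lambda>x. g (sum_mean_squares x n / ln n, innovation_sum memory x n / ln n)"])
      (use adapted_innovation_sum in \<open>simp add: adapted_def\<close>)
  have distr_eq: "distr M borel (\<lambda>\<omega>. stat (\<lambda>k. X k \<omega>) n) = distr M borel (\<lambda>\<omega>. stat (path \<omega>) n)" for n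
    using AE_adapted_eq[OF ad[of n]] measurable_adapted[OF ad[of n]] meas
    by (intro distr_cong_AE) auto
  have pos: "(g (v, 0))\<^sup>2 * v > 0" using g(2) v by (simp add: v_def)
  have "weak_conv_m (\<lambda>n. distr M borel (\<lambda>\<omega>. stat (\<lambda>k. X k \<omega>) n)) (centered_gaussian ((g (v, 0))\<^sup>2 * v))"
  proof (rule levy_continuity)
    show "real_distribution (distr M borel (\<lambda>\<omega>. stat (\<lambda>k. X k \<omega>) n))" for n
      using meas by (rule real_distribution_distr)
    show "real_distribution (centered_gaussian ((g (v, 0))\<^sup>2 * v))"
      by (rule real_distribution_centered_gaussian[OF pos])
    fix t :: real
    have "(\<lambda>n. char (distr M borel (\<lambda>\<omega>. Z n \<omega> * g (U n \<omega>, W n \<omega>))) t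
        - char (distr M borel (Z n)) (t * g (v, 0))) \<longlonglongrightarrow> 0"
      by (rule char_slutsky[OF _ int(1) C int(2) U_lim int(3) W_lim meas_g]) (use g in \<open>simp add: v_def\<close>)
    moreover have "(\<lambda>n. char (distr M borel (Z n)) (t * g (v, 0)))
        \<longlonglongrightarrow> char (centered_gaussian ((g (v, 0))\<^sup>2 * v)) t"
    proof -
      have "- ((g (v, 0))\<^sup>2 * v * t\<^sup>2) / 2 = - ((t * g (v, 0))\<^sup>2 / (3 - 4 * p)) / 2"
        by (simp add: v_def power_mult_distrib)
      then show ?thesis
        unfolding char_centered_gaussian[OF pos] Z_def[abs_def]
        using innovation_sum_char_tendsto[OF diffusive, of "t * g (v, 0)"] by (simp only:)
    qed
    ultimately have "(\<lambda>n. char (distr M borel (\<lambda>\<omega>. Z n \<omega> * g (U n \<omega>, W n \<omega>))) t)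
        \<longlonglongrightarrow> char (centered_gaussian ((g (v, 0))\<^sup>2 * v)) t"
      by (rule Lim_transform[rotated])
    moreover have "\<forall>\<^sub>F n in sequentially. char (distr M borel (\<lambda>\<omega>. Z n \<omega> * g (U n \<omega>, W n \<omega>))) t
        = char (distr M borel (\<lambda>\<omega>. stat (\<lambda>k. X k \<omega>) n)) t"
      unfolding distr_eq by (intro eventually_sequentiallyI[of 2]) (simp add: stat Z_def U_def W_def)
    ultimately show "(\<lambda>n. char (distr M borel (\<lambda>\<omega>. stat (\<lambda>k. X k \<omega>) n)) t)
        \<longlonglongrightarrow> char (centered_gaussian ((g (v, 0))\<^sup>2 * v)) t"
      by (rule Lim_transform_eventually)
  qed
  then show ?thesis unfolding converges_in_law_def by (simp add: v_def)
qed

lemma p_hat_path_diff: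
  assumes n: "n \<ge> 2"
  shows "p_hat (path \<omega>) n - p = innovation_sum memory (path \<omega>) n / (2 * sum_mean_squares (path \<omega>) n)"
  using sum_mean_squares_ge_1[OF n, of \<omega>] by (intro p_hat_diff) simp

text \<open>At the limit point g is (3 - 4 p) / 2, and its square over 3 - 4 p is the stated
  variance.\<close>

lemma p_hat_converges_in_law:
  "converges_in_law M (\<lambda>n \<omega>. sqrt (ln (real n)) * (p_hat (\<lambda>k. X k \<omega>) n - p))
    (centered_gaussian ((3 - 4 * p) / 4))"
proof -
  let ?g = "\<lambda>z :: real \<times> real. 1 / (2 * fst z)"
  have d: "3 - 4 * p > 0" using diffusive by simp
  have "converges_in_law M (\<lambda>n \<omega>. sqrt (ln (real n)) * (p_hat (\<lambda>k. X k \<omega>) n - p))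
    (centered_gaussian ((?g (1 / (3 - 4 * p), 0))\<^sup>2 / (3 - 4 * p)))"
  proof (rule statistic_converges_in_law[where stat = "\<lambda>x n. sqrt (ln (real n)) * (p_hat x n - p)"])
    show "isCont ?g (1 / (3 - 4 * p), 0)" using d by (intro continuous_intros) auto
    show "?g (1 / (3 - 4 * p), 0) \<noteq> 0" using d by simp
    show "adapted n (\<lambda>x. sqrt (ln (real n)) * (p_hat x n - p))" for n by (simp add: adapted_def)
    show "(\<lambda>\<omega>. sqrt (ln (real n)) * (p_hat (\<lambda>k. X k \<omega>) n - p)) \<in> borel_measurable M" for n
      using measurable_p_hat by measurable
    fix n :: nat and \<omega> assume n: "n \<ge> 2"
    let ?r = "sqrt (ln (real n))"
    have r: "?r > 0" "?r * ?r = ln n" using n by auto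
    have A: "sum_mean_squares (path \<omega>) n > 0" using sum_mean_squares_ge_1[OF n, of \<omega>] by simp
    have scale: "r * (N / (2 * A)) = N / r * (1 / (2 * (A / (r * r))))" if "r > 0" "A > 0" for r N A :: real
      using that by (simp add: field_simps)
    show "sqrt (ln (real n)) * (p_hat (path \<omega>) n - p) = innovation_sum memory (path \<omega>) n / sqrt (ln n)
      * ?g (sum_mean_squares (path \<omega>) n / ln n, innovation_sum memory (path \<omega>) n / ln n)"
      unfolding p_hat_path_diff[OF n] fst_conv by (rule scale[OF r(1) A, unfolded r(2)])
  qed
  moreover have "(?g (1 / r, 0))\<^sup>2 / r = r / 4" if "r > 0" for r
    using that by (simp add: power2_eq_square)
  note this[OF d]
  ultimately show ?thesis by (simp only:)
qed

lemma studentized_p_hat_converges_in_law: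
  "converges_in_law M (\<lambda>n \<omega>. 2 * sqrt (ln (real n)) * ((p_hat (\<lambda>k. X k \<omega>) n - p)
      / sqrt (3 - 4 * p_hat (\<lambda>k. X k \<omega>) n))) (centered_gaussian 1)"
proof -
  \<comment> \<open>\<open>snd z / (2 * fst z)\<close> stands for \<open>p_hat - p\<close>. Default
    values of \<open>sqrt\<close> and division occur alike in \<open>g\<close> and in the statistic,
    so the two agree for all \<open>n \<ge> 2\<close>; near the limit point the radicand is close to
    3 - 4 p > 0.\<close>
  let ?g = "\<lambda>z :: real \<times> real. 1 / fst z / sqrt (3 - 4 * (p + snd z / (2 * fst z)))"
  let ?stat = "\<lambda>x n. 2 * sqrt (ln (real n)) * ((p_hat x n - p) / sqrt (3 - 4 * p_hat x n))"
  have d: "3 - 4 * p > 0" using diffusive by simp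
  have g: "?g (1 / (3 - 4 * p), 0) = sqrt (3 - 4 * p)"
    using d by (simp add: real_div_sqrt)
  have "converges_in_law M (\<lambda>n \<omega>. ?stat (\<lambda>k. X k \<omega>) n)
    (centered_gaussian ((?g (1 / (3 - 4 * p), 0))\<^sup>2 / (3 - 4 * p)))"
  proof (rule statistic_converges_in_law[where stat = ?stat])
    show "isCont ?g (1 / (3 - 4 * p), 0)" using d by (intro continuous_intros) auto
    show "?g (1 / (3 - 4 * p), 0) \<noteq> 0" unfolding g using d by simp
    show "adapted n (\<lambda>x. ?stat x n)" for n by (simp add: adapted_def)
    show "(\<lambda>\<omega>. ?stat (\<lambda>k. X k \<omega>) n) \<in> borel_measurable M" for n
      using measurable_p_hat by measurable
    fix n :: nat and \<omega> assume n: "n \<ge> 2"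
    let ?A = "sum_mean_squares (path \<omega>) n" and ?N = "innovation_sum memory (path \<omega>) n"
    let ?r = "sqrt (ln (real n))"
    have L: "ln (real n) > 0" and r: "?r > 0" "?r * ?r = ln n" using n by auto
    have scale: "N / r * (1 / (A / (r * r))) = 2 * r * (N / (2 * A))" if "r > 0" "A > 0" for r N A :: real
      using that by (simp add: field_simps)
    have A: "?A > 0" using sum_mean_squares_ge_1[OF n, of \<omega>] by simp
    have "p + ?N / ln n / (2 * (?A / ln n)) = p_hat (path \<omega>) n"
      using p_hat_path_diff[OF n, of \<omega>] L A by (simp add: field_simps)
    moreover have "?N / sqrt (ln n) * (1 / (?A / ln n)) = 2 * sqrt (ln n) * (?N / (2 * ?A))"
      by (rule scale[OF r(1) A, unfolded r(2)])
    ultimately show "?stat (path \<omega>) n = ?N / sqrt (ln n) * ?g (?A / ln n, ?N / ln n)"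
      unfolding fst_conv snd_conv p_hat_path_diff[OF n] by (metis times_divide_eq_right)
  qed
  then show ?thesis unfolding g using d by simp
qed

end

end

theorem theorem3p2:
  fixes M :: "'a measure" and p q :: real and X :: "nat \<Rightarrow> 'a \<Rightarrow> real"
    and K :: "nat \<Rightarrow> 'a \<Rightarrow> nat" and B :: "nat \<Rightarrow> 'a \<Rightarrow> bool"
  assumes "elephant_random_walk M p q X K B"
    and "p < 3 / 4"
  shows "converges_in_law M
           (\<lambda>n \<omega>. sqrt (ln (real n)) * (p_hat (\<lambda>k. X k \<omega>) n - p))
           (centered_gaussian ((3 - 4 * p) / 4))
       \<and> convergent (\<lambda>n. fisher_info M p q X n / ln (real n))
       \<and> asymptotic_fisher_info M p q X = 4 / (3 - 4 * p)
       \<and> (3 - 4 * p) / 4 = 1 / asymptotic_fisher_info M p q X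
       \<and> converges_in_law M
           (\<lambda>n \<omega>. 2 * sqrt (ln (real n)) * ((p_hat (\<lambda>k. X k \<omega>) n - p)
                     / sqrt (3 - 4 * p_hat (\<lambda>k. X k \<omega>) n)))
           (centered_gaussian 1)"
proof -
  interpret elephant_random_walk M p q X K B by fact
  have info: "asymptotic_fisher_info M p q X = 4 / (3 - 4 * p)"
    unfolding asymptotic_fisher_info_def by (rule limI[OF fisher_info_tendsto[OF assms(2)]])
  show ?thesis
    unfolding info
    using p_hat_converges_in_law[OF assms(2)] studentized_p_hat_converges_in_law[OF assms(2)]
      convergentI[OF fisher_info_tendsto[OF assms(2)]] by simp
qed

end
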